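(* Let $p,q$ be nonnegative integers and let $\ell=\min(p,q)$. Then the Loewy length of the $\mathfrak{gl}_\infty$-module $\mathbf V^{\otimes(p,q)}$ equals $\ell+1$, and $$\operatorname{soc}^{(r)}\mathbf V^{\otimes(p,q)}=\bigcap_{I_1,\dots,I_r}\ker\Big(\Phi_{I_1,\dots,I_r}:\mathbf V^{\otimes(p,q)}\to\mathbf V^{\otimes(p-r,q-r)}\Big),\qquad r=1,\dots,\ell,$$ where the intersection is over all collections of $r$ pairwise disjoint index pairs. Moreover, the socle filtration of $\mathbf V^{\otimes(p,q)}$ regarded as an $\mathfrak{sl}_\infty$-module coincides with this filtration.
   Context: $\Bbbk$ is a field of characteristic zero; everything is over $\Bbbk$. Let $\mathbf V,\mathbf V_*$ be countably infinite-dimensional vector spaces with a non-degenerate pairing $\langle\cdot,\cdot\rangle:\mathbf V\otimes\mathbf V_*\to\Bbbk$ (we also write $\langle u^*,v\rangle=\langle v,u^*\rangle$). $\mathfrak{gl}_\infty$ is the space $\mathbf V\otimes\mathbf V_*$ with Lie bracket $[u\otimes u^*,v\otimes v^*]=\langle u^*,v\rangle\,u\otimes v^*-\langle v^*,u\rangle\,v\otimes u^*$; $\mathfrak{sl}_\infty$ is the kernel of $\langle\cdot,\cdot\rangle$, a Lie subalgebra. $\mathfrak{gl}_\infty$ acts on $\mathbf V$ by $(u\otimes u^* )v=\langle u^*,v\rangle u$, on $\mathbf V_*$ by $(u\otimes u^* )v^*=-\langle v^*,u\rangle u^*$, and on $\mathbf V^{\otimes(p,q)}=\mathbf V^{\otimes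 p}\otimes\mathbf V_*^{\otimes q}$ by the Leibniz rule. An index pair is $I=(i,j)$ with $1\le i\le p$, $1\le j\le q$. Index pairs $I_1=(i_1,j_1),\dots,I_r=(i_r,j_r)$ are pairwise disjoint if the $i_k$ are distinct and the $j_k$ are distinct. For such a collection, $\Phi_{I_1,\dots,I_r}:\mathbf V^{\otimes(p,q)}\to\mathbf V^{\otimes(p-r,q-r)}$ is the $r$-fold contraction sending $v_1\otimes\dots\otimes v_p\otimes v_1^*\otimes\dots\otimes v_q^*$ to $\prod_k\langle v_{j_k}^*,v_{i_k}\rangle$ times the tensor obtained by omitting all $v_{i_k}$ and $v_{j_k}^*$. For a finite length module $M$, $\operatorname{soc}M$ is the sum of all simple submodules; the socle filtration is defined by $\operatorname{soc}^{(0)}M=0$ and $\operatorname{soc}^{(i+1)}M/\operatorname{soc}^{(i)}M=\operatorname{soc}(M/\operatorname{soc}^{(i)}M)$. The Loewy length is the smallest positive integer $l$ with $\operatorname{soc}^{(l)}M=M$. *)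

theory Defs
  imports
    Complex_Main
    "HOL-Algebra.Module"
    "HOL-Algebra.AbelCoset"
    "HOL-Library.Poly_Mapping"
    "HOL-Library.Countable_Set"
begin

section \<open>Modules over a Lie algebra and their socle filtration\<close>

text \<open>
  Vector spaces that live on a carrier set are \<open>module\<close> records of HOL-Algebra over the
  ring record of a field given by a type class. The ring fields \<open>mult\<close> and \<open>one\<close>
  of such a record carry no information.
\<close>

definition field_ring :: "'k::field ring" where
  "field_ring = \<lparr>carrier = UNIV, mult = (*), one = 1, zero = 0, add = (+)\<rparr>"

definition quotient_module ::
    "('k, 'm, 'c) module_scheme \<Rightarrow> 'm set \<Rightarrow> ('k, 'm set) module" where
  "quotient_module M N =
     \<lparr>carrier = a_rcosets\<^bsub>M\<^esub> N, mult = undefined, one = undefined, zero = N, add = set_add M,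
      smult = (\<lambda>a X. \<Union>x\<in>X. N +>\<^bsub>M\<^esub> (a \<odot>\<^bsub>M\<^esub> x))\<rparr>"

record ('k, 'x) lie_algebra = "('k, 'x) module" +
  bracket :: "'x \<Rightarrow> 'x \<Rightarrow> 'x"

record ('k, 'm, 'x) lie_module = "('k, 'm) module" +
  act :: "'x \<Rightarrow> 'm \<Rightarrow> 'm"

definition lie_submodule ::
    "('k::field, 'x, 'b) lie_algebra_scheme \<Rightarrow> ('k, 'm, 'x) lie_module \<Rightarrow> 'm set \<Rightarrow> bool" where
  "lie_submodule L M N \<longleftrightarrow>
     submodule N (field_ring :: 'k ring) M \<and> (\<forall>x\<in>carrier L. \<forall>m\<in>N. act M x m \<in> N)"

definition lie_quotient :: "('k, 'm, 'x) lie_module \<Rightarrow> 'm set \<Rightarrow> ('k, 'm set, 'x) lie_module" where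
  "lie_quotient M N =
     module.extend (quotient_module M N)
       (lie_module.fields (\<lambda>x X. \<Union>m\<in>X. N +>\<^bsub>M\<^esub> (act M x m)))"

definition simple_lie_module ::
    "('k::field, 'x, 'b) lie_algebra_scheme \<Rightarrow> ('k, 'm, 'x) lie_module \<Rightarrow> bool" where
  "simple_lie_module L M \<longleftrightarrow>
     carrier M \<noteq> {\<zero>\<^bsub>M\<^esub>} \<and>
     (\<forall>N. lie_submodule L M N \<longrightarrow> N = {\<zero>\<^bsub>M\<^esub>} \<or> N = carrier M)"

definition simple_submodules ::
    "('k::field, 'x, 'b) lie_algebra_scheme \<Rightarrow> ('k, 'm, 'x) lie_module \<Rightarrow> 'm set set" where
  "simple_submodules L M =
     {S. lie_submodule L M S \<and> simple_lie_module L (M\<lparr>carrier := S\<rparr>)}"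

definition socle ::
    "('k::field, 'x, 'b) lie_algebra_scheme \<Rightarrow> ('k, 'm, 'x) lie_module \<Rightarrow> 'm set" where
  "socle L M =
     {\<Oplus>\<^bsub>M\<^esub>S\<in>\<S>. f S | \<S> f. finite \<S> \<and> \<S> \<subseteq> simple_submodules L M \<and> f \<in> (\<Pi> S\<in>\<S>. S)}"

primrec socle_filtration ::
    "('k::field, 'x, 'b) lie_algebra_scheme \<Rightarrow> ('k, 'm, 'x) lie_module \<Rightarrow> nat \<Rightarrow> 'm set" where
  "socle_filtration L M 0 = {\<zero>\<^bsub>M\<^esub>}"
| "socle_filtration L M (Suc i) =
     {m \<in> carrier M. socle_filtration L M i +>\<^bsub>M\<^esub> m
                       \<in> socle L (lie_quotient M (socle_filtration L M i))}"

text \<open>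
  A relation rather than a function, so that nothing is claimed about modules whose socle
  filtration does not reach the whole module.
\<close>

definition has_loewy_length ::
    "('k::field, 'x, 'b) lie_algebra_scheme \<Rightarrow> ('k, 'm, 'x) lie_module \<Rightarrow> nat \<Rightarrow> bool" where
  "has_loewy_length L M l \<longleftrightarrow>
     0 < l \<and> socle_filtration L M l = carrier M \<and>
     (\<forall>k. 0 < k \<and> socle_filtration L M k = carrier M \<longrightarrow> l \<le> k)"

section \<open>Mixed tensor powers\<close>

locale countable_dual_pair =
  V: vector_space scaleV + W: vector_space scaleW
  for scaleV :: "'k::field_char_0 \<Rightarrow> 'v::ab_group_add \<Rightarrow> 'v"
    and scaleW :: "'k \<Rightarrow> 'w::ab_group_add \<Rightarrow> 'w" +
  fixes pairing :: "'v \<Rightarrow> 'w \<Rightarrow> 'k"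
  assumes linear_left: "\<And>w. Vector_Spaces.linear scaleV (*) (\<lambda>v. pairing v w)"
    and linear_right: "\<And>v. Vector_Spaces.linear scaleW (*) (\<lambda>w. pairing v w)"
    and nondegenerate_left: "\<And>v. (\<forall>w. pairing v w = 0) \<Longrightarrow> v = 0"
    and nondegenerate_right: "\<And>w. (\<forall>v. pairing v w = 0) \<Longrightarrow> w = 0"
    and countable_dim_left: "\<exists>B. countable B \<and> infinite B \<and> V.independent B \<and> V.span B = UNIV"
    and countable_dim_right: "\<exists>B. countable B \<and> infinite B \<and> W.independent B \<and> W.span B = UNIV"

text \<open>
  The tensor product of \<open>p\<close> copies of \<open>V\<close> and \<open>q\<close> copies of \<open>V\<^sub>*\<close> is the free vector space on
  pairs of lists \<open>(vs, ws)\<close> of lengths \<open>p\<close> and \<open>q\<close>, modulo multilinearity. Its elements are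
  therefore cosets in the type \<open>('v, 'w, 'k) prespace\<close>. Tensor positions are
  numbered from \<open>0\<close>.
\<close>

type_synonym ('v, 'w, 'k) prespace = "('v list \<times> 'w list) \<Rightarrow>\<^sub>0 'k"

definition prescale :: "'k::field \<Rightarrow> ('g \<Rightarrow>\<^sub>0 'k) \<Rightarrow> ('g \<Rightarrow>\<^sub>0 'k)" where
  "prescale c x = Poly_Mapping.map (\<lambda>a. c * a) x"

definition free_space :: "nat \<Rightarrow> nat \<Rightarrow> ('k::field, ('v, 'w, 'k) prespace) module" where
  "free_space p q =
     \<lparr>carrier = {x. \<forall>(vs, ws)\<in>Poly_Mapping.keys x. length vs = p \<and> length ws = q},
      mult = undefined, one = undefined, zero = 0, add = (+), smult = prescale\<rparr>"

definition multilinearity_relations ::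
    "('k::field \<Rightarrow> 'v::ab_group_add \<Rightarrow> 'v) \<Rightarrow> ('k \<Rightarrow> 'w::ab_group_add \<Rightarrow> 'w) \<Rightarrow>
     nat \<Rightarrow> nat \<Rightarrow> ('v, 'w, 'k) prespace set" where
  "multilinearity_relations scaleV scaleW p q =
     {Poly_Mapping.single (vs[i := a + b], ws) 1
        - Poly_Mapping.single (vs[i := a], ws) 1 - Poly_Mapping.single (vs[i := b], ws) 1
      | vs ws i a b. length vs = p \<and> length ws = q \<and> i < p} \<union>
     {Poly_Mapping.single (vs[i := scaleV c a], ws) 1 - Poly_Mapping.single (vs[i := a], ws) c
      | vs ws i c a. length vs = p \<and> length ws = q \<and> i < p} \<union>
     {Poly_Mapping.single (vs, ws[j := a + b]) 1
        - Poly_Mapping.single (vs, ws[j := a]) 1 - Poly_Mapping.single (vs, ws[j := b]) 1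
      | vs ws j a b. length vs = p \<and> length ws = q \<and> j < q} \<union>
     {Poly_Mapping.single (vs, ws[j := scaleW c a]) 1 - Poly_Mapping.single (vs, ws[j := a]) c
      | vs ws j c a. length vs = p \<and> length ws = q \<and> j < q}"

definition tensor_rel ::
    "('k::field \<Rightarrow> 'v::ab_group_add \<Rightarrow> 'v) \<Rightarrow> ('k \<Rightarrow> 'w::ab_group_add \<Rightarrow> 'w) \<Rightarrow>
     nat \<Rightarrow> nat \<Rightarrow> ('v, 'w, 'k) prespace set" where
  "tensor_rel scaleV scaleW p q =
     module.span prescale (multilinearity_relations scaleV scaleW p q)"

definition tensor_space ::
    "('k::field \<Rightarrow> 'v::ab_group_add \<Rightarrow> 'v) \<Rightarrow> ('k \<Rightarrow> 'w::ab_group_add \<Rightarrow> 'w) \<Rightarrow>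
     nat \<Rightarrow> nat \<Rightarrow> ('k, ('v, 'w, 'k) prespace set) module" where
  "tensor_space scaleV scaleW p q =
     quotient_module (free_space p q) (tensor_rel scaleV scaleW p q)"

definition tensor_class ::
    "('k::field \<Rightarrow> 'v::ab_group_add \<Rightarrow> 'v) \<Rightarrow> ('k \<Rightarrow> 'w::ab_group_add \<Rightarrow> 'w) \<Rightarrow>
     nat \<Rightarrow> nat \<Rightarrow> ('v, 'w, 'k) prespace \<Rightarrow> ('v, 'w, 'k) prespace set" where
  "tensor_class scaleV scaleW p q x = tensor_rel scaleV scaleW p q +>\<^bsub>free_space p q\<^esub> x"

text \<open>
  Linear and bilinear extension from generators. The operations on tensors below are the maps
  they induce on cosets; each union over representatives is a single coset, because
  the extended maps respect the multilinearity relations.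
\<close>

definition linear_extension :: "('g \<Rightarrow> ('h \<Rightarrow>\<^sub>0 'k)) \<Rightarrow> ('g \<Rightarrow>\<^sub>0 'k::field) \<Rightarrow> ('h \<Rightarrow>\<^sub>0 'k)" where
  "linear_extension f x =
     (\<Sum>g\<in>Poly_Mapping.keys x. prescale (Poly_Mapping.lookup x g) (f g))"

definition bilinear_extension ::
    "('g \<Rightarrow> 'h \<Rightarrow> ('l \<Rightarrow>\<^sub>0 'k)) \<Rightarrow> ('g \<Rightarrow>\<^sub>0 'k::field) \<Rightarrow> ('h \<Rightarrow>\<^sub>0 'k) \<Rightarrow> ('l \<Rightarrow>\<^sub>0 'k)" where
  "bilinear_extension f x y = linear_extension (\<lambda>g. linear_extension (f g) y) x"

section \<open>The Lie algebras \<open>gl\<^sub>\<infinity>\<close> and \<open>sl\<^sub>\<infinity>\<close> and their action on tensors\<close>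

text \<open>A generator \<open>u \<otimes> u\<^sup>*\<close> of \<open>gl\<^sub>\<infinity>\<close> is the pair of one-element lists \<open>([u], [u\<^sup>*])\<close>.\<close>

definition gl_bracket_gen ::
    "('v \<Rightarrow> 'w \<Rightarrow> 'k::field) \<Rightarrow> 'v list \<times> 'w list \<Rightarrow> 'v list \<times> 'w list \<Rightarrow> ('v, 'w, 'k) prespace" where
  "gl_bracket_gen pairing x y =
     (let u = hd (fst x); u' = hd (snd x); v = hd (fst y); v' = hd (snd y)
      in Poly_Mapping.single ([u], [v']) (pairing v u')
           - Poly_Mapping.single ([v], [u']) (pairing u v'))"

definition gl_act_gen ::
    "('v \<Rightarrow> 'w \<Rightarrow> 'k::field) \<Rightarrow> 'v list \<times> 'w list \<Rightarrow> 'v list \<times> 'w list \<Rightarrow> ('v, 'w, 'k) prespace" where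
  "gl_act_gen pairing x t =
     (let u = hd (fst x); u' = hd (snd x); vs = fst t; ws = snd t
      in (\<Sum>i<length vs. Poly_Mapping.single (vs[i := u], ws) (pairing (vs ! i) u'))
           - (\<Sum>j<length ws. Poly_Mapping.single (vs, ws[j := u']) (pairing u (ws ! j))))"

definition gl_infinity ::
    "('k::field \<Rightarrow> 'v::ab_group_add \<Rightarrow> 'v) \<Rightarrow> ('k \<Rightarrow> 'w::ab_group_add \<Rightarrow> 'w) \<Rightarrow>
     ('v \<Rightarrow> 'w \<Rightarrow> 'k) \<Rightarrow> ('k, ('v, 'w, 'k) prespace set) lie_algebra" where
  "gl_infinity scaleV scaleW pairing =
     module.extend (tensor_space scaleV scaleW 1 1)
       (lie_algebra.fields (\<lambda>X Y. \<Union>x\<in>X. \<Union>y\<in>Y. tensor_class scaleV scaleW 1 1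
          (bilinear_extension (gl_bracket_gen pairing) x y)))"

definition linear_pairing :: "('v \<Rightarrow> 'w \<Rightarrow> 'k::field) \<Rightarrow> ('v, 'w, 'k) prespace \<Rightarrow> 'k" where
  "linear_pairing pairing x =
     (\<Sum>g\<in>Poly_Mapping.keys x. Poly_Mapping.lookup x g * pairing (hd (fst g)) (hd (snd g)))"

definition sl_infinity ::
    "('k::field \<Rightarrow> 'v::ab_group_add \<Rightarrow> 'v) \<Rightarrow> ('k \<Rightarrow> 'w::ab_group_add \<Rightarrow> 'w) \<Rightarrow>
     ('v \<Rightarrow> 'w \<Rightarrow> 'k) \<Rightarrow> ('k, ('v, 'w, 'k) prespace set) lie_algebra" where
  "sl_infinity scaleV scaleW pairing =
     (gl_infinity scaleV scaleW pairing)
       \<lparr>carrier := {X \<in> carrier (gl_infinity scaleV scaleW pairing).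
                     \<forall>x\<in>X. linear_pairing pairing x = 0}\<rparr>"

definition mixed_tensors ::
    "('k::field \<Rightarrow> 'v::ab_group_add \<Rightarrow> 'v) \<Rightarrow> ('k \<Rightarrow> 'w::ab_group_add \<Rightarrow> 'w) \<Rightarrow>
     ('v \<Rightarrow> 'w \<Rightarrow> 'k) \<Rightarrow> nat \<Rightarrow> nat \<Rightarrow>
     ('k, ('v, 'w, 'k) prespace set, ('v, 'w, 'k) prespace set) lie_module" where
  "mixed_tensors scaleV scaleW pairing p q =
     module.extend (tensor_space scaleV scaleW p q)
       (lie_module.fields (\<lambda>X T. \<Union>x\<in>X. \<Union>t\<in>T. tensor_class scaleV scaleW p q
          (bilinear_extension (gl_act_gen pairing) x t)))"

section \<open>Contractions\<close>

definition disjoint_index_pairs :: "nat \<Rightarrow> nat \<Rightarrow> nat \<Rightarrow> (nat \<times> nat) list set" where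
  "disjoint_index_pairs p q r =
     {Is. length Is = r \<and> set Is \<subseteq> {..<p} \<times> {..<q} \<and>
          distinct (map fst Is) \<and> distinct (map snd Is)}"

definition contraction_gen ::
    "('v \<Rightarrow> 'w \<Rightarrow> 'k::field) \<Rightarrow> (nat \<times> nat) list \<Rightarrow> 'v list \<times> 'w list \<Rightarrow> ('v, 'w, 'k) prespace" where
  "contraction_gen pairing Is t =
     (let vs = fst t; ws = snd t
      in Poly_Mapping.single (nths vs (- fst ` set Is), nths ws (- snd ` set Is))
           (\<Prod>(i, j)\<leftarrow>Is. pairing (vs ! i) (ws ! j)))"

definition contraction ::
    "('k::field \<Rightarrow> 'v::ab_group_add \<Rightarrow> 'v) \<Rightarrow> ('k \<Rightarrow> 'w::ab_group_add \<Rightarrow> 'w) \<Rightarrow>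
     ('v \<Rightarrow> 'w \<Rightarrow> 'k) \<Rightarrow> nat \<Rightarrow> nat \<Rightarrow> (nat \<times> nat) list \<Rightarrow>
     ('v, 'w, 'k) prespace set \<Rightarrow> ('v, 'w, 'k) prespace set" where
  "contraction scaleV scaleW pairing p q Is T =
     (\<Union>t\<in>T. tensor_class scaleV scaleW (p - length Is) (q - length Is)
        (linear_extension (contraction_gen pairing Is) t))"

end

theory Submission
  imports Defs "HOL-Library.Function_Algebras" "HOL-Library.Groups_Big_Fun" "HOL-Combinatorics.Permutations"
begin

text \<open>
  Let \<open>F\<^sub>r\<close> be the common kernel of the \<open>r\<close>-fold contractions. They embed \<open>T/F\<^sub>r\<close> into a finite sum of
  copies of the mixed tensor power of type \<open>(p - r, q - r)\<close>, and \<open>F\<^sub>r\<^sub>+\<^sub>1\<close> is the preimage of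
  the traceless tensors. So it suffices that a finite sum of copies of a mixed tensor power \<open>Y\<close> has as its
  socle the submodule \<open>Y\<^sub>1\<close> of traceless families.

  Choose vectors and covectors \<open>u\<^sub>l\<close>, one for each tensor position \<open>l\<close>, that pair to zero with
  each other and with everything in sight. Products of rank one operators replace the tensor
  factors by these and evaluate the tensor at arbitrary arguments \<open>a\<close>; the result is the sum, over
  the permutations \<open>g\<close> of the positions that preserve their type, of the
  value of the tensor at \<open>a \<circ> g\<close> times the product of the \<open>u\<^sub>g\<^sub>l\<close>. It is traceless, and nonzero for some \<open>a\<close>.
  Hence every nonzero submodule of \<open>Y\<close> meets \<open>Y\<^sub>1\<close>. Conversely, a traceless tensor is recovered from
  these polarizations, because \<open>\<Sum>\<^sub>s E\<^sub>s\<^sub>u E\<^sub>u\<^sub>s\<close> acts on it by a nonzero scalar. So a submodule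
  of \<open>Y\<^sub>1\<close> is determined by the values of its members at the tuples \<open>a \<circ> g\<close>, which span a
  representation of the finite group of all \<open>g\<close>, and an invariant complement of the latter, which exists by
  Maschke's theorem, yields a complement of the submodule. All operators used lie in \<open>sl\<^sub>\<infinity>\<close>,
  whose submodules are therefore the same as those of \<open>gl\<^sub>\<infinity>\<close>.
\<close>

text \<open>Coordinates exist because both spaces have countable dimension: a non-degenerate pairing
  then admits dual bases, and every element of gl becomes a finite matrix. The scalar by which the
  sum over \<open>s\<close> acts is the number of positions of the given type that still carry an
  old index. It is a positive integer, and characteristic zero is used to divide by it and by the
  order of the permutation group. For a tensor with nonzero traces the same sum has further terms,
  in which two positions of opposite types carry the new label and the remaining factor is a trace.
  This is why only traceless tensors are recovered and why the filtration has several layers.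
  Families of tensors are treated instead of single ones, because only the joint map of all r-fold
  contractions has the common kernel as its kernel. The evaluations of a family lie in a space with
  basis \<open>I \<times> G\<close>, so chains of submodules of traceless families have bounded
  length, and this produces simple submodules.\<close>

definition fscale :: "'k::field \<Rightarrow> ('a \<Rightarrow> 'k) \<Rightarrow> 'a \<Rightarrow> 'k" where
  "fscale c f = (\<lambda>x. c * f x)"

lemma fscale_apply [simp]: "fscale c f x = c * f x"
  by (simp add: fscale_def)

interpretation fv: vector_space "fscale :: 'k::field \<Rightarrow> ('a \<Rightarrow> 'k) \<Rightarrow> 'a \<Rightarrow> 'k"
  by unfold_locales (auto simp: fscale_def fun_eq_iff algebra_simps)

interpretation fvp: vector_space_pair "fscale :: 'k::field \<Rightarrow> ('a \<Rightarrow> 'k) \<Rightarrow> 'a \<Rightarrow> 'k"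
  "fscale :: 'k::field \<Rightarrow> ('b \<Rightarrow> 'k) \<Rightarrow> 'b \<Rightarrow> 'k"
  by unfold_locales

lemma sum_apply: "(\<Sum>k\<in>A. f k :: 'a \<Rightarrow> 'b::comm_monoid_add) z = (\<Sum>k\<in>A. f k z)"
  by (induction A rule: infinite_finite_induct) auto

text \<open>The whole space may be infinite-dimensional, so finiteness enters only through a finite
  \<open>B\<close> whose span contains \<open>T\<close>. A basis of \<open>S\<close> enlarged by a
  vector of \<open>T\<close> outside \<open>S\<close> is still independent.\<close>

lemma (in vector_space) dim_psubset_lt:
  assumes "finite B" "T \<subseteq> span B" "subspace S" "S \<subseteq> T" "S \<noteq> T"
  shows "dim S < dim T"
proof -
  obtain BS where BS: "BS \<subseteq> S" "independent BS" "S \<subseteq> span BS" "card BS = dim S"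
    using basis_exists by blast
  have eq: "span BS = S"
    using BS assms(3) by (metis span_minimal subset_antisym)
  obtain x where x: "x \<in> T" "x \<notin> S" using assms by blast
  have ins: "independent (insert x BS)"
    using BS x eq by (simp add: independent_insert)
  have "insert x BS \<subseteq> T" using BS(1) x assms(4) by auto
  from maximal_independent_subset_extend[OF this ins]
  obtain BT where BT: "insert x BS \<subseteq> BT" "BT \<subseteq> T" "independent BT" "T \<subseteq> span BT"
    by blast
  have fin: "finite BT" using independent_span_bound[OF assms(1) BT(3)] BT assms by blast
  have "x \<notin> BS" using BS x by blast
  then have "card BS < card BT"
    using BT(1) fin by (intro psubset_card_mono) auto
  moreover have "dim T = card BT"
    using BT dim_unique by blast
  ultimately show ?thesis using BS by simp
qed

section \<open>Families of tensors in coordinates\<close>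

text \<open>
  With respect to dual bases \<open>e\<^sub>s\<close>, \<open>f\<^sub>s\<close> of \<open>V\<close> and \<open>V\<^sub>*\<close>, a mixed tensor is a finitely supported
  function of the index at each of its positions. Here \<open>x (i, b)\<close> is the coordinate of the \<open>i\<close>-th
  member of a family of tensors, and \<open>b\<close> gives an index to each position; only the values of \<open>b\<close>
  at the positions that are present matter. If \<open>A\<close> and \<open>B\<close> are the positions of
  type \<open>V\<close> and \<open>V\<^sub>*\<close>, then \<open>transfer_op A B s t\<close> is the action of the matrix unit \<open>e\<^sub>s \<otimes> f\<^sub>t\<close>.
\<close>

type_synonym ('i, 'p, 'k) tensor = "'i \<times> ('p \<Rightarrow> nat) \<Rightarrow> 'k"

definition transfer_op :: "'p set \<Rightarrow> 'p set \<Rightarrow> nat \<Rightarrow> nat \<Rightarrow> ('i, 'p, 'k::field) tensor \<Rightarrow> ('i, 'p, 'k) tensor"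
  where "transfer_op A B s t x =
    (\<lambda>(i, b). (\<Sum>k\<in>A. if b k = s then x (i, b(k := t)) else 0)
            - (\<Sum>k\<in>B. if b k = t then x (i, b(k := s)) else 0))"

text \<open>On a dual factor a matrix unit acts by minus its transpose, so exchanging the types of
  the positions exchanges \<open>s\<close> and \<open>t\<close> up to sign. This lets later proofs
  treat positions of both types alike.\<close>

lemma transfer_op_swap: "transfer_op B A s t x = - transfer_op A B t s x"
  by (auto simp: transfer_op_def fun_eq_iff)

lemma transfer_op_add:
  fixes x y :: "'i \<times> ('p \<Rightarrow> nat) \<Rightarrow> 'c::field"
  shows "transfer_op A B s t (x + y) = transfer_op A B s t x + transfer_op A B s t y"
proof -
  have "(\<Sum>k\<in>C. if b k = r then (x + y) (i, b(k := r')) else 0) =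
      (\<Sum>k\<in>C. if b k = r then x (i, b(k := r')) else 0) + (\<Sum>k\<in>C. if b k = r then y (i, b(k := r')) else 0)"
    for C :: "'p set" and r r' i b
    by (subst sum.distrib[symmetric]) (auto intro: sum.cong)
  then show ?thesis by (simp add: transfer_op_def fun_eq_iff)
qed

lemma transfer_op_scale: "transfer_op A B s t (fscale c x) = fscale c (transfer_op A B s t x)"
proof -
  show ?thesis
    by (auto simp: transfer_op_def fun_eq_iff sum_distrib_left right_diff_distrib
        intro!: arg_cong2[where f = "(-)"] sum.cong)
qed

lemma transfer_op_linear: "Vector_Spaces.linear fscale fscale (transfer_op A B s t)"
  by unfold_locales (auto simp: transfer_op_add transfer_op_scale)

definition trace_at :: "'p \<Rightarrow> 'p \<Rightarrow> ('i, 'p, 'k::field) tensor \<Rightarrow> ('i, 'p, 'k) tensor"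
  where "trace_at j k x = (\<lambda>(i, b). Sum_any (\<lambda>n. x (i, b(j := n, k := n))))"

text \<open>Boundedness can be asked only at positions in \<open>L\<close>: elsewhere
  \<open>b\<close> is arbitrary and \<open>x\<close> is constant in it. For finite \<open>I\<close>
  and \<open>L\<close> this is finite support modulo the values of \<open>b\<close> outside
  \<open>L\<close>.\<close>

definition tensors :: "'i set \<Rightarrow> 'p set \<Rightarrow> ('i, 'p, 'k::field) tensor set"
  where "tensors I L = {x. (\<forall>i b. x (i, b) \<noteq> 0 \<longrightarrow> i \<in> I) \<and>
    (\<forall>i b c. (\<forall>k\<in>L. b k = c k) \<longrightarrow> x (i, b) = x (i, c)) \<and>
    (\<exists>n. \<forall>i b. x (i, b) \<noteq> 0 \<longrightarrow> (\<forall>k\<in>L. b k < n))}"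

lemma tensorsD:
  assumes "x \<in> tensors I L"
  shows "x (i, b) \<noteq> 0 \<Longrightarrow> i \<in> I"
    and "(\<And>k. k \<in> L \<Longrightarrow> b k = c k) \<Longrightarrow> x (i, b) = x (i, c)"
  using assms by (auto simp: tensors_def)

lemma tensors_bound:
  assumes "x \<in> tensors I L"
  obtains n where "\<And>m i b k. n \<le> m \<Longrightarrow> x (i, b) \<noteq> 0 \<Longrightarrow> k \<in> L \<Longrightarrow> b k < m"
proof -
  obtain n where n: "\<And>i b k. x (i, b) \<noteq> 0 \<Longrightarrow> k \<in> L \<Longrightarrow> b k < n"
    using assms unfolding tensors_def by blast
  show thesis by (rule that[of n]) (use n less_le_trans in blast)
qed

lemma tensors_subspace: "fv.subspace (tensors I L :: ('i, 'p, 'k::field) tensor set)"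
proof (rule fv.subspaceI)
  show "0 \<in> tensors I L" by (auto simp: tensors_def)
next
  fix x y :: "('i, 'p, 'k) tensor"
  assume x: "x \<in> tensors I L" and y: "y \<in> tensors I L"
  obtain n where n: "\<And>m i b k. n \<le> m \<Longrightarrow> x (i, b) \<noteq> 0 \<Longrightarrow> k \<in> L \<Longrightarrow> b k < m" using tensors_bound[OF x] by blast
  obtain n' where n': "\<And>m i b k. n' \<le> m \<Longrightarrow> y (i, b) \<noteq> 0 \<Longrightarrow> k \<in> L \<Longrightarrow> b k < m" using tensors_bound[OF y] by blast
  have "\<forall>i b. (x + y) (i, b) \<noteq> 0 \<longrightarrow> (\<forall>k\<in>L. b k < max n n')"
  proof (intro allI impI ballI)
    fix i b k assume nz: "(x + y) (i, b) \<noteq> 0" and k: "k \<in> L"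
    from nz have "x (i, b) \<noteq> 0 \<or> y (i, b) \<noteq> 0" by auto
    then show "b k < max n n'" using n[of "max n n'" i b k] n'[of "max n n'" i b k] k by auto
  qed
  moreover have "(x + y) (i, b) \<noteq> 0 \<longrightarrow> i \<in> I" for i b
    using tensorsD(1)[OF x, of i b] tensorsD(1)[OF y, of i b] by (cases "x (i, b) = 0") auto
  moreover have "(\<forall>k\<in>L. b k = c k) \<longrightarrow> (x + y) (i, b) = (x + y) (i, c)" for i b c
    using tensorsD(2)[OF x, of b c i] tensorsD(2)[OF y, of b c i] by auto
  ultimately show "x + y \<in> tensors I L" unfolding tensors_def by blast
next
  fix c and x :: "('i, 'p, 'k) tensor" assume x: "x \<in> tensors I L"
  then obtain n where n: "\<And>m i b k. n \<le> m \<Longrightarrow> x (i, b) \<noteq> 0 \<Longrightarrow> k \<in> L \<Longrightarrow> b k < m" using tensors_bound by blast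
  have "\<forall>i b. fscale c x (i, b) \<noteq> 0 \<longrightarrow> (\<forall>k\<in>L. b k < n)" using n by auto
  moreover have "(\<forall>k\<in>L. b k = c k) \<longrightarrow> fscale d x (i, b) = fscale d x (i, c)" for i b c d
    using tensorsD(2)[OF x, of b c i] by auto
  moreover have "fscale c x (i, b) \<noteq> 0 \<longrightarrow> i \<in> I" for i b using tensorsD(1)[OF x, of i b] by auto
  ultimately show "fscale c x \<in> tensors I L" unfolding tensors_def by blast
qed

lemma Sum_any_bounded:
  fixes f :: "nat \<Rightarrow> 'k::comm_monoid_add"
  assumes "\<And>k. f k \<noteq> 0 \<Longrightarrow> k < n"
  shows "Sum_any f = (\<Sum>k<n. f k)"
  by (rule Sum_any.expand_superset) (use assms in auto)

lemma trace_at_bounded: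
  assumes "\<And>i b k. x (i, b) \<noteq> 0 \<Longrightarrow> k \<in> L \<Longrightarrow> b k < n" "j \<in> L"  "j \<noteq> k"
  shows "trace_at j k x (i, b) = (\<Sum>m<n. x (i, b(j := m, k := m)))"
  unfolding trace_at_def prod.case
proof (rule Sum_any_bounded)
  fix m assume "x (i, b(j := m, k := m)) \<noteq> 0"
  from assms(1)[OF this assms(2)] assms(3) show "m < n" by simp
qed

lemma trace_at_commute: "j \<noteq> k \<Longrightarrow> trace_at j k = trace_at k j"
  unfolding trace_at_def by (auto simp: fun_upd_twist)

text \<open>\<open>Sum_any\<close> is zero when infinitely many terms are nonzero, so additivity is
  stated for members of \<open>tensors\<close>; there all sums run below a common bound.\<close>

lemma trace_at_add:
  assumes x: "x \<in> tensors I L" and y: "y \<in> tensors I L" and jk: "j \<in> L" "j \<noteq> k"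
  shows "trace_at j k (x + y) = trace_at j k x + trace_at j k y"
proof -
  obtain n where n: "\<And>m i b k. n \<le> m \<Longrightarrow> x (i, b) \<noteq> 0 \<Longrightarrow> k \<in> L \<Longrightarrow> b k < m" using tensors_bound[OF x] by blast
  obtain n' where n': "\<And>m i b k. n' \<le> m \<Longrightarrow> y (i, b) \<noteq> 0 \<Longrightarrow> k \<in> L \<Longrightarrow> b k < m" using tensors_bound[OF y] by blast
  have xy: "x + y \<in> tensors I L" using tensors_subspace x y by (rule fv.subspace_add)
  obtain n'' where n'': "\<And>m i b k. n'' \<le> m \<Longrightarrow> (x+y) (i, b) \<noteq> 0 \<Longrightarrow> k \<in> L \<Longrightarrow> b k < m" using tensors_bound[OF xy] by blast
  define N where "N = max n (max n' n'')"
  have "trace_at j k (x + y) (i, b) = (trace_at j k x + trace_at j k y) (i, b)" for i b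
  proof -
    have "trace_at j k (x + y) (i, b) = (\<Sum>m<N. (x + y) (i, b(j := m, k := m)))"
      by (rule trace_at_bounded[of _ L]) (use n''[of N] jk in \<open>auto simp: N_def\<close>)
    moreover have "trace_at j k x (i, b) = (\<Sum>m<N. x (i, b(j := m, k := m)))"
      by (rule trace_at_bounded[of _ L]) (use n[of N] jk in \<open>auto simp: N_def\<close>)
    moreover have "trace_at j k y (i, b) = (\<Sum>m<N. y (i, b(j := m, k := m)))"
      by (rule trace_at_bounded[of _ L]) (use n'[of N] jk in \<open>auto simp: N_def\<close>)
    ultimately show ?thesis by (simp add: sum.distrib)
  qed
  then show ?thesis by (auto simp: fun_eq_iff)
qed

lemma trace_at_scale:
  fixes x :: "'i \<times> ('p \<Rightarrow> nat) \<Rightarrow> 'c::field"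
  shows "trace_at j k (fscale c x) = fscale c (trace_at j k x)"
proof (cases "c = 0")
  case True then show ?thesis by (auto simp: trace_at_def fun_eq_iff)
next
  case False
  have "Sum_any (\<lambda>n. c * g n) = c * Sum_any g" for g :: "nat \<Rightarrow> 'c"
    unfolding Sum_any.expand_set using False by (simp add: sum_distrib_left)
  then show ?thesis by (auto simp: trace_at_def fun_eq_iff)
qed

text \<open>The terms of \<open>transfer_op\<close> at the two contracted positions cancel.\<close>

lemma trace_at_transfer_op:
  assumes x: "x \<in> tensors I (A \<union> B)" and fin: "finite A" "finite B" and dis: "A \<inter> B = {}"
    and jk: "j \<in> A" "k \<in> B"
  shows "trace_at j k (transfer_op A B s t x) = transfer_op (A - {j}) (B - {k}) s t (trace_at j k x)"
proof -
  obtain n0 where n0: "\<And>m i b k. n0 \<le> m \<Longrightarrow> x (i, b) \<noteq> 0 \<Longrightarrow> k \<in> A \<union> B \<Longrightarrow> b k < m"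
    using tensors_bound[OF x] by blast
  define n where "n = Suc (max n0 (max s t))"
  have n: "x (i, b) \<noteq> 0 \<Longrightarrow> k \<in> A \<union> B \<Longrightarrow> b k < n" for i b k using n0[of n] by (auto simp: n_def)
  have st: "s < n" "t < n" by (auto simp: n_def)
  have jk': "j \<noteq> k" using jk dis by auto
  have tr: "trace_at j k x (i, b) = (\<Sum>m<n. x (i, b(j := m, k := m)))" for i b
    by (rule trace_at_bounded[of _ "A \<union> B"]) (use n jk jk' in auto)
  show ?thesis
  proof (intro ext, clarify)
    fix i b
    \<comment> \<open>Each term changes the index at one position only, so at least one of
      \<open>j\<close> and \<open>k\<close> keeps the value \<open>m\<close>. Beyond the bound
      \<open>n\<close> the term vanishes, and the trace is a finite sum.\<close>
    have nE: "m < n" if "transfer_op A B s t x (i, b(j := m, k := m)) \<noteq> 0" for m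
    proof (rule ccontr)
      assume m: "\<not> m < n"
      have "(\<Sum>l\<in>A. if (b(j := m, k := m)) l = s then x (i, (b(j := m, k := m))(l := t)) else 0) = 0"
      proof (rule sum.neutral, rule ballI)
        fix l assume l: "l \<in> A"
        then have "l \<noteq> k" using dis jk by auto
        then show "(if (b(j := m, k := m)) l = s then x (i, (b(j := m, k := m))(l := t)) else 0) = 0"
          using n[of i "(b(j := m, k := m))(l := t)" k] m jk jk' st by (auto simp: fun_upd_twist)
      qed
      moreover have "(\<Sum>l\<in>B. if (b(j := m, k := m)) l = t then x (i, (b(j := m, k := m))(l := s)) else 0) = 0"
      proof (rule sum.neutral, rule ballI)
        fix l assume l: "l \<in> B"
        then have "l \<noteq> j" using dis jk by auto
        then show "(if (b(j := m, k := m)) l = t then x (i, (b(j := m, k := m))(l := s)) else 0) = 0"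
          using n[of i "(b(j := m, k := m))(l := s)" j] m jk jk' st by (auto simp: fun_upd_twist)
      qed
      ultimately show False using that by (simp add: transfer_op_def)
    qed
    have "trace_at j k (transfer_op A B s t x) (i, b) = (\<Sum>m<n. transfer_op A B s t x (i, b(j := m, k := m)))"
      unfolding trace_at_def prod.case by (rule Sum_any_bounded) (use nE in auto)
    also have "\<dots> = (\<Sum>m<n. (\<Sum>l\<in>A. if (b(j := m, k := m)) l = s then x (i, (b(j := m, k := m))(l := t)) else 0))
       - (\<Sum>m<n. (\<Sum>l\<in>B. if (b(j := m, k := m)) l = t then x (i, (b(j := m, k := m))(l := s)) else 0))"
      by (simp add: transfer_op_def sum_subtractf)
    also have "(\<Sum>m<n. (\<Sum>l\<in>A. if (b(j := m, k := m)) l = s then x (i, (b(j := m, k := m))(l := t)) else 0))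
      = (\<Sum>l\<in>A - {j}. if b l = s then trace_at j k x (i, b(l := t)) else 0) + x (i, b(j := t, k := s))" (is "?L = _")
    proof -
      have "?L = (\<Sum>l\<in>A. \<Sum>m<n. if (b(j := m, k := m)) l = s then x (i, (b(j := m, k := m))(l := t)) else 0)"
        by (rule sum.swap)
      also have "\<dots> = (\<Sum>m<n. if (b(j := m, k := m)) j = s then x (i, (b(j := m, k := m))(j := t)) else 0)
          + (\<Sum>l\<in>A-{j}. \<Sum>m<n. if (b(j := m, k := m)) l = s then x (i, (b(j := m, k := m))(l := t)) else 0)"
        using fin jk by (simp add: sum.remove)
      \<comment> \<open>At the position \<open>j\<close> only \<open>m = s\<close> contributes and
        leaves \<open>t\<close> at \<open>j\<close> and \<open>s\<close> at \<open>k\<close>. In the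
        second sum the position \<open>k\<close> contributes for \<open>m = t\<close> only and
        leaves the same entry.\<close>
      also have "(\<Sum>m<n. if (b(j := m, k := m)) j = s then x (i, (b(j := m, k := m))(j := t)) else 0)
        = (\<Sum>m<n. if m = s then x (i, b(j := t, k := s)) else 0)"
        using jk' by (intro sum.cong refl) (auto simp: fun_upd_twist)
      also have "\<dots> = x (i, b(j := t, k := s))" using st by simp
      also have "(\<Sum>l\<in>A-{j}. \<Sum>m<n. if (b(j := m, k := m)) l = s then x (i, (b(j := m, k := m))(l := t)) else 0)
        = (\<Sum>l\<in>A - {j}. if b l = s then trace_at j k x (i, b(l := t)) else 0)"
      proof (rule sum.cong[OF refl])
        fix l assume l: "l \<in> A - {j}"
        then have "l \<noteq> k" "l \<noteq> j" using jk dis by auto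
        then show "(\<Sum>m<n. if (b(j := m, k := m)) l = s then x (i, (b(j := m, k := m))(l := t)) else 0)
          = (if b l = s then trace_at j k x (i, b(l := t)) else 0)"
          by (simp add: tr fun_upd_twist)
      qed
      finally show ?thesis by (simp only: add.commute)
    qed
    also have "(\<Sum>m<n. (\<Sum>l\<in>B. if (b(j := m, k := m)) l = t then x (i, (b(j := m, k := m))(l := s)) else 0))
      = (\<Sum>l\<in>B - {k}. if b l = t then trace_at j k x (i, b(l := s)) else 0) + x (i, b(j := t, k := s))" (is "?L = _")
    proof -
      have "?L = (\<Sum>l\<in>B. \<Sum>m<n. if (b(j := m, k := m)) l = t then x (i, (b(j := m, k := m))(l := s)) else 0)"
        by (rule sum.swap)
      also have "\<dots> = (\<Sum>m<n. if (b(j := m, k := m)) k = t then x (i, (b(j := m, k := m))(k := s)) else 0)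
          + (\<Sum>l\<in>B-{k}. \<Sum>m<n. if (b(j := m, k := m)) l = t then x (i, (b(j := m, k := m))(l := s)) else 0)"
        using fin jk by (simp add: sum.remove)
      also have "(\<Sum>m<n. if (b(j := m, k := m)) k = t then x (i, (b(j := m, k := m))(k := s)) else 0)
        = (\<Sum>m<n. if m = t then x (i, b(j := t, k := s)) else 0)"
        using jk' by (intro sum.cong refl) (auto simp: fun_upd_twist)
      also have "\<dots> = x (i, b(j := t, k := s))" using st by simp
      also have "(\<Sum>l\<in>B-{k}. \<Sum>m<n. if (b(j := m, k := m)) l = t then x (i, (b(j := m, k := m))(l := s)) else 0)
        = (\<Sum>l\<in>B - {k}. if b l = t then trace_at j k x (i, b(l := s)) else 0)"
      proof (rule sum.cong[OF refl])
        fix l assume l: "l \<in> B - {k}"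
        then have "l \<noteq> k" "l \<noteq> j" using jk dis by auto
        then show "(\<Sum>m<n. if (b(j := m, k := m)) l = t then x (i, (b(j := m, k := m))(l := s)) else 0)
          = (if b l = t then trace_at j k x (i, b(l := s)) else 0)"
          by (simp add: tr fun_upd_twist)
      qed
      finally show ?thesis by (simp only: add.commute)
    qed
    also have "(\<Sum>l\<in>A - {j}. if b l = s then trace_at j k x (i, b(l := t)) else 0) + x (i, b(j := t, k := s))
        - ((\<Sum>l\<in>B - {k}. if b l = t then trace_at j k x (i, b(l := s)) else 0) + x (i, b(j := t, k := s)))
      = transfer_op (A - {j}) (B - {k}) s t (trace_at j k x) (i, b)"
      by (simp only: transfer_op_def prod.case add_diff_cancel_right)
    finally show "trace_at j k (transfer_op A B s t x) (i, b) = transfer_op (A - {j}) (B - {k}) s t (trace_at j k x) (i, b)" .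
  qed
qed

lemma transfer_op_tensors:
  assumes x: "x \<in> tensors I L" and L: "A \<union> B = L" and fin: "finite L"
  shows "transfer_op A B s t x \<in> tensors I L"
proof -
  obtain n where n: "\<And>m i b k. n \<le> m \<Longrightarrow> x (i, b) \<noteq> 0 \<Longrightarrow> k \<in> L \<Longrightarrow> b k < m" using tensors_bound[OF x] by blast
  define N where "N = Suc (max n (max s t))"
  have nz: "i \<in> I \<and> (\<forall>k\<in>L. b k < N)" if "transfer_op A B s t x (i, b) \<noteq> 0" for i b
  proof -
    from that have "(\<Sum>k\<in>A. if b k = s then x (i, b(k := t)) else 0) \<noteq> 0 \<or>
       (\<Sum>k\<in>B. if b k = t then x (i, b(k := s)) else 0) \<noteq> 0" by (auto simp: transfer_op_def)
    then have "\<exists>k\<in>L. (b k = s \<and> x (i, b(k:=t)) \<noteq> 0) \<or> (b k = t \<and> x (i, b(k := s)) \<noteq> 0)"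
      using L by (auto elim!: sum.not_neutral_contains_not_neutral split: if_splits)
    then obtain k r where k: "k \<in> L" "b k < N" "x (i, b(k:=r)) \<noteq> 0" by (auto simp: N_def)
    have "b l < N" if "l \<in> L" for l
      using n[of N i "b(k:=r)" l] k that by (cases "l = k") (auto simp: N_def)
    then show ?thesis using tensorsD(1)[OF x k(3)] by auto
  qed
  have "transfer_op A B s t x (i, b) = transfer_op A B s t x (i, c)" if bc: "\<forall>k\<in>L. b k = c k" for i b c
  proof -
    have e: "x (i, b(k := r)) = x (i, c(k := r))" for k r
      by (rule tensorsD(2)[OF x]) (use bc in auto)
    have "(\<Sum>k\<in>A. if b k = s then x (i, b(k := t)) else 0) = (\<Sum>k\<in>A. if c k = s then x (i, c(k := t)) else 0)"
      using bc L by (intro sum.cong) (auto simp: e)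
    moreover have "(\<Sum>k\<in>B. if b k = t then x (i, b(k := s)) else 0) = (\<Sum>k\<in>B. if c k = t then x (i, c(k := s)) else 0)"
      using bc L by (intro sum.cong) (auto simp: e)
    ultimately show ?thesis by (simp add: transfer_op_def)
  qed
  then show ?thesis using nz unfolding tensors_def by blast
qed


section \<open>The action split over positions, and commutators of matrix units\<close>

definition site_op :: "'p set \<Rightarrow> 'p \<Rightarrow> nat \<Rightarrow> nat \<Rightarrow> ('i, 'p, 'k::field) tensor \<Rightarrow> ('i, 'p, 'k) tensor"
  where "site_op A k s t x = (\<lambda>(i, b).
    if k \<in> A then (if b k = s then x (i, b(k := t)) else 0)
    else - (if b k = t then x (i, b(k := s)) else 0))"

lemma transfer_op_site_op:
  assumes "finite A" "finite B" "A \<inter> B = {}"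
  shows "transfer_op A B s t x (i, b) = (\<Sum>k\<in>A \<union> B. site_op A k s t x (i, b))"
proof -
  have "(\<Sum>k\<in>A. site_op A k s t x (i, b)) = (\<Sum>k\<in>A. if b k = s then x (i, b(k := t)) else 0)"
    by (rule sum.cong) (auto simp: site_op_def)
  moreover have "(\<Sum>k\<in>B. site_op A k s t x (i, b)) = (\<Sum>k\<in>B. - (if b k = t then x (i, b(k := s)) else 0))"
    using assms by (intro sum.cong) (auto simp: site_op_def)
  ultimately show ?thesis
    using assms by (simp add: sum.union_disjoint transfer_op_def sum_negf)
qed

lemma site_op_sum:
  "site_op A k s t (\<lambda>(i, b). \<Sum>l\<in>C. f l (i, b)) (i, b) = (\<Sum>l\<in>C. site_op A k s t (f l) (i, b))"
  by (auto simp: site_op_def sum_negf)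

lemma transfer_op_twice:
  assumes "finite A" "finite B" "A \<inter> B = {}"
  shows "transfer_op A B s t (transfer_op A B s' t' x) (i, b) =
    (\<Sum>k\<in>A \<union> B. \<Sum>l\<in>A \<union> B. site_op A k s t (site_op A l s' t' x) (i, b))"
proof -
  have e: "transfer_op A B s' t' x = (\<lambda>(i, b). \<Sum>l\<in>A \<union> B. site_op A l s' t' x (i, b))"
    using transfer_op_site_op[OF assms] by (auto simp: fun_eq_iff)
  show ?thesis
    unfolding transfer_op_site_op[OF assms, of s t] e
    by (rule sum.cong[OF refl], rule site_op_sum[where f = "\<lambda>l. site_op A l s' t' x"])
qed

lemma site_op_commute:
  assumes "k \<noteq> l"
  shows "site_op A k s t (site_op A l s' t' x) = site_op A l s' t' (site_op A k s t x)"
  using assms by (auto simp: site_op_def fun_eq_iff fun_upd_twist)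

lemma site_op_commutator:
  assumes "s \<noteq> t"
  shows "site_op A k s t (site_op A k t s x) (i, b) - site_op A k t s (site_op A k s t x) (i, b)
    = site_op A k s s x (i, b) - site_op A k t t x (i, b)"
  using assms by (auto simp: site_op_def fun_upd_idem)

text \<open>Contributions at distinct positions commute, so the double sum reduces to its diagonal,
  where the relation is that of matrix units on a single factor.\<close>

lemma transfer_op_commutator:
  assumes AB: "finite A" "finite B" "A \<inter> B = {}" and st: "s \<noteq> t"
  shows "transfer_op A B s t (transfer_op A B t s x) - transfer_op A B t s (transfer_op A B s t x)
    = transfer_op A B s s x - transfer_op A B t t x"
proof (intro ext, clarify)
  fix i b
  let ?L = "A \<union> B"
  have "(transfer_op A B s t (transfer_op A B t s x) - transfer_op A B t s (transfer_op A B s t x)) (i, b)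
    = (\<Sum>k\<in>?L. \<Sum>l\<in>?L. site_op A k s t (site_op A l t s x) (i, b)) -
      (\<Sum>k\<in>?L. \<Sum>l\<in>?L. site_op A k t s (site_op A l s t x) (i, b))"
    by (simp add: transfer_op_twice[OF AB])
  also have "(\<Sum>k\<in>?L. \<Sum>l\<in>?L. site_op A k t s (site_op A l s t x) (i, b))
    = (\<Sum>l\<in>?L. \<Sum>k\<in>?L. site_op A k t s (site_op A l s t x) (i, b))" by (rule sum.swap)
  also have "(\<Sum>k\<in>?L. \<Sum>l\<in>?L. site_op A k s t (site_op A l t s x) (i, b)) - \<dots>
    = (\<Sum>k\<in>?L. \<Sum>l\<in>?L. site_op A k s t (site_op A l t s x) (i, b) - site_op A l t s (site_op A k s t x) (i, b))"
    by (simp add: sum_subtractf)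
  also have "\<dots> = (\<Sum>k\<in>?L. \<Sum>l\<in>?L. if k = l then site_op A k s s x (i, b) - site_op A k t t x (i, b) else 0)"
    by (intro sum.cong refl) (use site_op_commutator[OF st] in \<open>auto simp: site_op_commute\<close>)
  also have "\<dots> = (\<Sum>k\<in>?L. site_op A k s s x (i, b) - site_op A k t t x (i, b))"
    using AB by simp
  also have "\<dots> = (transfer_op A B s s x - transfer_op A B t t x) (i, b)"
    using AB by (simp add: transfer_op_site_op sum_subtractf)
  finally show "(transfer_op A B s t (transfer_op A B t s x) - transfer_op A B t s (transfer_op A B s t x)) (i, b)
    = (transfer_op A B s s x - transfer_op A B t t x) (i, b)" .
qed

section \<open>Families of tensors and their submodules\<close>

locale tensor_family =
  fixes I :: "'i set" and P Q :: "'p set"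
  assumes finite_I: "finite I" and finite_P: "finite P" and finite_Q: "finite Q"
    and disjoint: "P \<inter> Q = {}"
begin

abbreviation L :: "'p set" where "L \<equiv> P \<union> Q"

lemma finite_L: "finite L" using finite_P finite_Q by simp

text \<open>Stability is asked for off-diagonal matrix units only. These lie in both
  \<open>sl_infinity\<close> and \<open>gl_infinity\<close>, so one notion serves both Lie
  algebras.\<close>

definition submod :: "('i, 'p, 'k::field_char_0) tensor set \<Rightarrow> bool" where
  "submod N \<longleftrightarrow> fv.subspace N \<and> N \<subseteq> tensors I L \<and>
     (\<forall>s t x. s \<noteq> t \<longrightarrow> x \<in> N \<longrightarrow> transfer_op P Q s t x \<in> N)"

lemma submodD:
  assumes "submod N"
  shows "fv.subspace N" "x \<in> N \<Longrightarrow> x \<in> tensors I L"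
    "s \<noteq> t \<Longrightarrow> x \<in> N \<Longrightarrow> transfer_op P Q s t x \<in> N"
  using assms by (auto simp: submod_def)

text \<open>A diagonal matrix unit comes from a commutator: with \<open>r\<close> beyond all indices
  of \<open>x\<close>, the unit at \<open>(r, r)\<close> kills \<open>x\<close>, so the unit at
  \<open>(s, s)\<close> acts on \<open>x\<close> as the commutator of those at \<open>(s, r)\<close>
  and \<open>(r, s)\<close>.\<close>

lemma submod_transfer_op:
  assumes N: "submod N" and x: "x \<in> N"
  shows "transfer_op P Q s t x \<in> N"
proof (cases "s = t")
  case False
  then show ?thesis using submodD[OF N] x by simp
next
  case True
  obtain n where n: "\<And>m i b k. n \<le> m \<Longrightarrow> x (i, b) \<noteq> 0 \<Longrightarrow> k \<in> L \<Longrightarrow> b k < m"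
    using tensors_bound[OF submodD(2)[OF N x]] by blast
  define r where "r = Suc (max n s)"
  have r: "r \<noteq> s" "n \<le> r" by (auto simp: r_def)
  have 0: "x (i, b(k := r)) = 0" if "k \<in> L" for i b k
    using n[OF r(2), of i "b(k := r)" k] that by auto
  have "transfer_op P Q r r x (i, b) = 0" for i b
    unfolding transfer_op_def prod.case by (subst (1 2) sum.neutral) (auto simp: 0)
  then have "transfer_op P Q r r x = 0" by (auto simp: fun_eq_iff)
  with transfer_op_commutator[OF finite_P finite_Q disjoint, of s r x] r
  have "transfer_op P Q s s x = transfer_op P Q s r (transfer_op P Q r s x) - transfer_op P Q r s (transfer_op P Q s r x)"
    by simp
  also have "\<dots> \<in> N"
    using submodD[OF N] x r by (intro fv.subspace_diff) auto
  finally show ?thesis using True by simp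
qed

text \<open>Seen from \<open>l\<close>, its own type plays the part of \<open>V\<close>. With these
  sets \<open>transfer_op (same l) (other l)\<close> is a matrix unit up to sign, and polarization
  need not distinguish the two types.\<close>

definition same :: "'p \<Rightarrow> 'p set" where "same l = (if l \<in> P then P else Q)"
definition other :: "'p \<Rightarrow> 'p set" where "other l = (if l \<in> P then Q else P)"

lemma same_other:
  assumes "l \<in> L"
  shows "l \<in> same l" "same l \<union> other l = L" "same l \<inter> other l = {}" "finite (same l)" "finite (other l)"
    "same l \<subseteq> L" "other l \<subseteq> L"
  using assms disjoint finite_P finite_Q by (auto simp: same_def other_def)

lemma submod_same_other:
  assumes "submod N" "x \<in> N"
  shows "transfer_op (same l) (other l) s t x \<in> N"
proof (cases "l \<in> P")
  case False
  have "- transfer_op P Q t s x \<in> N"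
    using submod_transfer_op assms submodD(1) by (blast intro: fv.subspace_neg)
  then show ?thesis using False by (simp add: same_def other_def transfer_op_swap[of Q P])
qed (use submod_transfer_op assms in \<open>auto simp: same_def other_def\<close>)

section \<open>Polarization\<close>

text \<open>
  \<open>polarize u a S\<close> is, up to sign, the product of the matrix units that replace the index \<open>a l\<close> by the new
  index \<open>u l\<close>, for \<open>l \<in> S\<close>. Since \<open>u l\<close> is fresh, a coordinate of the result can be nonzero only if
  \<open>u l\<close> occurs exactly once and at a position of the type of \<open>l\<close>; putting \<open>a l\<close> back
  at that position then gives the corresponding coordinate of the original tensor.
\<close>

definition marked :: "('p \<Rightarrow> nat) \<Rightarrow> 'p set \<Rightarrow> ('p \<Rightarrow> nat) \<Rightarrow> bool" where
  "marked u S b \<longleftrightarrow> (\<forall>l\<in>S. \<exists>k\<in>same l. \<forall>k'\<in>L. b k' = u l \<longleftrightarrow> k' = k)"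

definition unmark :: "('p \<Rightarrow> nat) \<Rightarrow> ('p \<Rightarrow> nat) \<Rightarrow> 'p set \<Rightarrow> ('p \<Rightarrow> nat) \<Rightarrow> ('p \<Rightarrow> nat)" where
  "unmark u a S b = (\<lambda>k. if b k \<in> u ` S then a (inv_into S u (b k)) else b k)"

definition polarize ::
  "('p \<Rightarrow> nat) \<Rightarrow> ('p \<Rightarrow> nat) \<Rightarrow> 'p set \<Rightarrow> ('i, 'p, 'k::field_char_0) tensor \<Rightarrow> ('i, 'p, 'k) tensor" where
  "polarize u a S x = (\<lambda>(i, b). if marked u S b then x (i, unmark u a S b) else 0)"

lemma unmark_eq: "inj_on u S \<Longrightarrow> l \<in> S \<Longrightarrow> b k = u l \<Longrightarrow> unmark u a S b k = a l"
  by (simp add: unmark_def)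

lemma unmark_same: "b k \<notin> u ` S \<Longrightarrow> unmark u a S b k = b k"
  by (simp add: unmark_def)

lemma polarize_empty: "polarize u a {} x = x"
  by (auto simp: polarize_def marked_def unmark_def)

lemma polarize_support:
  assumes "\<And>i b k. x (i, b) \<noteq> 0 \<Longrightarrow> k \<in> L \<Longrightarrow> b k \<in> Z"
    and "polarize u a S x (i, b) \<noteq> 0" "k \<in> L"
  shows "b k \<in> Z \<union> u ` S"
proof (cases "b k \<in> u ` S")
  case False
  have "x (i, unmark u a S b) \<noteq> 0" using assms(2) by (auto simp: polarize_def split: if_splits)
  from assms(1)[OF this assms(3)] show ?thesis using False by (simp add: unmark_same)
qed simp

text \<open>The label \<open>u l\<close> does not occur in \<open>polarize u a S x\<close>, so the
  subtracted sum, which would read it, vanishes. In the first sum some position carries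
  \<open>u l\<close>, and no second one can, since it would still be read there. As \<open>s\<close>
  is not a label, writing it back neither creates nor destroys a mark of \<open>S\<close>.\<close>

lemma polarize_step:
  assumes x: "x \<in> tensors I L"
    and Z: "\<And>i b k. x (i, b) \<noteq> 0 \<Longrightarrow> k \<in> L \<Longrightarrow> b k \<in> Z"
    and u: "inj_on u L" "u ` L \<inter> Z = {}"
    and S: "S \<subseteq> L" and l: "l \<in> L" "l \<notin> S" and s: "s \<notin> u ` L"
  shows "transfer_op (same l) (other l) (u l) s (polarize u a S x) = polarize u (a(l := s)) (insert l S) x"
proof (intro ext, clarify)
  fix i b
  note so = same_other[OF l(1)]
  have injS: "inj_on u S" "inj_on u (insert l S)"
    by (rule inj_on_subset[OF u(1)], use S l in blast)+
  have ul: "u l \<notin> Z \<union> u ` S"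
    using u S l inj_on_image_mem_iff[OF u(1) l(1) S] by blast
  have sup: "polarize u a S x (i, c) = 0" if "k \<in> L" "c k = u l" for c k
    using polarize_support[where Z = Z and x = x and u = u and a = a and S = S and i = i and b = c and k = k]
      Z that ul by auto
  have "(\<Sum>k\<in>other l. if b k = s then polarize u a S x (i, b(k := u l)) else 0) = 0"
  proof (rule sum.neutral, rule ballI)
    fix k assume "k \<in> other l"
    then show "(if b k = s then polarize u a S x (i, b(k := u l)) else 0) = 0"
      using sup[of k "b(k := u l)"] so by auto
  qed
  then have eq: "transfer_op (same l) (other l) (u l) s (polarize u a S x) (i, b)
    = (\<Sum>k\<in>same l. if b k = u l then polarize u a S x (i, b(k := s)) else 0)"
    by (simp add: transfer_op_def)
  show "transfer_op (same l) (other l) (u l) s (polarize u a S x) (i, b) = polarize u (a(l := s)) (insert l S) x (i, b)"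
  proof (cases "marked u (insert l S) b")
    case True
    then obtain k0 where k0: "k0 \<in> same l" "\<And>k'. k' \<in> L \<Longrightarrow> b k' = u l \<longleftrightarrow> k' = k0"
      by (auto simp: marked_def)
    have k0L: "k0 \<in> L" using k0 so by auto
    have "(\<Sum>k\<in>same l. if b k = u l then polarize u a S x (i, b(k := s)) else 0)
      = (\<Sum>k\<in>same l. if k = k0 then polarize u a S x (i, b(k0 := s)) else 0)"
      using so k0 by (intro sum.cong refl) auto
    also have "\<dots> = polarize u a S x (i, b(k0 := s))" using so k0 by simp
    also have "marked u S (b(k0 := s))"
      unfolding marked_def
    proof
      fix l' assume l': "l' \<in> S"
      with True obtain k1 where k1: "k1 \<in> same l'" "\<And>k'. k' \<in> L \<Longrightarrow> b k' = u l' \<longleftrightarrow> k' = k1"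
        by (auto simp: marked_def)
      have "u l \<noteq> u l'" using ul l' by auto
      then have "k0 \<noteq> k1" using k0 k1 k0L by metis
      moreover have "s \<noteq> u l'" using s l' S by auto
      ultimately have "\<forall>k'\<in>L. (b(k0 := s)) k' = u l' \<longleftrightarrow> k' = k1" using k1 k0 by auto
      then show "\<exists>k\<in>same l'. \<forall>k'\<in>L. (b(k0 := s)) k' = u l' \<longleftrightarrow> k' = k" using k1 by blast
    qed
    then have "polarize u a S x (i, b(k0 := s)) = x (i, unmark u a S (b(k0 := s)))"
      by (simp add: polarize_def)
    also have "\<dots> = x (i, unmark u (a(l := s)) (insert l S) b)"
    proof (rule tensorsD(2)[OF x])
      fix k assume k: "k \<in> L"
      show "unmark u a S (b(k0 := s)) k = unmark u (a(l := s)) (insert l S) b k"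
      proof (cases "k = k0")
        case True
        have "unmark u (a(l := s)) (insert l S) b k = (a(l := s)) l"
          by (rule unmark_eq[OF injS(2)]) (use k0 k0L True in auto)
        moreover have "unmark u a S (b(k0 := s)) k = s"
          using True s S by (subst unmark_same) auto
        ultimately show ?thesis by simp
      next
        case False
        then have bk: "b k \<noteq> u l" using k0 k by auto
        show ?thesis
        proof (cases "b k \<in> u ` S")
          case True
          then obtain l' where l': "l' \<in> S" "b k = u l'" by auto
          then have "l' \<noteq> l" using bk by auto
          have "unmark u a S (b(k0 := s)) k = a l'"
            by (rule unmark_eq[OF injS(1) l'(1)]) (use False l' in auto)
          moreover have "unmark u (a(l := s)) (insert l S) b k = (a(l := s)) l'"
            by (rule unmark_eq[OF injS(2)]) (use l' in auto)
          ultimately show ?thesis using \<open>l' \<noteq> l\<close> by simp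
        next
          case nin: False
          then show ?thesis using bk False by (simp add: unmark_same)
        qed
      qed
    qed
    also have "\<dots> = polarize u (a(l := s)) (insert l S) x (i, b)" using True by (simp add: polarize_def)
    finally show ?thesis using eq by simp
  next
    case False
    \<comment> \<open>A nonzero term would force \<open>u l\<close> to occur at \<open>k\<close>
      only, and then \<open>b\<close> would be marked at \<open>l\<close> as well.\<close>
    have "(\<Sum>k\<in>same l. if b k = u l then polarize u a S x (i, b(k := s)) else 0) = 0"
    proof (rule sum.neutral, rule ballI, rule ccontr)
      fix k assume k: "k \<in> same l" and "(if b k = u l then polarize u a S x (i, b(k := s)) else 0) \<noteq> 0"
      then have bk: "b k = u l" and nz: "polarize u a S x (i, b(k := s)) \<noteq> 0" by (auto split: if_splits)
      from nz have mk: "marked u S (b(k := s))" by (auto simp: polarize_def split: if_splits)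
      have kL: "k \<in> L" using k so by auto
      have "marked u (insert l S) b"
        unfolding marked_def
      proof
        fix l' assume l': "l' \<in> insert l S"
        show "\<exists>k\<in>same l'. \<forall>k'\<in>L. b k' = u l' \<longleftrightarrow> k' = k"
        proof (cases "l' = l")
          case True
          have "b k' \<noteq> u l" if "k' \<in> L" "k' \<noteq> k" for k'
            using sup[of k' "b(k := s)"] nz that by auto
          then show ?thesis using True k bk by blast
        next
          case False
          then have l'S: "l' \<in> S" using l' by simp
          then obtain k1 where k1: "k1 \<in> same l'" "\<And>k'. k' \<in> L \<Longrightarrow> (b(k := s)) k' = u l' \<longleftrightarrow> k' = k1"
            using mk unfolding marked_def by meson
          have "u l \<noteq> u l'" using ul l'S by auto
          moreover have "s \<noteq> u l'" using s l'S S by auto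
          ultimately have "k \<noteq> k1" using k1(2)[OF kL] by auto
          have "b k' = u l' \<longleftrightarrow> k' = k1" if "k' \<in> L" for k'
            using k1(2)[OF that] \<open>k \<noteq> k1\<close> \<open>u l \<noteq> u l'\<close> bk by (cases "k' = k") auto
          then show ?thesis using k1 by blast
        qed
      qed
      then show False using False by simp
    qed
    then show ?thesis using eq False by (simp add: polarize_def)
  qed
qed

lemma polarize_mem:
  assumes N: "submod N" and x: "x \<in> N"
    and Z: "\<And>i b k. x (i, b) \<noteq> 0 \<Longrightarrow> k \<in> L \<Longrightarrow> b k \<in> Z"
    and u: "inj_on u L" "u ` L \<inter> Z = {}" and a: "a ` L \<inter> u ` L = {}" and S: "S \<subseteq> L"
  shows "polarize u a S x \<in> N"
proof -
  have "finite S" using S finite_L finite_subset by blast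
  then show ?thesis using S
  proof (induction S rule: finite_induct)
    case empty
    then show ?case using x by (simp add: polarize_empty)
  next
    case (insert l S)
    \<comment> \<open>Updating \<open>a\<close> at \<open>l\<close> by its own value changes
      nothing; it brings the term into the form of \<open>polarize_step\<close>.\<close>
    have "transfer_op (same l) (other l) (u l) (a l) (polarize u a S x) = polarize u (a(l := a l)) (insert l S) x"
      by (rule polarize_step[where Z = Z]) (use submodD(2)[OF N x] Z u insert a in auto)
    then show ?case using insert submod_same_other[OF N, of "polarize u a S x" l "u l" "a l"] by simp
  qed
qed


section \<open>Traceless families\<close>

definition traceless :: "('i, 'p, 'k::field_char_0) tensor set" where
  "traceless = {x \<in> tensors I L. \<forall>j\<in>P. \<forall>k\<in>Q. trace_at j k x = 0}"

lemma submod_tensors: "submod (tensors I L)"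
  unfolding submod_def using tensors_subspace transfer_op_tensors finite_L by blast

lemma trace_at_zero: "trace_at j k 0 = 0"
  by (auto simp: trace_at_def fun_eq_iff)

lemma transfer_op_zero: "transfer_op A B s t 0 = 0"
  using transfer_op_scale[of A B s t 0 0] by simp

text \<open>Taking a trace intertwines the action with that on the remaining positions, so a
  vanishing trace stays zero.\<close>

lemma submod_traceless: "submod traceless"
  unfolding submod_def
proof (intro conjI allI impI fv.subspaceI)
  show "0 \<in> traceless" 
    using fv.subspace_0[OF tensors_subspace] by (simp add: traceless_def trace_at_zero)
  show "traceless \<subseteq> tensors I L" by (auto simp: traceless_def)
  show "x + y \<in> traceless" if "x \<in> traceless" "y \<in> traceless" for x y :: "('i, 'p, 'k::field_char_0) tensor"
  proof -
    have "trace_at j k (x + y) = 0" if "j \<in> P" "k \<in> Q" for j k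
      using trace_at_add[of x I L y j k] that disjoint \<open>x \<in> traceless\<close> \<open>y \<in> traceless\<close>
      by (auto simp: traceless_def)
    then show ?thesis using that fv.subspace_add[OF tensors_subspace] by (auto simp: traceless_def)
  qed
  show "fscale c x \<in> traceless" if "x \<in> traceless" for c and x :: "('i, 'p, 'k::field_char_0) tensor"
    using that fv.subspace_scale[OF tensors_subspace] by (auto simp: traceless_def trace_at_scale)
  show "transfer_op P Q s t x \<in> traceless" if "x \<in> traceless" for s t and x :: "('i, 'p, 'k::field_char_0) tensor"
  proof -
    have "trace_at j k (transfer_op P Q s t x) = 0" if "j \<in> P" "k \<in> Q" for j k
      using trace_at_transfer_op[of x I P Q j k s t] that finite_P finite_Q disjoint \<open>x \<in> traceless\<close>
      by (simp add: traceless_def transfer_op_zero)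
    then show ?thesis using that transfer_op_tensors[of x I L P Q s t] finite_L by (auto simp: traceless_def)
  qed
qed

section \<open>Permutations of the positions and evaluation of tensors\<close>

text \<open>The product of the symmetric groups of \<open>P\<close> and \<open>Q\<close>, realized
  as permutations of the whole type that fix everything outside \<open>L\<close>.\<close>

definition G :: "('p \<Rightarrow> 'p) set" where "G = {g. g permutes L \<and> g ` P = P}"

lemma G_mem:
  assumes "g \<in> G"
  shows "g k \<in> P \<longleftrightarrow> k \<in> P" "g k \<in> Q \<longleftrightarrow> k \<in> Q" "inj g" "k \<notin> L \<Longrightarrow> g k = k" "bij g"
proof -
  have p: "g permutes L" and P: "g ` P = P" using assms by (auto simp: G_def)
  show inj: "inj g" and "bij g" using p by (auto simp: permutes_inj permutes_bij)
  show 1: "g k \<in> P \<longleftrightarrow> k \<in> P" using inj P by (metis inj_image_mem_iff)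
  have "g k \<in> L \<longleftrightarrow> k \<in> L" using permutes_in_image[OF p] .
  with 1 show "g k \<in> Q \<longleftrightarrow> k \<in> Q" using disjoint by auto
  show "k \<notin> L \<Longrightarrow> g k = k" using p by (simp add: permutes_def)
qed

lemma G_id: "id \<in> G" by (simp add: G_def permutes_id)

lemma G_comp: "g \<in> G \<Longrightarrow> h \<in> G \<Longrightarrow> g \<circ> h \<in> G"
  by (auto simp only: G_def mem_Collect_eq permutes_compose image_comp[symmetric])

lemma G_inv: "g \<in> G \<Longrightarrow> Hilbert_Choice.inv g \<in> G"
proof -
  assume g: "g \<in> G"
  have "Hilbert_Choice.inv g ` P = Hilbert_Choice.inv g ` (g ` P)" using g by (simp add: G_def)
  also have "\<dots> = P" by (rule image_inv_f_f[OF G_mem(3)[OF g]])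
  finally have "Hilbert_Choice.inv g ` P = P" .
  then show ?thesis using g by (auto simp: G_def permutes_inv)
qed

lemma finite_G: "finite G"
  by (rule finite_subset[OF _ finite_permutations[OF finite_L]]) (auto simp: G_def)

lemma G_unique:
  assumes "inj_on u L" "g \<in> G" "h \<in> G" "\<And>k. k \<in> L \<Longrightarrow> u (g k) = u (h k)"
  shows "g = h"
proof
  fix k show "g k = h k"
  proof (cases "k \<in> L")
    case True
    have "g k \<in> L" "h k \<in> L" using True G_mem assms by auto
    then show ?thesis using assms(1) assms(4)[OF True] by (auto dest: inj_onD)
  next
    case False
    then show ?thesis using G_mem(4)[OF assms(2)] G_mem(4)[OF assms(3)] by simp
  qed
qed

text \<open>The values of \<open>x\<close> along the orbit of the tuple \<open>a\<close> under
  permutation of the positions. Cutting off outside \<open>G\<close> places them in the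
  finite-dimensional space \<open>coeffs\<close>.\<close>

definition evals :: "('p \<Rightarrow> nat) \<Rightarrow> ('i, 'p, 'k::field_char_0) tensor \<Rightarrow> ('i \<times> ('p \<Rightarrow> 'p) \<Rightarrow> 'k)" where
  "evals a x = (\<lambda>(i, g). if g \<in> G then x (i, a \<circ> g) else 0)"

text \<open>The combination, with coefficients \<open>c\<close>, of the basis tensors that carry the
  labels \<open>u\<close> in the order prescribed by \<open>g\<close>. For injective
  \<open>u\<close> these are distinct, so \<open>c\<close> can be read off again.\<close>

definition spread :: "('p \<Rightarrow> nat) \<Rightarrow> ('i \<times> ('p \<Rightarrow> 'p) \<Rightarrow> 'k::field_char_0) \<Rightarrow> ('i, 'p, 'k) tensor" where
  "spread u c = (\<lambda>(i, b). \<Sum>g\<in>G. if \<forall>k\<in>L. b k = u (g k) then c (i, g) else 0)"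

definition coeffs :: "('i \<times> ('p \<Rightarrow> 'p) \<Rightarrow> 'k::field_char_0) set" where
  "coeffs = {c. \<forall>i g. c (i, g) \<noteq> 0 \<longrightarrow> i \<in> I \<and> g \<in> G}"

text \<open>Translation of the group argument. It reverses products, as \<open>shift_shift\<close>
  records, so it is a right action of \<open>G\<close>.\<close>

definition shift :: "('p \<Rightarrow> 'p) \<Rightarrow> ('i \<times> ('p \<Rightarrow> 'p) \<Rightarrow> 'k::field_char_0) \<Rightarrow> ('i \<times> ('p \<Rightarrow> 'p) \<Rightarrow> 'k)" where
  "shift m c = (\<lambda>(i, g). c (i, m \<circ> g))"

lemma spread_at:
  assumes "inj_on u L" "g \<in> G" "\<And>k. k \<in> L \<Longrightarrow> b k = u (g k)"
  shows "spread u c (i, b) = c (i, g)"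
proof -
  have "spread u c (i, b) = (\<Sum>h\<in>G. if h = g then c (i, g) else 0)"
    unfolding spread_def prod.case
    by (rule sum.cong[OF refl]) (use assms G_unique[OF assms(1) assms(2)] in auto)
  then show ?thesis using assms finite_G by simp
qed

lemma spread_outside:
  assumes "\<And>g. g \<in> G \<Longrightarrow> \<exists>k\<in>L. b k \<noteq> u (g k)"
  shows "spread u c (i, b) = 0"
  unfolding spread_def prod.case by (rule sum.neutral) (use assms in auto)

lemma spread_nonzeroE:
  assumes "spread u c (i, b) \<noteq> 0"
  obtains g where "g \<in> G" "\<And>k. k \<in> L \<Longrightarrow> b k = u (g k)" 
  using assms spread_outside by blast

text \<open>A marked \<open>b\<close> assigns to every \<open>l\<close> the one position
  \<open>h l\<close> that carries \<open>u l\<close>. This map keeps types and is injective, hence a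
  permutation of the finite set \<open>L\<close>, and its inverse is the required
  \<open>g\<close>.\<close>

lemma marked_iff:
  assumes u: "inj_on u L"
  shows "marked u L b \<longleftrightarrow> (\<exists>g\<in>G. \<forall>k\<in>L. b k = u (g k))"
proof
  assume "marked u L b"
  then have "\<forall>l\<in>L. \<exists>k. k \<in> same l \<and> (\<forall>k'\<in>L. b k' = u l \<longleftrightarrow> k' = k)" unfolding marked_def by blast
  then obtain h where h: "\<And>l. l \<in> L \<Longrightarrow> h l \<in> same l" "\<And>l k. l \<in> L \<Longrightarrow> k \<in> L \<Longrightarrow> b k = u l \<longleftrightarrow> k = h l"
    by metis
  have hL: "h l \<in> L" if "l \<in> L" for l using h(1)[OF that] same_other(6)[OF that] by auto
  have inj: "inj_on h L"
  proof (rule inj_onI)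
    fix l l' assume l: "l \<in> L" "l' \<in> L" "h l = h l'"
    then have "u l = u l'" using h(2) hL by metis
    then show "l = l'" using u l by (auto dest: inj_onD)
  qed
  have surj: "h ` L = L" using inj hL finite_L by (intro endo_inj_surj) auto
  define g where "g = (\<lambda>k. if k \<in> L then inv_into L h k else k)"
  have gh: "g (h l) = l" if "l \<in> L" for l using that inj hL by (simp add: g_def)
  have hg: "h (g k) = k" "g k \<in> L" if "k \<in> L" for k
    using that surj f_inv_into_f[of k h L] inv_into_into[of k h L] by (simp_all add: g_def)
  have "bij_betw g L L" by (rule bij_betwI[of _ _ _ h]) (use gh hg hL in auto)
  then have perm: "g permutes L" by (intro bij_imp_permutes) (auto simp: g_def)
  have gP: "g k \<in> P" if "k \<in> P" for k
  proof (rule ccontr)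
    assume "g k \<notin> P"
    then have "h (g k) \<in> Q" using h(1)[of "g k"] hg[of k] that by (auto simp: same_def)
    then show False using hg(1)[of k] that disjoint by auto
  qed
  have "inj_on g P" using perm permutes_inj inj_on_subset by blast
  then have "g ` P = P" using gP finite_P by (intro endo_inj_surj) auto
  then have "g \<in> G" using perm by (simp add: G_def)
  moreover have "b k = u (g k)" if "k \<in> L" for k
    using h(2)[OF hg(2)[OF that] that] hg(1)[OF that] by simp
  ultimately show "\<exists>g\<in>G. \<forall>k\<in>L. b k = u (g k)" by blast
next
  assume "\<exists>g\<in>G. \<forall>k\<in>L. b k = u (g k)"
  then obtain g where g: "g \<in> G" "\<And>k. k \<in> L \<Longrightarrow> b k = u (g k)" by blast
  show "marked u L b" unfolding marked_def
  proof
    fix l assume l: "l \<in> L"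
    obtain k where k: "g k = l" using G_mem(5)[OF g(1)] by (metis bij_pointE)
    have "k \<in> same l" using k l G_mem(1,2)[OF g(1), of k] by (auto simp: same_def)
    moreover have "b k' = u l \<longleftrightarrow> k' = k" if "k' \<in> L" for k'
    proof -
      have "g k' \<in> L" using that G_mem[OF g(1)] by auto
      then have "b k' = u l \<longleftrightarrow> g k' = l" using g(2)[OF that] u l by (auto dest: inj_onD)
      then show ?thesis using k G_mem(3)[OF g(1)] by (auto dest: injD)
    qed
    ultimately show "\<exists>k\<in>same l. \<forall>k'\<in>L. b k' = u l \<longleftrightarrow> k' = k" by blast
  qed
qed

text \<open>By \<open>marked_iff\<close> the surviving index tuples agree on \<open>L\<close> with
  some \<open>u o g\<close>, and unmarking turns such a tuple into \<open>a o g\<close>. So the full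
  product of matrix units is the permutation sum of the evaluations at \<open>a\<close>.\<close>

lemma polarize_full:
  assumes u: "inj_on u L" and x: "x \<in> tensors I L"
  shows "polarize u a L x = spread u (evals a x)"
proof (intro ext, clarify)
  fix i b
  show "polarize u a L x (i, b) = spread u (evals a x) (i, b)"
  proof (cases "marked u L b")
    case False
    then show ?thesis using spread_outside[of b u "evals a x" i] marked_iff[OF u, of b]
      by (auto simp: polarize_def)
  next
    case True
    then obtain g where g: "g \<in> G" "\<And>k. k \<in> L \<Longrightarrow> b k = u (g k)" using marked_iff[OF u] by blast
    have "x (i, unmark u a L b) = x (i, a \<circ> g)"
    proof (rule tensorsD(2)[OF x])
      fix k assume k: "k \<in> L"
      then have "g k \<in> L" using G_mem[OF g(1)] by auto
      then show "unmark u a L b k = (a \<circ> g) k" using unmark_eq[OF u] g(2)[OF k] by simp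
    qed
    then show ?thesis using spread_at[OF u g, where c = "evals a x" and i = i] True g by (simp add: polarize_def evals_def)
  qed
qed

lemma exists_fresh_labels:
  obtains u :: "'p \<Rightarrow> nat" where "inj_on u L" "\<And>k. n \<le> u k"
proof -
  obtain h :: "'p \<Rightarrow> nat" where h: "inj_on h L" using finite_imp_inj_to_nat_seg[OF finite_L] by blast
  show thesis by (rule that[of "\<lambda>k. n + h k"]) (use h in \<open>auto simp: inj_on_def\<close>)
qed

lemma fresh_labels_disjoint:
  assumes "\<And>k. k \<in> S \<Longrightarrow> a k < n" "\<And>k. n \<le> u k"
  shows "a ` S \<inter> u ` T = ({} :: nat set)"
proof -
  have "a k \<noteq> u k'" if "k \<in> S" for k k' using assms(1)[OF that] assms(2)[of k'] by simp
  then show ?thesis by blast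
qed

lemma labels_ge_disjoint: "(\<And>k. n \<le> u k) \<Longrightarrow> u ` T \<inter> {..<n} = ({} :: nat set)"
  by (metis (no_types, lifting) disjoint_iff imageE leD lessThan_iff)

lemma labels_bounded: obtains n where "\<And>k m. k \<in> L \<Longrightarrow> n \<le> m \<Longrightarrow> a k < (m::nat)"
proof -
  obtain n where n: "\<And>k. k \<in> L \<Longrightarrow> a k < n"
    using finite_L finite_nat_set_iff_bounded[of "a ` L"] by auto
  show thesis by (rule that[of n]) (use n less_le_trans in blast)
qed

lemma spread_linear: "Vector_Spaces.linear fscale fscale (spread u)"
proof -
  have 1: "spread u (c + d) (i, b) = spread u c (i, b) + spread u d (i, b)" for c d :: "'i \<times> ('p \<Rightarrow> 'p) \<Rightarrow> 'k::field_char_0" and i b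
    unfolding spread_def prod.case sum.distrib[symmetric] by (rule sum.cong) auto
  have 2: "spread u (fscale r c) (i, b) = r * spread u c (i, b)" for c :: "'i \<times> ('p \<Rightarrow> 'p) \<Rightarrow> 'k::field_char_0" and i b r
    unfolding spread_def prod.case sum_distrib_left by (rule sum.cong) auto
  show ?thesis by unfold_locales (auto simp: fun_eq_iff 1 2)
qed

lemma evals_linear: "Vector_Spaces.linear fscale fscale (evals a)"
  by unfold_locales (auto simp: evals_def fun_eq_iff)

lemma shift_linear: "Vector_Spaces.linear fscale fscale (shift m)"
  by unfold_locales (auto simp: shift_def fun_eq_iff)

text \<open>Evaluation at the labels inverts \<open>spread\<close>; this is what allows labels to be
  exchanged for others.\<close>

lemma evals_spread:
  assumes u: "inj_on u L" and c: "c \<in> coeffs"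
  shows "evals u (spread u c) = c"
proof (intro ext, clarify)
  fix i g
  show "evals u (spread u c) (i, g) = c (i, g)"
    using spread_at[OF u, of g "u \<circ> g" c i] c by (auto simp: evals_def coeffs_def)
qed

lemma evals_coeffs: "x \<in> tensors I L \<Longrightarrow> evals a x \<in> coeffs"
  by (auto simp: evals_def coeffs_def dest: tensorsD(1) split: if_splits)

text \<open>The basis tensors involved carry pairwise distinct labels at the positions, so no
  nonzero entry has equal indices at two of them, and each summand of a trace is zero.\<close>

lemma spread_traceless:
  assumes u: "inj_on u L" and c: "c \<in> coeffs"
  shows "spread u c \<in> traceless"
proof -
  obtain n where n: "\<And>k m. k \<in> L \<Longrightarrow> n \<le> m \<Longrightarrow> u k < (m::nat)" using labels_bounded by blast
  have "i \<in> I \<and> (\<forall>k\<in>L. b k < n)" if nz: "spread u c (i, b) \<noteq> 0" for i b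
  proof -
    obtain g where g: "g \<in> G" "\<And>k. k \<in> L \<Longrightarrow> b k = u (g k)" using spread_nonzeroE[OF nz] by blast
    have "g k \<in> L" if "k \<in> L" for k using G_mem[OF g(1)] that by auto
    then have "\<forall>k\<in>L. b k < n" using g n by auto
    moreover have "c (i, g) \<noteq> 0" using spread_at[OF u g] nz by metis
    ultimately show ?thesis using c by (auto simp: coeffs_def)
  qed
  moreover have "spread u c (i, b) = spread u c (i, b')" if "\<forall>k\<in>L. b k = b' k" for i b b'
    unfolding spread_def prod.case using that by (intro sum.cong) auto
  ultimately have t: "spread u c \<in> tensors I L" unfolding tensors_def by blast
  have "spread u c (i, b(j := m, k := m)) = 0" if jk: "j \<in> P" "k \<in> Q" for i b j k m
  proof (rule spread_outside, rule ccontr)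
    fix g assume g: "g \<in> G" and "\<not> (\<exists>l\<in>L. (b(j := m, k := m)) l \<noteq> u (g l))"
    then have e: "(b(j := m, k := m)) l = u (g l)" if "l \<in> L" for l using that by blast
    have "u (g j) = u (g k)" using e[of j] e[of k] jk by (simp split: if_splits)
    moreover have "g j \<in> L" "g k \<in> L" using G_mem[OF g] jk by auto
    ultimately have "g j = g k" using u by (auto dest: inj_onD)
    then show False using G_mem(3)[OF g] jk disjoint by (auto dest: injD)
  qed
  then show ?thesis using t by (auto simp: traceless_def trace_at_def fun_eq_iff)
qed

text \<open>If \<open>u\<close> is not fresh for \<open>x\<close>, one polarizes to fresh labels \<open>u'\<close> first.\<close>

lemma spread_evals_mem:
  assumes N: "submod N" and x: "x \<in> N" and u: "inj_on u L"
  shows "spread u (evals a x) \<in> N"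
proof -
  have xt: "x \<in> tensors I L" using submodD(2)[OF N x] .
  obtain n1 where n1: "\<And>m i b k. n1 \<le> m \<Longrightarrow> x (i, b) \<noteq> 0 \<Longrightarrow> k \<in> L \<Longrightarrow> b k < m"
    using tensors_bound[OF xt] by blast
  obtain n2 where n2: "\<And>k m. k \<in> L \<Longrightarrow> n2 \<le> m \<Longrightarrow> a k < (m::nat)" using labels_bounded by blast
  obtain n3 where n3: "\<And>k m. k \<in> L \<Longrightarrow> n3 \<le> m \<Longrightarrow> u k < (m::nat)" using labels_bounded by blast
  \<comment> \<open>\<open>n\<close> bounds the indices of \<open>x\<close>, the tuple
    \<open>a\<close> and the old labels, so labels from \<open>n\<close> on are fresh for all
    three.\<close>
  define n where "n = max n1 (max n2 n3)"
  have nx: "x (i, b) \<noteq> 0 \<Longrightarrow> k \<in> L \<Longrightarrow> b k < n" for i b k using n1[of n] by (auto simp: n_def)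
  have na: "k \<in> L \<Longrightarrow> a k < n" for k using n2[of k n] by (auto simp: n_def)
  have nu: "k \<in> L \<Longrightarrow> u k < n" for k using n3[of k n] by (auto simp: n_def)
  obtain u' :: "'p \<Rightarrow> nat" where u': "inj_on u' L" "\<And>k. n \<le> u' k" using exists_fresh_labels by blast
  define y where "y = polarize u' a L x"
  have y: "y \<in> N" unfolding y_def
    by (rule polarize_mem[OF N x, where Z = "{..<n}"])
      (use nx u'(1) labels_ge_disjoint[of n u' L, OF u'(2)] fresh_labels_disjoint[of L a n u' L, OF na u'(2)] in auto)
  have ys: "y = spread u' (evals a x)" unfolding y_def by (rule polarize_full[OF u'(1) xt])
  have ysup: "b k \<in> u' ` L" if "y (i, b) \<noteq> 0" "k \<in> L" for i b k
  proof -
    have nz: "spread u' (evals a x) (i, b) \<noteq> 0" using that(1) ys by simp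
    obtain g where g: "g \<in> G" "\<And>k. k \<in> L \<Longrightarrow> b k = u' (g k)" using spread_nonzeroE[OF nz] by blast
    have "g k \<in> L" using that(2) G_mem(1,2)[OF g(1), of k] by blast
    then show ?thesis using g(2)[OF that(2)] by blast
  qed
  \<comment> \<open>All indices of \<open>y\<close> are labels from \<open>u'\<close>, which avoid
    \<open>u\<close>. Polarizing at the tuple \<open>u'\<close> replaces the labels
    \<open>u'\<close> by \<open>u\<close> and keeps the coefficients.\<close>
  have "polarize u u' L y \<in> N"
    by (rule polarize_mem[OF N y, where Z = "u' ` L"])
      (use ysup u fresh_labels_disjoint[of L u n u' L, OF nu u'(2)] in auto)
  moreover have "polarize u u' L y = spread u (evals u' y)"
    by (rule polarize_full[OF u submodD(2)[OF N y]])
  moreover have "evals u' y = evals a x" unfolding ys by (rule evals_spread[OF u'(1) evals_coeffs[OF xt]])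
  ultimately show ?thesis by simp
qed

text \<open>Evaluating at a tuple where \<open>x\<close> is nonzero gives a nonzero coefficient at
  the identity of \<open>G\<close>, so the spread tensor is nonzero; it is traceless and stays in
  \<open>N\<close>.\<close>

lemma submod_meets_traceless:
  assumes N: "submod N" and x: "x \<in> N" "x \<noteq> 0"
  obtains y where "y \<in> N" "y \<in> traceless" "y \<noteq> 0"
proof -
  obtain i a where ia: "x (i, a) \<noteq> 0" using x(2) by (auto simp: fun_eq_iff)
  obtain u :: "'p \<Rightarrow> nat" where u: "inj_on u L" by (rule exists_fresh_labels[of 0])
  have xt: "x \<in> tensors I L" using submodD(2)[OF N x(1)] .
  have "spread u (evals a x) (i, u) = x (i, a)"
    using spread_at[OF u G_id, of u "evals a x" i] G_id by (simp add: evals_def)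
  then have "spread u (evals a x) \<noteq> 0" using ia by auto
  then show thesis using that spread_evals_mem[OF N x(1) u] spread_traceless[OF u evals_coeffs[OF xt]] by blast
qed

section \<open>Recovering a traceless tensor from its polarizations\<close>

text \<open>Each mark in \<open>S\<close> of the type of \<open>l\<close> occupies exactly one
  position of that type, and all other positions of the type keep an old index. The resulting number
  is the scalar in \<open>depolarize\<close>.\<close>

lemma polarize_unmarked_count:
  assumes Z: "\<And>i b k. x (i, b) \<noteq> 0 \<Longrightarrow> k \<in> L \<Longrightarrow> b k < n"
    and u: "inj_on u L" "\<And>k. n \<le> u k" and S: "S \<subseteq> L" and l: "l \<in> L"
    and nz: "polarize u a S x (i, b) \<noteq> 0"
  shows "card {k \<in> same l. b k < n} = card (same l) - card (S \<inter> same l)"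
proof -
  note so = same_other[OF l]
  have mk: "marked u S b" using nz by (auto simp: polarize_def split: if_splits)
  let ?M = "{k \<in> same l. b k \<in> u ` S}"
  have dich: "b k < n \<longleftrightarrow> b k \<notin> u ` S" if "k \<in> L" for k
    using polarize_support[of x "{..<n}" u a S i b k] Z nz that u(2) by (auto simp: not_less[symmetric])
  then have "{k \<in> same l. b k < n} = same l - ?M" using so by auto
  then have "card {k \<in> same l. b k < n} = card (same l) - card ?M"
    using so by (auto intro: card_Diff_subset)
  moreover have inj: "inj_on b ?M"
  proof (rule inj_onI)
    fix k k' assume k: "k \<in> ?M" "k' \<in> ?M" "b k = b k'"
    then obtain l' where l': "l' \<in> S" "b k = u l'" by auto
    then obtain k0 where "\<And>k'. k' \<in> L \<Longrightarrow> b k' = u l' \<longleftrightarrow> k' = k0" using mk by (auto simp: marked_def)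
    then show "k = k'" using k l' so by (metis (no_types, lifting) mem_Collect_eq subsetD)
  qed
  moreover have img: "b ` ?M = u ` (S \<inter> same l)"
  proof (intro subset_antisym subsetI)
    fix v assume "v \<in> b ` ?M"
    then obtain k l' where k: "k \<in> same l" "v = b k" "l' \<in> S" "b k = u l'" by auto
    then obtain k0 where k0: "k0 \<in> same l'" "\<And>k'. k' \<in> L \<Longrightarrow> b k' = u l' \<longleftrightarrow> k' = k0" using mk by (auto simp: marked_def)
    then have "k \<in> same l'" using k so by auto
    then have "l' \<in> same l" using k disjoint S l by (auto simp: same_def split: if_splits)
    then show "v \<in> u ` (S \<inter> same l)" using k by auto
  next
    fix v assume "v \<in> u ` (S \<inter> same l)"
    then obtain l' where l': "l' \<in> S" "l' \<in> same l" "v = u l'" by auto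
    then obtain k0 where k0: "k0 \<in> same l'" "\<And>k'. k' \<in> L \<Longrightarrow> b k' = u l' \<longleftrightarrow> k' = k0" using mk by (auto simp: marked_def)
    have "same l' = same l" using l' disjoint S l by (auto simp: same_def split: if_splits)
    then have "k0 \<in> same l" "b k0 = u l'" using k0 so by auto
    then show "v \<in> b ` ?M" using l' by force
  qed
  moreover have "card (u ` (S \<inter> same l)) = card (S \<inter> same l)"
    by (rule card_image, rule inj_on_subset[OF u(1)], use S in blast)
  moreover have "card (b ` ?M) = card ?M" by (rule card_image[OF inj])
  ultimately show ?thesis using img by simp
qed

text \<open>For a general tensor there is a correction term that involves its traces.\<close>

lemma depolarize:
  assumes x: "x \<in> traceless" and Z: "\<And>i b k. x (i, b) \<noteq> 0 \<Longrightarrow> k \<in> L \<Longrightarrow> b k < n"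
    and u: "inj_on u L" "\<And>k. n \<le> u k" and S: "S \<subseteq> L" and l: "l \<in> L" "l \<notin> S"
    and z: "z = polarize u a S x" "z \<in> traceless"
  shows "(\<Sum>s<n. transfer_op (same l) (other l) s (u l) (transfer_op (same l) (other l) (u l) s z))
    = fscale (of_nat (card (same l) - card (S \<inter> same l))) z"
proof (intro ext, clarify)
  fix i b
  note so = same_other[OF l(1)]
  have mk: "marked u S c" if "z (i, c) \<noteq> 0" for c using that z(1) by (auto simp: polarize_def split: if_splits)
  have sup: "c k \<in> {..<n} \<union> u ` S" if "z (i, c) \<noteq> 0" "k \<in> L" for c k
    using polarize_support[of x "{..<n}" u a S i c k] Z that z(1) by auto
  have ul: "u l \<notin> {..<n} \<union> u ` S"
    using u S l inj_on_image_mem_iff[OF u(1) l(1) S] by (auto simp: not_less)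
  have sup0: "z (i, c) = 0" if "k \<in> L" "c k = u l" for c k
    using sup[of c k] that ul by auto
  have y: "transfer_op (same l) (other l) (u l) s z (i, c) = (\<Sum>k\<in>same l. if c k = u l then z (i, c(k := s)) else 0)"
    for s c
  proof -
    have "(\<Sum>k\<in>other l. if c k = s then z (i, c(k := u l)) else 0) = 0"
    proof (rule sum.neutral, rule ballI)
      fix k assume "k \<in> other l"
      then show "(if c k = s then z (i, c(k := u l)) else 0) = 0"
        using sup0[of k "c(k := u l)"] so by auto
    qed
    then show ?thesis by (simp add: transfer_op_def)
  qed
  \<comment> \<open>With \<open>u l\<close> written at \<open>k\<close>, only \<open>k' = k\<close>
    removes it again; any other choice leaves a label that does not occur in
    \<open>z\<close>.\<close>
  have first: "(\<Sum>k'\<in>same l. if (b(k := u l)) k' = u l then z (i, b(k := u l, k' := s)) else 0) = z (i, b)"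
    if k: "k \<in> same l" "b k = s" for k s
  proof -
    have "(\<Sum>k'\<in>same l. if (b(k := u l)) k' = u l then z (i, b(k := u l, k' := s)) else 0)
      = (\<Sum>k'\<in>same l. if k' = k then z (i, b) else 0)"
    proof (rule sum.cong[OF refl])
      fix k' assume "k' \<in> same l"
      show "(if (b(k := u l)) k' = u l then z (i, b(k := u l, k' := s)) else 0) = (if k' = k then z (i, b) else 0)"
      proof (cases "k' = k")
        case True then show ?thesis using k by (simp add: fun_upd_idem)
      next
        case False
        then have "z (i, b(k := u l, k' := s)) = 0" using k so by (intro sup0[of k]) auto
        then show ?thesis using False by simp
      qed
    qed
    then show ?thesis using k so by simp
  qed
  \<comment> \<open>The cross terms between the two types sum over \<open>s\<close> to a trace of
    \<open>z\<close>. Summing below \<open>n\<close> suffices: a larger index would be a label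
    occurring at both \<open>j\<close> and \<open>k\<close>, which a marked tuple excludes.\<close>
  have trace0: "(\<Sum>s<n. z (i, b(j := s, k := s))) = 0" if j: "j \<in> other l" and k: "k \<in> same l" for j k
  proof -
    have jk: "j \<noteq> k" "j \<in> L" "k \<in> L" using j k so by auto
    have "m < n" if nz: "z (i, b(j := m, k := m)) \<noteq> 0" for m
    proof (rule ccontr)
      assume "\<not> m < n"
      then have "m \<in> u ` S" using sup[OF nz jk(3)] by auto
      then obtain l' where "l' \<in> S" "m = u l'" by auto
      then obtain k0 where "\<And>k'. k' \<in> L \<Longrightarrow> (b(j := m, k := m)) k' = m \<longleftrightarrow> k' = k0"
        using mk[OF nz] unfolding marked_def by meson
      then show False using jk by (metis fun_upd_apply)
    qed
    then have "(\<Sum>s<n. z (i, b(j := s, k := s))) = trace_at j k z (i, b)"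
      unfolding trace_at_def prod.case by (rule Sum_any_bounded[symmetric])
    moreover have "trace_at j k z = 0"
    proof (cases "l \<in> P")
      case True
      then have "trace_at k j z = 0" using z(2) j k by (auto simp: traceless_def same_def other_def)
      then show ?thesis by (simp add: trace_at_commute[OF jk(1)])
    next
      case False
      then show ?thesis using z(2) j k by (auto simp: traceless_def same_def other_def)
    qed
    ultimately show ?thesis by simp
  qed
  have "(\<Sum>s<n. transfer_op (same l) (other l) s (u l) (transfer_op (same l) (other l) (u l) s z)) (i, b)
    = (\<Sum>s<n. transfer_op (same l) (other l) s (u l) (transfer_op (same l) (other l) (u l) s z) (i, b))"
    by (induction n) auto
  also have "\<dots> = (\<Sum>s<n. \<Sum>k\<in>same l. if b k = s then
        \<Sum>k'\<in>same l. if (b(k := u l)) k' = u l then z (i, b(k := u l, k' := s)) else 0 else 0)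
    - (\<Sum>s<n. \<Sum>j\<in>other l. if b j = u l then
        \<Sum>k\<in>same l. if (b(j := s)) k = u l then z (i, b(j := s, k := s)) else 0 else 0)"
    by (subst transfer_op_def) (simp only: prod.case y sum_subtractf)
  also have "(\<Sum>s<n. \<Sum>k\<in>same l. if b k = s then
        \<Sum>k'\<in>same l. if (b(k := u l)) k' = u l then z (i, b(k := u l, k' := s)) else 0 else 0)
    = (\<Sum>s<n. \<Sum>k\<in>same l. if b k = s then z (i, b) else 0)"
    using first by (intro sum.cong refl) auto
  also have "\<dots> = (\<Sum>k\<in>same l. \<Sum>s<n. if b k = s then z (i, b) else 0)" by (rule sum.swap)
  also have "\<dots> = (\<Sum>k\<in>same l. if b k < n then z (i, b) else 0)" by simp
  also have "\<dots> = of_nat (card {k \<in> same l. b k < n}) * z (i, b)"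
    using so by (simp add: sum.inter_filter[symmetric])
  also have "\<dots> = of_nat (card (same l) - card (S \<inter> same l)) * z (i, b)"
  proof (cases "z (i, b) = 0")
    case False
    then show ?thesis using polarize_unmarked_count[of x n u S l a i b] Z u S l z(1) by simp
  qed simp
  also have "(\<Sum>s<n. \<Sum>j\<in>other l. if b j = u l then
        \<Sum>k\<in>same l. if (b(j := s)) k = u l then z (i, b(j := s, k := s)) else 0 else 0) = 0"
  proof -
    have pull: "(\<Sum>s<n. if c then f s else 0) = (if c then \<Sum>s<n. f s else 0)" for c and f :: "nat \<Rightarrow> 'c::comm_monoid_add"
      by simp
    have "(\<Sum>s<n. \<Sum>j\<in>other l. if b j = u l then
        \<Sum>k\<in>same l. if (b(j := s)) k = u l then z (i, b(j := s, k := s)) else 0 else 0)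
      = (\<Sum>s<n. \<Sum>j\<in>other l. \<Sum>k\<in>same l. if b j = u l \<and> b k = u l then z (i, b(j := s, k := s)) else 0)"
    proof (intro sum.cong refl)
      fix s j assume "j \<in> other l"
      then have "(\<Sum>k\<in>same l. if (b(j := s)) k = u l then z (i, b(j := s, k := s)) else 0) =
         (\<Sum>k\<in>same l. if b k = u l then z (i, b(j := s, k := s)) else 0)"
        using so by (intro sum.cong refl) auto
      then show "(if b j = u l then
        \<Sum>k\<in>same l. if (b(j := s)) k = u l then z (i, b(j := s, k := s)) else 0 else 0)
        = (\<Sum>k\<in>same l. if b j = u l \<and> b k = u l then z (i, b(j := s, k := s)) else 0)" by simp
    qed
    also have "\<dots> = (\<Sum>j\<in>other l. \<Sum>s<n. \<Sum>k\<in>same l. if b j = u l \<and> b k = u l then z (i, b(j := s, k := s)) else 0)"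
      by (rule sum.swap)
    also have "\<dots> = (\<Sum>j\<in>other l. \<Sum>k\<in>same l. \<Sum>s<n. if b j = u l \<and> b k = u l then z (i, b(j := s, k := s)) else 0)"
      by (intro sum.cong refl sum.swap)
    also have "\<dots> = (\<Sum>j\<in>other l. \<Sum>k\<in>same l. if b j = u l \<and> b k = u l then \<Sum>s<n. z (i, b(j := s, k := s)) else 0)"
      by (simp only: pull)
    also have "\<dots> = 0" using trace0 by (intro sum.neutral ballI) simp
    finally show ?thesis .
  qed
  finally show "(\<Sum>s<n. transfer_op (same l) (other l) s (u l) (transfer_op (same l) (other l) (u l) s z)) (i, b)
    = fscale (of_nat (card (same l) - card (S \<inter> same l))) z (i, b)" by simp
qed

text \<open>Downward induction on the polarized set: \<open>depolarize\<close> expresses the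
  polarization over \<open>S\<close> through those over \<open>insert l S\<close>, up to a positive
  integer, which is invertible in characteristic zero. The empty set gives \<open>x\<close>
  itself.\<close>

lemma traceless_mem_if_polarizations:
  fixes x :: "('i, 'p, 'k::field_char_0) tensor"
  assumes N: "submod N" and x: "x \<in> traceless"
    and Z: "\<And>i b k. x (i, b) \<noteq> 0 \<Longrightarrow> k \<in> L \<Longrightarrow> b k < n"
    and u: "inj_on u L" "\<And>k. n \<le> u k"
    and mem: "\<And>a. (\<And>k. k \<in> L \<Longrightarrow> a k < n) \<Longrightarrow> polarize u a L x \<in> N"
    and n: "0 < n"
  shows "x \<in> N"
proof -
  have tl: "polarize u a S x \<in> traceless" if S: "S \<subseteq> L" and a: "\<And>k. k \<in> L \<Longrightarrow> a k < n" for S a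
    by (rule polarize_mem[OF submod_traceless x, where Z = "{..<n}"])
      (use Z u(1) labels_ge_disjoint[of n u L, OF u(2)] fresh_labels_disjoint[of L a n u L, OF a u(2)] S in auto)
  have "polarize u a S x \<in> N" if "S \<subseteq> L" "card (L - S) = m" "\<And>k. k \<in> L \<Longrightarrow> a k < n" for m S a
    using that
  proof (induction m arbitrary: S a)
    case 0
    then have "S = L" using finite_L by auto
    then show ?case using mem 0 by simp
  next
    case (Suc m)
    then obtain l where l: "l \<in> L" "l \<notin> S" by (metis DiffD1 DiffD2 card.empty ex_in_conv nat.distinct(1))
    note so = same_other[OF l(1)]
    let ?z = "polarize u a S x"
    have step: "transfer_op (same l) (other l) s (u l) (transfer_op (same l) (other l) (u l) s ?z) \<in> N" if s: "s < n" for s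
    proof -
      have s_fresh: "s \<notin> u ` L" using s u(2) leD by blast
      have "transfer_op (same l) (other l) (u l) s ?z = polarize u (a(l := s)) (insert l S) x"
        by (rule polarize_step[where Z = "{..<n}"])
          (use x Z u(1) labels_ge_disjoint[of n u L, OF u(2)] Suc.prems l s_fresh in \<open>auto simp: traceless_def\<close>)
      also have "\<dots> \<in> N"
      proof (rule Suc.IH)
        have "L - S = insert l (L - insert l S)" using l by auto
        then show "card (L - insert l S) = m" using Suc.prems(2) finite_L
          by (metis (no_types, lifting) DiffE card_insert_disjoint diff_Suc_1 finite_Diff insertCI)
      qed (use Suc.prems l s in auto)
      finally show ?thesis by (rule submod_same_other[OF N])
    qed
    have "card (S \<inter> same l) < card (same l)" using so l by (intro psubset_card_mono) auto
    then have nz: "of_nat (card (same l) - card (S \<inter> same l)) \<noteq> (0::'k)" by simp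
    have "fscale (of_nat (card (same l) - card (S \<inter> same l))) ?z
      = (\<Sum>s<n. transfer_op (same l) (other l) s (u l) (transfer_op (same l) (other l) (u l) s ?z))"
      by (rule depolarize[symmetric, OF x]) (use Z u Suc.prems l tl in auto)
    also have "\<dots> \<in> N" by (rule fv.subspace_sum[OF submodD(1)[OF N]]) (use step in auto)
    finally have "fscale (inverse (of_nat (card (same l) - card (S \<inter> same l)))) (fscale (of_nat (card (same l) - card (S \<inter> same l))) ?z) \<in> N"
      by (rule fv.subspace_scale[OF submodD(1)[OF N]])
    then show ?case using nz by (simp add: fv.scale_scale del: of_nat_diff)
  qed
  \<comment> \<open>Polarizing over the empty set returns \<open>x\<close>; \<open>0 < n\<close>
    makes the constant tuple zero admissible.\<close>
  from this[of "{}" _ "\<lambda>_. 0"] show ?thesis using n by (simp add: polarize_empty)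
qed


section \<open>Semisimplicity of traceless tensors\<close>

lemma shift_shift: "shift m (shift m' c) = shift (m' \<circ> m) c"
  by (simp add: shift_def fun_eq_iff comp_assoc)

lemma shift_id: "shift id c = c"
  by (simp add: shift_def fun_eq_iff)

lemma G_inv_comp:
  assumes "m \<in> G"
  shows "m \<circ> Hilbert_Choice.inv m = id" "Hilbert_Choice.inv m \<circ> m = id"
  using surj_iff[THEN iffD1, OF bij_is_surj[OF G_mem(5)[OF assms]]] inv_o_cancel[OF G_mem(3)[OF assms]]
  by simp_all

lemma G_comp_iff:
  assumes "m \<in> G"
  shows "m \<circ> g \<in> G \<longleftrightarrow> g \<in> G"
proof
  assume "m \<circ> g \<in> G"
  then have "Hilbert_Choice.inv m \<circ> (m \<circ> g) \<in> G" using G_comp G_inv assms by blast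
  then show "g \<in> G" using G_inv_comp(2)[OF assms] by (simp add: comp_assoc[symmetric])
qed (use G_comp assms in blast)

lemma shift_coeffs: "m \<in> G \<Longrightarrow> c \<in> coeffs \<Longrightarrow> shift m c \<in> coeffs"
  using G_comp_iff[of m] by (auto simp: shift_def coeffs_def)

lemma coeffs_subspace: "fv.subspace (coeffs :: ('i \<times> ('p \<Rightarrow> 'p) \<Rightarrow> 'k::field_char_0) set)"
proof (rule fv.subspaceI)
  fix c d :: "'i \<times> ('p \<Rightarrow> 'p) \<Rightarrow> 'k" assume cd: "c \<in> coeffs" "d \<in> coeffs"
  show "c + d \<in> coeffs" unfolding coeffs_def
  proof (safe)
    fix i g assume "(c + d) (i, g) \<noteq> 0"
    then have "c (i, g) \<noteq> 0 \<or> d (i, g) \<noteq> 0" by auto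
    then show "i \<in> I" "g \<in> G" using cd by (auto simp: coeffs_def)
  qed
qed (auto simp: coeffs_def)

lemma coeffs_finite_dim:
  obtains B :: "('i \<times> ('p \<Rightarrow> 'p) \<Rightarrow> 'k::field_char_0) set" where "finite B" "coeffs \<subseteq> fv.span B"
proof -
  define d :: "'i \<times> ('p \<Rightarrow> 'p) \<Rightarrow> 'i \<times> ('p \<Rightarrow> 'p) \<Rightarrow> 'k" where "d w = (\<lambda>z. if z = w then 1 else 0)" for w
  have fin: "finite (I \<times> G)" using finite_I finite_G by simp
  have "c \<in> fv.span (d ` (I \<times> G))" if c: "c \<in> coeffs" for c
  proof -
    have "c = (\<Sum>w\<in>I \<times> G. fscale (c w) (d w))"
    proof
      fix z
      have "(\<Sum>w\<in>I \<times> G. fscale (c w) (d w)) z = (\<Sum>w\<in>I \<times> G. if w = z then c w else 0)"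
        unfolding sum_apply by (intro sum.cong) (auto simp: d_def)
      also have "\<dots> = c z" using fin c by (cases z) (auto simp: coeffs_def)
      finally show "c z = (\<Sum>w\<in>I \<times> G. fscale (c w) (d w)) z" by simp
    qed
    also have "\<dots> \<in> fv.span (d ` (I \<times> G))"
      by (intro fv.span_sum fv.span_scale fv.span_base) auto
    finally show ?thesis .
  qed
  then show thesis using that[of "d ` (I \<times> G)"] fin by blast
qed

text \<open>A linear projection onto \<open>J\<close> is averaged over \<open>G\<close>. The average
  is equivariant and still restricts to the identity on \<open>J\<close>, so its kernel in
  \<open>coeffs\<close> is an invariant complement.\<close>

lemma maschke:
  fixes J :: "('i \<times> ('p \<Rightarrow> 'p) \<Rightarrow> 'k::field_char_0) set"
  assumes J: "fv.subspace J" "J \<subseteq> coeffs" and inv: "\<And>m c. m \<in> G \<Longrightarrow> c \<in> J \<Longrightarrow> shift m c \<in> J"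
  obtains J' where "fv.subspace J'" "J' \<subseteq> coeffs" "\<And>m c. m \<in> G \<Longrightarrow> c \<in> J' \<Longrightarrow> shift m c \<in> J'"
    "J \<inter> J' \<subseteq> {0}" "\<And>c. c \<in> coeffs \<Longrightarrow> \<exists>j\<in>J. \<exists>j'\<in>J'. c = j + j'"
proof -
  have lid: "Vector_Spaces.linear fscale fscale (id :: ('i \<times> ('p \<Rightarrow> 'p) \<Rightarrow> 'k) \<Rightarrow> _)"
    by unfold_locales auto
  obtain p where p: "range p \<subseteq> J" "Vector_Spaces.linear fscale fscale p" "\<And>j. j \<in> J \<Longrightarrow> p j = j"
    using fvp.linear_exists_left_inverse_on[OF lid J(1)] by auto
  define av where "av c = fscale (1 / of_nat (card G)) (\<Sum>m\<in>G. shift (Hilbert_Choice.inv m) (p (shift m c)))" for c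
  have cardG: "of_nat (card G) \<noteq> (0::'k)" using finite_G G_id by (auto simp: card_eq_0_iff)
  have lin1: "Vector_Spaces.linear fscale fscale (\<lambda>c. shift (Hilbert_Choice.inv m) (p (shift m c)))" for m
    using Vector_Spaces.linear_compose[OF Vector_Spaces.linear_compose[OF shift_linear p(2)] shift_linear, of "Hilbert_Choice.inv m" m]
    by (simp add: o_def)
  have lin: "Vector_Spaces.linear fscale fscale av"
    unfolding av_def by (intro fvp.linear_compose_scale_right fvp.linear_compose_sum ballI lin1)
  have avJ: "av c \<in> J" for c
    unfolding av_def using p(1) inv G_inv
    by (intro fv.subspace_scale[OF J(1)] fv.subspace_sum[OF J(1)]) auto
  have av_id: "av j = j" if j: "j \<in> J" for j
  proof -
    have "shift (Hilbert_Choice.inv m) (p (shift m j)) = j" if "m \<in> G" for m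
      using inv[OF that j] p(3) G_inv_comp(1)[OF that] by (simp add: shift_shift shift_id)
    then have "(\<Sum>m\<in>G. shift (Hilbert_Choice.inv m) (p (shift m j))) = (\<Sum>m\<in>G. j)"
      by (rule sum.cong[OF refl])
    also have "\<dots> = fscale (of_nat (card G)) j" by (auto simp: fun_eq_iff sum_apply)
    finally show ?thesis using cardG by (simp add: av_def)
  qed
  have av_shift: "av (shift h c) = shift h (av c)" if h: "h \<in> G" for h c
  proof -
    \<comment> \<open>Reindexing by left multiplication with \<open>h\<close> moves the translation
      by \<open>h\<close> out of the sum.\<close>
    have "(\<Sum>m\<in>G. shift (Hilbert_Choice.inv m) (p (shift m (shift h c))))
      = (\<Sum>m\<in>G. shift h (shift (Hilbert_Choice.inv m) (p (shift m c))))"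
    proof (rule sum.reindex_bij_witness[where i = "\<lambda>m. Hilbert_Choice.inv h \<circ> m" and j = "\<lambda>m. h \<circ> m"])
      fix m assume m: "m \<in> G"
      show "Hilbert_Choice.inv h \<circ> (h \<circ> m) = m" "h \<circ> (Hilbert_Choice.inv h \<circ> m) = m"
        using G_inv_comp[OF h] by (simp_all add: comp_assoc[symmetric])
      show "h \<circ> m \<in> G" "Hilbert_Choice.inv h \<circ> m \<in> G" using m h G_comp G_inv by auto
      have "Hilbert_Choice.inv (h \<circ> m) = Hilbert_Choice.inv m \<circ> Hilbert_Choice.inv h"
        by (rule o_inv_distrib) (use G_mem(5) h m in auto)
      then have "Hilbert_Choice.inv (h \<circ> m) \<circ> h = Hilbert_Choice.inv m"
        using G_inv_comp(2)[OF h] by (simp add: comp_assoc)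
      then show "shift h (shift (Hilbert_Choice.inv (h \<circ> m)) (p (shift (h \<circ> m) c)))
        = shift (Hilbert_Choice.inv m) (p (shift m (shift h c)))"
        by (simp add: shift_shift)
    qed
    then show ?thesis
      by (simp add: av_def fvp.linear_sum[OF shift_linear] fvp.linear_scale[OF shift_linear])
  qed
  define J' where "J' = {c \<in> coeffs. av c = 0}"
  show thesis
  proof (rule that[of J'])
    show "fv.subspace J'"
    proof (rule fv.subspaceI)
      show "0 \<in> J'" by (simp add: J'_def fv.subspace_0[OF coeffs_subspace] fvp.linear_0[OF lin])
    next
      fix x y assume "x \<in> J'" "y \<in> J'"
      then show "x + y \<in> J'"
        by (simp add: J'_def fv.subspace_add[OF coeffs_subspace] fvp.linear_add[OF lin])
    next
      fix r x assume "x \<in> J'"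
      then show "fscale r x \<in> J'"
        by (simp add: J'_def fv.subspace_scale[OF coeffs_subspace] fvp.linear_scale[OF lin])
    qed
    show "J' \<subseteq> coeffs" by (auto simp: J'_def)
    show "shift m c \<in> J'" if "m \<in> G" "c \<in> J'" for m c
      using that by (simp add: J'_def av_shift shift_coeffs fvp.linear_0[OF shift_linear])
    show "J \<inter> J' \<subseteq> {0}" using av_id by (auto simp: J'_def)
    show "\<exists>j\<in>J. \<exists>j'\<in>J'. c = j + j'" if c: "c \<in> coeffs" for c
    proof (intro bexI)
      show "c = av c + (c - av c)" by simp
      have "av c \<in> coeffs" using avJ J(2) by blast
      then show "c - av c \<in> J'"
        using c by (simp add: J'_def fv.subspace_diff[OF coeffs_subspace] av_id[OF avJ] fvp.linear_diff[OF lin])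
    qed (rule avJ)
  qed
qed

section \<open>Submodules and the spaces of their evaluations\<close>

lemma submod_Int: "submod N \<Longrightarrow> submod N' \<Longrightarrow> submod (N \<inter> N')"
  by (auto simp: submod_def fv.subspace_inter)

lemma submod_sums:
  fixes N N' :: "('i, 'p, 'k::field_char_0) tensor set"
  assumes "submod N" "submod N'"
  shows "submod {x + y |x y. x \<in> N \<and> y \<in> N'}"
  unfolding submod_def
proof (intro conjI allI impI)
  show "fv.subspace {x + y |x y. x \<in> N \<and> y \<in> N'}"
    by (rule fv.subspace_sums) (use assms submodD in auto)
  show "{x + y |x y. x \<in> N \<and> y \<in> N'} \<subseteq> tensors I L"
    using assms submodD(2) fv.subspace_add[OF tensors_subspace] by blast
  fix s t :: nat and z :: "('i, 'p, 'k) tensor" assume "z \<in> {x + y |x y. x \<in> N \<and> y \<in> N'}"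
  then obtain x y where z: "z = x + y" "x \<in> N" "y \<in> N'" by blast
  then have "transfer_op P Q s t z = transfer_op P Q s t x + transfer_op P Q s t y" by (simp add: transfer_op_add)
  moreover have "transfer_op P Q s t x \<in> N" "transfer_op P Q s t y \<in> N'" using z assms submod_transfer_op by auto
  ultimately show "transfer_op P Q s t z \<in> {x + y |x y. x \<in> N \<and> y \<in> N'}" by blast
qed

lemma submod_span_Union:
  assumes "\<And>S. S \<in> \<S> \<Longrightarrow> submod S"
  shows "submod (fv.span (\<Union>\<S>))"
  unfolding submod_def
proof (intro conjI allI impI fv.subspace_span)
  show "fv.span (\<Union>\<S>) \<subseteq> tensors I L"
    by (rule fv.span_minimal) (use assms submodD(2) tensors_subspace in blast)+
  fix s t :: nat and x assume x: "x \<in> fv.span (\<Union>\<S>)"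
  have "transfer_op P Q s t ` (\<Union>\<S>) \<subseteq> \<Union>\<S>" using assms submod_transfer_op by blast
  then have "fv.span (transfer_op P Q s t ` (\<Union>\<S>)) \<subseteq> fv.span (\<Union>\<S>)" by (rule fv.span_mono)
  then show "transfer_op P Q s t x \<in> fv.span (\<Union>\<S>)"
    using fvp.linear_span_image[OF transfer_op_linear, of P Q s t "\<Union>\<S>"] x by blast
qed

text \<open>For a submodule this is a subrepresentation of the translation action on
  \<open>coeffs\<close>. It is the finite-dimensional shadow of \<open>N\<close> to which Maschke's
  theorem is applied.\<close>

definition coeff_space :: "('i, 'p, 'k::field_char_0) tensor set \<Rightarrow> ('i \<times> ('p \<Rightarrow> 'p) \<Rightarrow> 'k) set" where
  "coeff_space N = fv.span {evals a x |a x. x \<in> N}"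

lemma shift_evals: "m \<in> G \<Longrightarrow> shift m (evals a x) = evals (a \<circ> m) x"
  using G_comp_iff[of m] by (auto simp: shift_def evals_def fun_eq_iff comp_assoc)

lemma shift_coeff_space:
  assumes m: "m \<in> G" and c: "c \<in> coeff_space N"
  shows "shift m c \<in> coeff_space N"
proof -
  have "shift m ` {evals a x |a x. x \<in> N} \<subseteq> {evals a x |a x. x \<in> N}"
    using shift_evals[OF m] by blast
  then have "fv.span (shift m ` {evals a x |a x. x \<in> N}) \<subseteq> coeff_space N"
    unfolding coeff_space_def by (rule fv.span_mono)
  then show ?thesis
    using fvp.linear_span_image[OF shift_linear, of m "{evals a x |a x. x \<in> N}"] c unfolding coeff_space_def by blast
qed

lemma coeff_space_coeffs: "N \<subseteq> tensors I L \<Longrightarrow> coeff_space N \<subseteq> coeffs"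
  unfolding coeff_space_def by (rule fv.span_minimal[OF _ coeffs_subspace]) (use evals_coeffs in blast)

lemma evals_coeff_space: "x \<in> N \<Longrightarrow> evals a x \<in> coeff_space N"
  unfolding coeff_space_def by (rule fv.span_base) blast

lemma spread_coeff_space:
  assumes N: "submod N" and u: "inj_on u L" and c: "c \<in> coeff_space N"
  shows "spread u c \<in> N"
proof -
  have "spread u ` {evals a x |a x. x \<in> N} \<subseteq> N" using spread_evals_mem[OF N _ u] by blast
  then have "fv.span (spread u ` {evals a x |a x. x \<in> N}) \<subseteq> N"
    by (rule fv.span_minimal) (rule submodD(1)[OF N])
  then show ?thesis
    using fvp.linear_span_image[OF spread_linear, of u "{evals a x |a x. x \<in> N}"] c unfolding coeff_space_def by blast
qed

text \<open>Full polarization joined with the recovery of traceless tensors, stated so that bounds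
  and freshness no longer appear.\<close>

lemma traceless_mem_if_spreads:
  assumes N: "submod N" and x: "x \<in> traceless"
    and mem: "\<And>u a. inj_on u L \<Longrightarrow> spread u (evals a x) \<in> N"
  shows "x \<in> N"
proof -
  have xt: "x \<in> tensors I L" using x by (simp add: traceless_def)
  obtain n where n: "\<And>m i b k. n \<le> m \<Longrightarrow> x (i, b) \<noteq> 0 \<Longrightarrow> k \<in> L \<Longrightarrow> b k < m"
    using tensors_bound[OF xt] by blast
  obtain u :: "'p \<Rightarrow> nat" where u: "inj_on u L" "\<And>k. Suc n \<le> u k" by (rule exists_fresh_labels[of "Suc n"]) blast
  show ?thesis
  proof (rule traceless_mem_if_polarizations[OF N x _ u])
    show "b k < Suc n" if "x (i, b) \<noteq> 0" "k \<in> L" for i b k using n[of "Suc n" i b k] that by simp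
    show "polarize u a L x \<in> N" for a using mem[OF u(1)] polarize_full[OF u(1) xt] by simp
  qed simp
qed

text \<open>A traceless tensor is rebuilt from its evaluations, so two submodules of
  \<open>traceless\<close> with the same \<open>coeff_space\<close> agree.\<close>

lemma mem_if_evals_coeff_space:
  assumes N: "submod N" and x: "x \<in> traceless" and c: "\<And>a. evals a x \<in> coeff_space N"
  shows "x \<in> N"
  by (rule traceless_mem_if_spreads[OF N x]) (rule spread_coeff_space[OF N _ c])

text \<open>Elements of \<open>G\<close> permute \<open>P\<close> and \<open>Q\<close> separately.
  Reindexing both sums by \<open>g\<close> turns a change of \<open>a o g\<close> at
  \<open>k\<close> into a change of \<open>a\<close> at \<open>g k\<close>, so the formula is the
  same for all group elements.\<close>

lemma evals_transfer_op:
  "evals a (transfer_op P Q s t x) =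
    (\<Sum>k\<in>P. if a k = s then evals (a(k := t)) x else 0) - (\<Sum>k\<in>Q. if a k = t then evals (a(k := s)) x else 0)"
proof (intro ext, clarify)
  fix i g
  show "evals a (transfer_op P Q s t x) (i, g) = ((\<Sum>k\<in>P. if a k = s then evals (a(k := t)) x else 0)
      - (\<Sum>k\<in>Q. if a k = t then evals (a(k := s)) x else 0)) (i, g)"
  proof (cases "g \<in> G")
    case True
    have upd: "(a \<circ> g)(k := r) = a(g k := r) \<circ> g" for k r
      using G_mem(3)[OF True] by (auto simp: fun_eq_iff dest: injD)
    have sums: "(\<Sum>k\<in>X. if (a \<circ> g) k = r then x (i, (a \<circ> g)(k := r')) else 0)
      = (\<Sum>k\<in>X. if a k = r then evals (a(k := r')) x else 0) (i, g)" if X: "bij_betw g X X" for X r r'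
    proof -
      have "(\<Sum>k\<in>X. if (a \<circ> g) k = r then x (i, (a \<circ> g)(k := r')) else 0)
        = (\<Sum>k\<in>X. (\<lambda>k. if a k = r then x (i, a(k := r') \<circ> g) else 0) (g k))"
        by (intro sum.cong refl) (auto simp: upd)
      also have "\<dots> = (\<Sum>k\<in>X. if a k = r then x (i, a(k := r') \<circ> g) else 0)"
        by (rule sum.reindex_bij_betw[OF X])
      also have "\<dots> = (\<Sum>k\<in>X. if a k = r then evals (a(k := r')) x else 0) (i, g)"
        unfolding sum_apply using True by (intro sum.cong) (auto simp: evals_def)
      finally show ?thesis .
    qed
    have "bij_betw g X X" if "X = P \<or> X = Q" for X
    proof -
      have "g ` X \<subseteq> X" using that G_mem(1,2)[OF True] by blast
      moreover have "inj_on g X" using inj_on_subset[OF G_mem(3)[OF True]] by blast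
      moreover have "finite X" using that finite_P finite_Q by auto
      ultimately show ?thesis by (simp add: bij_betw_def endo_inj_surj)
    qed
    then show ?thesis using True sums[of P s t] sums[of Q t s] by (simp add: evals_def[of a] transfer_op_def)
  next
    case False
    have "(\<Sum>k\<in>X. if a k = r then evals (a(k := r')) x else 0) (i, g) = 0" for X r r'
      unfolding sum_apply by (rule sum.neutral) (use False in \<open>auto simp: evals_def\<close>)
    then show ?thesis using False by (simp add: evals_def[of a])
  qed
qed

text \<open>By \<open>evals_transfer_op\<close> the evaluations of a transferred tensor are
  combinations of evaluations of the original one at other tuples, so a linear condition imposed on
  all tuples at once is stable.\<close>

lemma submod_of_coeffs:
  fixes J :: "('i \<times> ('p \<Rightarrow> 'p) \<Rightarrow> 'k::field_char_0) set"
  assumes J: "fv.subspace J"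
  shows "submod {x \<in> traceless. \<forall>a. evals a x \<in> J}"
  unfolding submod_def
proof (intro conjI allI impI fv.subspaceI)
  have T: "fv.subspace (traceless :: ('i, 'p, 'k) tensor set)"
    by (rule submodD(1)[OF submod_traceless])
  show "0 \<in> {x \<in> traceless. \<forall>a. evals a x \<in> J}"
    by (simp add: fv.subspace_0[OF T] fvp.linear_0[OF evals_linear] fv.subspace_0[OF J])
  fix x :: "('i, 'p, 'k) tensor" assume x: "x \<in> {x \<in> traceless. \<forall>a. evals a x \<in> J}"
  show "x + y \<in> {x \<in> traceless. \<forall>a. evals a x \<in> J}" if "y \<in> {x \<in> traceless. \<forall>a. evals a x \<in> J}" for y
    using that x by (simp add: fv.subspace_add[OF T] fv.subspace_add[OF J] fvp.linear_add[OF evals_linear])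
  show "fscale c x \<in> {x \<in> traceless. \<forall>a. evals a x \<in> J}" for c
    using x by (simp add: fv.subspace_scale[OF T] fv.subspace_scale[OF J] fvp.linear_scale[OF evals_linear])
  show "transfer_op P Q s t x \<in> {x \<in> traceless. \<forall>a. evals a x \<in> J}" for s t
  proof -
    have "evals a (transfer_op P Q s t x) \<in> J" for a
      unfolding evals_transfer_op
      by (intro fv.subspace_diff[OF J] fv.subspace_sum[OF J]) (use x fv.subspace_0[OF J] in auto)
    then show ?thesis using x by (simp add: submod_transfer_op[OF submod_traceless])
  qed
qed (use submodD(2)[OF submod_traceless] in blast)

text \<open>The complement consists of the traceless families all of whose evaluations lie in the
  Maschke complement \<open>J'\<close> of \<open>coeff_space N\<close>. Coordinates are evaluations
  at the identity, which makes the intersection trivial. Splitting the evaluations and spreading the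
  two parts shows that the sum is everything.\<close>

lemma submod_complement:
  fixes N :: "('i, 'p, 'k::field_char_0) tensor set"
  assumes N: "submod N" "N \<subseteq> traceless"
  obtains N' where "submod N'" "N' \<subseteq> traceless" "N \<inter> N' \<subseteq> {0}"
    "\<And>x. x \<in> traceless \<Longrightarrow> \<exists>y\<in>N. \<exists>z\<in>N'. x = y + z"
proof -
  have sub: "fv.subspace (coeff_space N)" by (simp add: coeff_space_def)
  have cc: "coeff_space N \<subseteq> coeffs" by (rule coeff_space_coeffs) (use submodD(2)[OF N(1)] in blast)
  obtain J' where J': "fv.subspace J'" "J' \<subseteq> coeffs" "\<And>m c. m \<in> G \<Longrightarrow> c \<in> J' \<Longrightarrow> shift m c \<in> J'"
    "coeff_space N \<inter> J' \<subseteq> {0}" "\<And>c. c \<in> coeffs \<Longrightarrow> \<exists>j\<in>coeff_space N. \<exists>j'\<in>J'. c = j + j'"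
    by (rule maschke[OF sub cc shift_coeff_space]) blast+
  define N' :: "('i, 'p, 'k) tensor set" where "N' = {x \<in> traceless. \<forall>a. evals a x \<in> J'}"
  have N': "submod N'" unfolding N'_def by (rule submod_of_coeffs[OF J'(1)])
  \<comment> \<open>An evaluation of \<open>spread u c\<close> is a translate of \<open>c\<close> if
    the tuple permutes the labels, and zero otherwise. Invariance of \<open>J'\<close> settles the
    first case.\<close>
  have spreadN': "spread u c \<in> N'" if u: "inj_on u L" and c: "c \<in> J'" for u :: "'p \<Rightarrow> nat" and c
  proof -
    have "evals a (spread u c) \<in> J'" for a
    proof (cases "\<exists>m\<in>G. \<forall>k\<in>L. a k = u (m k)")
      case True
      then obtain m where m: "m \<in> G" "\<And>k. k \<in> L \<Longrightarrow> a k = u (m k)" by blast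
      have "evals a (spread u c) = shift m c"
      proof (intro ext, clarify)
        fix i g
        show "evals a (spread u c) (i, g) = shift m c (i, g)"
        proof (cases "g \<in> G")
          case True
          have "spread u c (i, a \<circ> g) = c (i, m \<circ> g)"
          proof (rule spread_at[OF u G_comp[OF m(1) True]])
            fix k assume "k \<in> L"
            then have "g k \<in> L" using G_mem(1,2)[OF True, of k] by blast
            then show "(a \<circ> g) k = u ((m \<circ> g) k)" using m(2) by simp
          qed
          then show ?thesis using True by (simp add: evals_def shift_def)
        next
          case False
          then have "c (i, m \<circ> g) = 0" using c J'(2) G_comp_iff[OF m(1)] by (auto simp: coeffs_def)
          then show ?thesis using False by (simp add: evals_def shift_def)
        qed
      qed
      then show ?thesis using J'(3)[OF m(1) c] by simp
    next
      case False
      \<comment> \<open>If \<open>a o g\<close> matched the labels in the order \<open>h\<close>,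
        then \<open>a\<close> would match them in the order given by \<open>h\<close> composed with
        the inverse of \<open>g\<close>.\<close>
      have "spread u c (i, a \<circ> g) = 0" if g: "g \<in> G" for i g
      proof (rule spread_outside, rule ccontr)
        fix h assume h: "h \<in> G" and "\<not> (\<exists>k\<in>L. (a \<circ> g) k \<noteq> u (h k))"
        then have e: "a (g k) = u (h k)" if "k \<in> L" for k using that by auto
        have "a k = u ((h \<circ> Hilbert_Choice.inv g) k)" if k: "k \<in> L" for k
        proof -
          have "Hilbert_Choice.inv g k \<in> L" using k G_mem(1,2)[OF G_inv[OF g], of k] by blast
          moreover have "g (Hilbert_Choice.inv g k) = k" using G_inv_comp(1)[OF g] by (metis comp_apply id_apply)
          ultimately show ?thesis using e[of "Hilbert_Choice.inv g k"] by simp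
        qed
        then show False using False G_comp[OF h G_inv[OF g]] by blast
      qed
      then have "evals a (spread u c) = 0" by (auto simp: evals_def fun_eq_iff)
      then show ?thesis using fv.subspace_0[OF J'(1)] by simp
    qed
    then show ?thesis using spread_traceless[OF u] c J'(2) by (auto simp: N'_def)
  qed
  show thesis
  proof (rule that[OF N'])
    show "N' \<subseteq> traceless" by (auto simp: N'_def)
    show "N \<inter> N' \<subseteq> {0}"
    proof
      fix x assume x: "x \<in> N \<inter> N'"
      have "x (i, a) = 0" for i a
      proof -
        have "evals a x \<in> coeff_space N \<inter> J'" using x evals_coeff_space by (auto simp: N'_def)
        then have "evals a x (i, id) = 0" using J'(4) by auto
        then show ?thesis using G_id by (simp add: evals_def)
      qed
      then show "x \<in> {0}" by (auto simp: fun_eq_iff)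
    qed
    fix x assume x: "x \<in> (traceless :: ('i, 'p, 'k) tensor set)"
    have "x \<in> {y + z |y z. y \<in> N \<and> z \<in> N'}"
    proof (rule traceless_mem_if_spreads[OF submod_sums[OF N(1) N'] x])
      fix u a :: "'p \<Rightarrow> nat" assume u: "inj_on u L"
      have "evals a x \<in> coeffs" using x evals_coeffs by (auto simp: traceless_def)
      then obtain j j' where j: "j \<in> coeff_space N" "j' \<in> J'" "evals a x = j + j'" using J'(5) by blast
      have "spread u (evals a x) = spread u j + spread u j'"
        unfolding j(3) by (rule fvp.linear_add[OF spread_linear])
      then show "spread u (evals a x) \<in> {y + z |y z. y \<in> N \<and> z \<in> N'}"
        using spread_coeff_space[OF N(1) u j(1)] spreadN'[OF u j(2)] by blast
    qed
    then show "\<exists>y\<in>N. \<exists>z\<in>N'. x = y + z" by blast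
  qed
qed

section \<open>Simple submodules and semisimplicity\<close>

definition simple :: "('i, 'p, 'k::field_char_0) tensor set \<Rightarrow> bool" where
  "simple S \<longleftrightarrow> submod S \<and> S \<noteq> {0} \<and> (\<forall>N. submod N \<longrightarrow> N \<subseteq> S \<longrightarrow> N = {0} \<or> N = S)"

text \<open>Together with the finite dimension of \<open>coeffs\<close> this bounds the length of
  chains of submodules of \<open>traceless\<close>.\<close>

lemma coeff_space_strict_mono:
  fixes N N' :: "('i, 'p, 'k::field_char_0) tensor set"
  assumes "submod N" "submod N'" "N \<subseteq> N'" "N \<noteq> N'" "N' \<subseteq> traceless"
  shows "fv.dim (coeff_space N) < fv.dim (coeff_space N')"
proof -
  obtain B :: "('i \<times> ('p \<Rightarrow> 'p) \<Rightarrow> 'k) set" where B: "finite B" "coeffs \<subseteq> fv.span B" by (rule coeffs_finite_dim)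
  have "coeff_space N' \<subseteq> coeffs" by (rule coeff_space_coeffs) (use submodD(2)[OF assms(2)] in blast)
  then have sp: "coeff_space N' \<subseteq> fv.span B" using B(2) by blast
  have sub: "coeff_space N \<subseteq> coeff_space N'"
    unfolding coeff_space_def by (rule fv.span_mono) (use assms(3) in blast)
  have "coeff_space N \<noteq> coeff_space N'"
  proof
    assume e: "coeff_space N = coeff_space N'"
    have "x \<in> N" if x: "x \<in> N'" for x
      by (rule mem_if_evals_coeff_space[OF assms(1)]) (use x assms(5) evals_coeff_space[OF x] e in auto)
    then show False using assms(3,4) by blast
  qed
  moreover have "fv.subspace (coeff_space N)" by (simp add: coeff_space_def)
  ultimately show ?thesis using fv.dim_psubset_lt[OF B(1) sp _ sub] by blast
qed

text \<open>A nonzero submodule of \<open>Z\<close> whose \<open>coeff_space\<close> has least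
  dimension has no smaller nonzero submodule.\<close>

lemma exists_simple:
  assumes Z: "submod Z" "Z \<subseteq> traceless" "Z \<noteq> {0}"
  obtains S where "simple S" "S \<subseteq> Z"
proof -
  let ?P = "\<lambda>N. submod N \<and> N \<subseteq> Z \<and> N \<noteq> {0}"
  have "?P Z" using Z by simp
  from ex_has_least_nat[of ?P, OF this, of "\<lambda>N. fv.dim (coeff_space N)"]
  obtain S where S: "?P S" "\<And>N. ?P N \<Longrightarrow> fv.dim (coeff_space S) \<le> fv.dim (coeff_space N)" by blast
  have "N = {0} \<or> N = S" if N: "submod N" "N \<subseteq> S" for N
  proof (rule ccontr)
    assume c: "\<not> (N = {0} \<or> N = S)"
    then have "fv.dim (coeff_space N) < fv.dim (coeff_space S)"
      using coeff_space_strict_mono[OF N(1)] S(1) N Z(2) by blast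
    then show False using S(2)[of N] N S(1) c by auto
  qed
  then show thesis using that[of S] S(1) by (simp add: simple_def)
qed

text \<open>A complement in \<open>traceless\<close> of the sum of the simple submodules of
  \<open>Z\<close> meets \<open>Z\<close> in zero only; otherwise the intersection would contain a
  further simple submodule. Hence the second component of any element of \<open>Z\<close>
  vanishes.\<close>

lemma semisimple:
  assumes Z: "submod Z" "Z \<subseteq> traceless"
  shows "Z \<subseteq> fv.span (\<Union>{S. simple S \<and> S \<subseteq> Z})"
proof
  let ?S = "fv.span (\<Union>{S. simple S \<and> S \<subseteq> Z})"
  have S: "submod ?S" by (rule submod_span_Union) (auto simp: simple_def)
  have SZ: "?S \<subseteq> Z" by (rule fv.span_minimal) (use submodD(1)[OF Z(1)] in auto)
  obtain N where N: "submod N" "N \<subseteq> traceless" "?S \<inter> N \<subseteq> {0}"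
    "\<And>x. x \<in> traceless \<Longrightarrow> \<exists>y\<in>?S. \<exists>z\<in>N. x = y + z"
    by (rule submod_complement[OF S subset_trans[OF SZ Z(2)]]) blast
  have "Z \<inter> N = {0}"
  proof (rule ccontr)
    assume ne: "Z \<inter> N \<noteq> {0}"
    have "Z \<inter> N \<subseteq> traceless" using Z(2) by blast
    then obtain T where T: "simple T" "T \<subseteq> Z \<inter> N"
      by (rule exists_simple[OF submod_Int[OF Z(1) N(1)] _ ne])
    then have "T \<subseteq> ?S" using fv.span_superset by fastforce
    then have "T \<subseteq> {0}" using T N(3) by blast
    moreover have "0 \<in> T" using T(1) fv.subspace_0[OF submodD(1)] by (auto simp: simple_def)
    ultimately show False using T(1) by (auto simp: simple_def)
  qed
  fix x assume x: "x \<in> Z"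
  then obtain y z where yz: "y \<in> ?S" "z \<in> N" "x = y + z" using N(4) Z(2) by blast
  have "z = x - y" using yz by simp
  also have "x - y \<in> Z" using x yz(1) SZ fv.subspace_diff[OF submodD(1)[OF Z(1)]] by blast
  finally have "z = 0" using yz(2) \<open>Z \<inter> N = {0}\<close> by blast
  then show "x \<in> ?S" using yz by simp
qed


section \<open>The socle filtration in coordinates\<close>

text \<open>A cover of \<open>F\<close> corresponds to a simple submodule of the quotient by
  \<open>F\<close>. Working with covers avoids quotients until the final translation.\<close>

definition cover :: "('i, 'p, 'k::field_char_0) tensor set \<Rightarrow> ('i, 'p, 'k) tensor set \<Rightarrow> bool" where
  "cover F N \<longleftrightarrow> submod N \<and> F \<subset> N \<and> (\<forall>H. submod H \<longrightarrow> F \<subseteq> H \<longrightarrow> H \<subseteq> N \<longrightarrow> H = F \<or> H = N)"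

text \<open>The preimage of the socle of the quotient by \<open>F\<close>; \<open>F\<close> itself
  is included so that the case without covers is right as well.\<close>

definition soc_step :: "('i, 'p, 'k::field_char_0) tensor set \<Rightarrow> ('i, 'p, 'k) tensor set" where
  "soc_step F = fv.span (F \<union> \<Union>{N. cover F N})"

lemma submod_soc_step:
  assumes "submod F"
  shows "submod (soc_step F)"
proof -
  have "submod (fv.span (\<Union>(insert F {N. cover F N})))"
    by (rule submod_span_Union) (use assms in \<open>auto simp: cover_def\<close>)
  then show ?thesis by (simp add: soc_step_def)
qed

end

text \<open>The map is required to be linear on \<open>tensors\<close> only, because traces need not
  be additive outside it.\<close>

locale family_hom = T: tensor_family I P Q + Y: tensor_family I' P' Q'
  for I :: "'i set" and P Q :: "'p set" and I' :: "'j set" and P' Q' :: "'q set" +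
  fixes h :: "('i, 'p, 'k::field_char_0) tensor \<Rightarrow> ('j \<times> ('q \<Rightarrow> nat) \<Rightarrow> 'k)"
  assumes h_tensors: "x \<in> tensors I (P \<union> Q) \<Longrightarrow> h x \<in> tensors I' (P' \<union> Q')"
    and h_add: "x \<in> tensors I (P \<union> Q) \<Longrightarrow> y \<in> tensors I (P \<union> Q) \<Longrightarrow> h (x + y) = h x + h y"
    and h_scale: "x \<in> tensors I (P \<union> Q) \<Longrightarrow> h (fscale c x) = fscale c (h x)"
    and h_transfer_op: "x \<in> tensors I (P \<union> Q) \<Longrightarrow> h (transfer_op P Q s t x) = transfer_op P' Q' s t (h x)"
begin

lemma h_zero: "h 0 = 0"
  using h_scale[of 0 0] by (simp add: fv.subspace_0[OF tensors_subspace])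

lemma h_diff:
  assumes "x \<in> tensors I (P \<union> Q)" "y \<in> tensors I (P \<union> Q)"
  shows "h (x - y) = h x - h y"
proof -
  have y: "fscale (- 1) y \<in> tensors I (P \<union> Q)" using assms(2) by (rule fv.subspace_scale[OF tensors_subspace])
  have "x - y = x + fscale (- 1) y" by (simp add: fun_eq_iff)
  then have "h (x - y) = h (x + fscale (- 1) y)" by (rule arg_cong)
  also have "\<dots> = h x + fscale (- 1) (h y)"
    unfolding h_add[OF assms(1) y] h_scale[OF assms(2)] ..
  also have "\<dots> = h x - h y" by (simp add: fun_eq_iff)
  finally show ?thesis .
qed

lemma submod_preimage:
  assumes N: "Y.submod N"
  shows "T.submod {x \<in> tensors I T.L. h x \<in> N}"
  unfolding T.submod_def
proof (intro conjI allI impI fv.subspaceI)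
  show "0 \<in> {x \<in> tensors I T.L. h x \<in> N}"
    using fv.subspace_0[OF Y.submodD(1)[OF N]] fv.subspace_0[OF tensors_subspace] by (simp add: h_zero)
  fix x assume x: "x \<in> {x \<in> tensors I T.L. h x \<in> N}"
  show "x + y \<in> {x \<in> tensors I T.L. h x \<in> N}" if "y \<in> {x \<in> tensors I T.L. h x \<in> N}" for y
    using x that by (simp add: fv.subspace_add[OF tensors_subspace] fv.subspace_add[OF Y.submodD(1)[OF N]] h_add)
  show "fscale c x \<in> {x \<in> tensors I T.L. h x \<in> N}" for c
    using x by (simp add: fv.subspace_scale[OF tensors_subspace] fv.subspace_scale[OF Y.submodD(1)[OF N]] h_scale)
  show "transfer_op P Q s t x \<in> {x \<in> tensors I T.L. h x \<in> N}" for s t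
    using x by (simp add: T.submod_transfer_op[OF T.submod_tensors] h_transfer_op Y.submod_transfer_op[OF N])
qed auto

lemma submod_image:
  assumes N: "T.submod N"
  shows "Y.submod (h ` N)"
  unfolding Y.submod_def
proof (intro conjI allI impI fv.subspaceI)
  note t = T.submodD(2)[OF N]
  show "0 \<in> h ` N" using fv.subspace_0[OF T.submodD(1)[OF N]] h_zero by (metis imageI)
  show "h ` N \<subseteq> tensors I' Y.L" using t h_tensors by blast
  fix y assume y: "y \<in> h ` N"
  then obtain x where x: "x \<in> N" "y = h x" by blast
  show "y + y' \<in> h ` N" if y': "y' \<in> h ` N" for y'
  proof -
    obtain x' where x': "x' \<in> N" "y' = h x'" using y' by blast
    have "x + x' \<in> N" by (rule fv.subspace_add[OF T.submodD(1)[OF N] x(1) x'(1)])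
    moreover have "y + y' = h (x + x')" using x x' t h_add by simp
    ultimately show ?thesis by blast
  qed
  show "fscale c y \<in> h ` N" for c
  proof -
    have "fscale c x \<in> N" by (rule fv.subspace_scale[OF T.submodD(1)[OF N] x(1)])
    moreover have "fscale c y = h (fscale c x)" using x t h_scale by simp
    ultimately show ?thesis by blast
  qed
  show "transfer_op P' Q' s t y \<in> h ` N" for s t
  proof -
    have "transfer_op P Q s t x \<in> N" by (rule T.submod_transfer_op[OF N x(1)])
    moreover have "transfer_op P' Q' s t y = h (transfer_op P Q s t x)" using x t h_transfer_op by simp
    ultimately show ?thesis by blast
  qed
qed

text \<open>A cover of the kernel meets the right-hand side in the kernel or in all of itself; the
  former is impossible, because its nonzero image contains a nonzero traceless family. Conversely,
  the image of the right-hand side is a sum of simple submodules, and the preimage of each is a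
  cover of the kernel. As \<open>h\<close> may fail to be onto, everything happens inside its
  image.\<close>

theorem soc_step_kernel:
  "T.soc_step {x \<in> tensors I T.L. h x = 0} = {x \<in> tensors I T.L. h x \<in> Y.traceless}"
  (is "T.soc_step ?K = ?K1")
proof
  have sub0: "Y.submod {0}"
    by (simp add: Y.submod_def fv.subspace_single_0 fv.subspace_0[OF tensors_subspace] Y.transfer_op_zero)
  have K: "T.submod ?K" using submod_preimage[OF sub0] by simp
  have K1: "T.submod ?K1" by (rule submod_preimage[OF Y.submod_traceless])
  have KK1: "?K \<subseteq> ?K1" using fv.subspace_0[OF Y.submodD(1)[OF Y.submod_traceless]] by auto
  \<comment> \<open>A submodule that contains the kernel is determined by its image.\<close>
  have step: "x \<in> N" if "T.submod N" "?K \<subseteq> N" "x \<in> tensors I T.L" "x' \<in> N" "h x = h x'" for N x x'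
  proof -
    have x't: "x' \<in> tensors I T.L" by (rule T.submodD(2)[OF that(1,4)])
    have "x - x' \<in> tensors I T.L" by (rule fv.subspace_diff[OF tensors_subspace that(3) x't])
    then have "x - x' \<in> N" using that h_diff[OF that(3) x't] by auto
    from fv.subspace_add[OF T.submodD(1)[OF that(1)] this that(4)] show ?thesis by simp
  qed
  show "T.soc_step ?K \<subseteq> ?K1"
    unfolding T.soc_step_def
  proof (rule fv.span_minimal[OF _ T.submodD(1)[OF K1]])
    have "G \<subseteq> ?K1" if G: "T.cover ?K G" for G
    proof -
      have Gs: "T.submod G" "?K \<subset> G" using G by (auto simp: T.cover_def)
      have "T.submod (G \<inter> ?K1)" by (rule T.submod_Int[OF Gs(1) K1])
      moreover have "?K \<subseteq> G \<inter> ?K1" using Gs(2) KK1 by (simp add: psubset_eq)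
      moreover have "G \<inter> ?K1 \<subseteq> G" by simp
      ultimately consider "G \<inter> ?K1 = ?K" | "G \<inter> ?K1 = G" using G unfolding T.cover_def by meson
      then show ?thesis
      proof cases
        case 1
        obtain x where x: "x \<in> G" "x \<notin> ?K" using Gs(2) by blast
        have "h x \<noteq> 0" using x T.submodD(2)[OF Gs(1)] by blast
        moreover have "h x \<in> h ` G" using x(1) by simp
        ultimately obtain y where y: "y \<in> h ` G" "y \<in> Y.traceless" "y \<noteq> 0"
          using Y.submod_meets_traceless[OF submod_image[OF Gs(1)]] by metis
        then obtain x' where x': "x' \<in> G" "y = h x'" by blast
        then have "x' \<in> G \<inter> ?K1" using y(2) T.submodD(2)[OF Gs(1)] by simp
        then have "x' \<in> ?K" unfolding 1 .
        then show ?thesis using y(3) x'(2) by simp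
      qed auto
    qed
    then show "?K \<union> \<Union>{G. T.cover ?K G} \<subseteq> ?K1" using KK1 by blast
  qed
  show "?K1 \<subseteq> T.soc_step ?K"
  proof
    let ?Z = "h ` ?K1" and ?S = "T.soc_step ?K"
    have S: "T.submod ?S" by (rule T.submod_soc_step[OF K])
    have KS: "?K \<subseteq> ?S" unfolding T.soc_step_def by (rule subset_trans[OF _ fv.span_superset]) blast
    have Z: "Y.submod ?Z" "?Z \<subseteq> Y.traceless" using submod_image[OF K1] by auto
    have simple: "A \<subseteq> h ` ?S" if A: "Y.simple A" "A \<subseteq> ?Z" for A
    proof -
      let ?G = "{x \<in> tensors I T.L. h x \<in> A}"
      have As: "Y.submod A" "A \<noteq> {0}" using A by (auto simp: Y.simple_def)
      have G: "T.submod ?G" by (rule submod_preimage[OF As(1)])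
      have A0: "0 \<in> A" by (rule fv.subspace_0[OF Y.submodD(1)[OF As(1)]])
      have img: "A \<subseteq> h ` ?G"
      proof
        fix y assume y: "y \<in> A"
        then obtain x where "x \<in> ?K1" "y = h x" using A(2) by blast
        then show "y \<in> h ` ?G" using y by blast
      qed
      have "T.cover ?K ?G" unfolding T.cover_def
      proof (intro conjI allI impI)
        obtain y where "y \<in> A" "y \<noteq> 0" using As(2) A0 by blast
        then obtain x where "x \<in> ?G" "h x \<noteq> 0" using img by blast
        then have "?K \<noteq> ?G" by auto
        moreover have "?K \<subseteq> ?G" using A0 by auto
        ultimately show "?K \<subset> ?G" by (intro psubsetI)
        fix H assume H: "T.submod H" "?K \<subseteq> H" "H \<subseteq> ?G"
        have "h ` H \<subseteq> A" using H(3) by blast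
        then consider "h ` H = {0}" | "h ` H = A"
          using A(1) submod_image[OF H(1)] unfolding Y.simple_def by meson
        then show "H = ?K \<or> H = ?G"
        proof cases
          case 1
          then have "H \<subseteq> ?K" using T.submodD(2)[OF H(1)] by blast
          then show ?thesis using H(2) by blast
        next
          case 2
          have "?G \<subseteq> H"
          proof
            fix x assume x: "x \<in> ?G"
            then obtain x' where "x' \<in> H" "h x = h x'" using 2 by blast
            then show "x \<in> H" using step[OF H(1,2)] x by simp
          qed
          then show ?thesis using H(3) by blast
        qed
      qed (rule G)
      then have "?G \<subseteq> ?S" unfolding T.soc_step_def by (intro subset_trans[OF _ fv.span_superset]) blast
      then show ?thesis using img by blast
    qed
    have "?Z \<subseteq> fv.span (\<Union>{A. Y.simple A \<and> A \<subseteq> ?Z})" by (rule Y.semisimple[OF Z])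
    also have "\<dots> \<subseteq> h ` ?S"
      by (rule fv.span_minimal[OF _ Y.submodD(1)[OF submod_image[OF S]]]) (use simple in blast)
    finally have ZS: "?Z \<subseteq> h ` ?S" .
    fix x assume x: "x \<in> ?K1"
    then obtain x' where "x' \<in> ?S" "h x = h x'" using ZS by blast
    then show "x \<in> ?S" using step[OF S KS] x by simp
  qed
qed

end

section \<open>Iterated contractions and their common kernels\<close>

text \<open>Contracted positions remain in the index tuple while the result ignores them, so nothing
  is renumbered. The head of the list is contracted last.\<close>

primrec contract :: "('p \<times> 'p) list \<Rightarrow> ('i, 'p, 'k::field) tensor \<Rightarrow> ('i, 'p, 'k) tensor" where
  "contract [] x = x"
| "contract (jk # Is) x = trace_at (fst jk) (snd jk) (contract Is x)"

lemma trace_at_tensors: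
  assumes x: "x \<in> tensors I L" and jk: "j \<in> L" "k \<in> L" "j \<noteq> k"
  shows "trace_at j k x \<in> tensors I (L - {j, k})"
proof -
  obtain n where n: "\<And>m i b k. n \<le> m \<Longrightarrow> x (i, b) \<noteq> 0 \<Longrightarrow> k \<in> L \<Longrightarrow> b k < m" using tensors_bound[OF x] by blast
  have tr: "trace_at j k x (i, b) = (\<Sum>m<n. x (i, b(j := m, k := m)))" for i b
    by (rule trace_at_bounded[of _ L]) (use n[of n] jk in auto)
  have "i \<in> I \<and> (\<forall>l\<in>L - {j, k}. b l < n)" if "trace_at j k x (i, b) \<noteq> 0" for i b
  proof -
    from that obtain m where m: "x (i, b(j := m, k := m)) \<noteq> 0"
      unfolding tr by (auto elim: sum.not_neutral_contains_not_neutral)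
    have "b l < n" if "l \<in> L - {j, k}" for l using n[OF _ m, of n l] that by auto
    then show ?thesis using tensorsD(1)[OF x m] by blast
  qed
  moreover have "trace_at j k x (i, b) = trace_at j k x (i, c)" if "\<forall>l\<in>L - {j, k}. b l = c l" for i b c
    unfolding tr by (intro sum.cong refl tensorsD(2)[OF x]) (use that in auto)
  ultimately show ?thesis unfolding tensors_def by blast
qed

context tensor_family
begin

definition pairs :: "nat \<Rightarrow> ('p \<times> 'p) list set" where
  "pairs r = {Is. length Is = r \<and> set Is \<subseteq> P \<times> Q \<and> distinct (map fst Is) \<and> distinct (map snd Is)}"

definition restP :: "('p \<times> 'p) list \<Rightarrow> 'p set" where "restP Is = P - fst ` set Is"
definition restQ :: "('p \<times> 'p) list \<Rightarrow> 'p set" where "restQ Is = Q - snd ` set Is"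

lemma finite_pairs: "finite (pairs r)"
  by (rule finite_subset[OF _ finite_lists_length_eq[of "P \<times> Q" r]])
    (use finite_P finite_Q in \<open>auto simp: pairs_def\<close>)

lemma pairs_Cons:
  "jk # Is \<in> pairs (Suc r) \<longleftrightarrow> Is \<in> pairs r \<and> fst jk \<in> restP Is \<and> snd jk \<in> restQ Is"
  by (cases jk) (auto simp: pairs_def restP_def restQ_def)

lemma pairs_SucE:
  assumes "Js \<in> pairs (Suc r)"
  obtains j k Is where "Js = (j, k) # Is" "Is \<in> pairs r" "j \<in> restP Is" "k \<in> restQ Is"
  using assms by (cases Js) (auto simp: pairs_def restP_def restQ_def)

lemma rest_Cons:
  "restP ((j, k) # Is) = restP Is - {j}" "restQ ((j, k) # Is) = restQ Is - {k}"
  by (auto simp: restP_def restQ_def)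

lemma rest_disjoint: "restP Is \<inter> restQ Is = {}" "finite (restP Is)" "finite (restQ Is)"
  using disjoint finite_P finite_Q by (auto simp: restP_def restQ_def)

lemma rest_Cons_Un:
  assumes "j \<in> restP Is" "k \<in> restQ Is"
  shows "restP ((j, k) # Is) \<union> restQ ((j, k) # Is) = restP Is \<union> restQ Is - {j, k}"
  using assms rest_disjoint[of Is] by (auto simp: rest_Cons)

lemma contract_tensors:
  assumes x: "x \<in> tensors I L"
  shows "Is \<in> pairs r \<Longrightarrow> contract Is x \<in> tensors I (restP Is \<union> restQ Is)"
proof (induction Is arbitrary: r)
  case Nil
  then show ?case using x by (simp add: restP_def restQ_def)
next
  case (Cons jk Is)
  obtain j k where jk: "jk = (j, k)" by (cases jk)
  obtain r' where r: "r = Suc r'" using Cons.prems by (auto simp: pairs_def)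
  have p: "Is \<in> pairs r'" "j \<in> restP Is" "k \<in> restQ Is" using Cons.prems by (auto simp: r pairs_Cons jk)
  have "j \<noteq> k" using p rest_disjoint(1)[of Is] by auto
  then show ?case
    using trace_at_tensors[OF Cons.IH[OF p(1)], of j k] p(2,3) rest_Cons_Un[OF p(2,3)] by (simp add: jk)
qed

lemma contract_add:
  assumes x: "x \<in> tensors I L" and y: "y \<in> tensors I L"
  shows "Is \<in> pairs r \<Longrightarrow> contract Is (x + y) = contract Is x + contract Is y"
proof (induction Is arbitrary: r)
  case (Cons jk Is)
  obtain j k where jk: "jk = (j, k)" by (cases jk)
  obtain r' where r: "r = Suc r'" using Cons.prems by (auto simp: pairs_def)
  have p: "Is \<in> pairs r'" "j \<in> restP Is" "k \<in> restQ Is" using Cons.prems by (auto simp: r pairs_Cons jk)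
  have "j \<noteq> k" using p rest_disjoint(1)[of Is] by auto
  then show ?case
    unfolding jk contract.simps fst_conv snd_conv Cons.IH[OF p(1)]
    using p(2) by (intro trace_at_add[OF contract_tensors[OF x p(1)] contract_tensors[OF y p(1)]]) auto
qed simp

lemma contract_scale: "contract Is (fscale c x) = fscale c (contract Is x)"
  by (induction Is) (simp_all only: contract.simps trace_at_scale)

lemma contract_transfer_op:
  assumes x: "x \<in> tensors I L"
  shows "Is \<in> pairs r \<Longrightarrow> contract Is (transfer_op P Q s t x) = transfer_op (restP Is) (restQ Is) s t (contract Is x)"
proof (induction Is arbitrary: r)
  case Nil
  then show ?case by (simp add: restP_def restQ_def)
next
  case (Cons jk Is)
  obtain j k where jk: "jk = (j, k)" by (cases jk)
  obtain r' where r: "r = Suc r'" using Cons.prems by (auto simp: pairs_def)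
  have p: "Is \<in> pairs r'" "j \<in> restP Is" "k \<in> restQ Is" using Cons.prems by (auto simp: r pairs_Cons jk)
  show ?case
    using trace_at_transfer_op[OF contract_tensors[OF x p(1)] rest_disjoint(2,3,1) p(2,3)] Cons.IH[OF p(1)]
    by (simp add: jk rest_Cons)
qed

definition contraction_kernel :: "nat \<Rightarrow> ('i, 'p, 'k::field_char_0) tensor set" where
  "contraction_kernel r = {x \<in> tensors I L. \<forall>Is\<in>pairs r. contract Is x = 0}"

lemma card_rest:
  assumes "Is \<in> pairs r"
  shows "card (restP Is) = card P - r" "card (restQ Is) = card Q - r"
proof -
  have "card (fst ` set Is) = r" "card (snd ` set Is) = r" "fst ` set Is \<subseteq> P" "snd ` set Is \<subseteq> Q"
    using assms distinct_card[of "map fst Is"] distinct_card[of "map snd Is"] by (auto simp: pairs_def)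
  then show "card (restP Is) = card P - r" "card (restQ Is) = card Q - r"
    unfolding restP_def restQ_def by (auto simp: card_Diff_subset)
qed

text \<open>All the \<open>r\<close>-fold contractions together form one map into a family over \<open>pairs r\<close>; the
  remaining positions of each contraction are identified with those of a fixed pair of sets.\<close>

lemma soc_step_contraction_kernel:
  fixes r
  assumes I: "I = {i0}"
  shows "soc_step (contraction_kernel r :: ('i, 'p, 'k::field_char_0) tensor set) = contraction_kernel (Suc r)"
proof -
  \<comment> \<open>If \<open>r\<close> exceeds \<open>card P\<close> or \<open>card Q\<close>, the
    truncated difference is zero, and then \<open>pairs r\<close> is empty.\<close>
  obtain P' where P': "P' \<subseteq> P" "card P' = card P - r" using obtain_subset_with_card_n[of "card P - r" P] by auto
  obtain Q' where Q': "Q' \<subseteq> Q" "card Q' = card Q - r" using obtain_subset_with_card_n[of "card Q - r" Q] by auto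
  have fin: "finite P'" "finite Q'" using P' Q' finite_P finite_Q finite_subset by auto
  have dis': "P' \<inter> Q' = {}" using P' Q' disjoint by blast
  \<comment> \<open>The members of one family share their positions; equal cardinalities provide
    identifications of the remaining positions that respect types.\<close>
  have "\<exists>\<sigma>. bij_betw \<sigma> (restP Is) P' \<and> bij_betw \<sigma> (restQ Is) Q'" if Is: "Is \<in> pairs r" for Is
  proof -
    obtain f where f: "bij_betw f (restP Is) P'"
      using finite_same_card_bij[OF rest_disjoint(2) fin(1)] card_rest[OF Is] P'(2) by metis
    obtain g where g: "bij_betw g (restQ Is) Q'"
      using finite_same_card_bij[OF rest_disjoint(3) fin(2)] card_rest[OF Is] Q'(2) by metis
    have "bij_betw (\<lambda>k. if k \<in> restP Is then f k else g k) (restP Is) P'"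
      using f by (simp cong: bij_betw_cong)
    moreover have "bij_betw (\<lambda>k. if k \<in> restP Is then f k else g k) (restQ Is) Q'"
      using rest_disjoint(1)[of Is] by (subst bij_betw_cong[of _ _ g]) (auto simp: g)
    ultimately show ?thesis by blast
  qed
  then obtain \<sigma> where \<sigma>P: "\<And>Is. Is \<in> pairs r \<Longrightarrow> bij_betw (\<sigma> Is) (restP Is) P'"
    and \<sigma>Q: "\<And>Is. Is \<in> pairs r \<Longrightarrow> bij_betw (\<sigma> Is) (restQ Is) Q'" by metis
  have \<sigma>: "bij_betw (\<sigma> Is) (restP Is \<union> restQ Is) (P' \<union> Q')" if "Is \<in> pairs r" for Is
    by (rule bij_betw_combine[OF \<sigma>P[OF that] \<sigma>Q[OF that] dis'])
  define h :: "('i, 'p, 'k) tensor \<Rightarrow> (('p \<times> 'p) list \<times> ('p \<Rightarrow> nat) \<Rightarrow> 'k)" where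
    "h x = (\<lambda>(Is, a). if Is \<in> pairs r then contract Is x (i0, a \<circ> \<sigma> Is) else 0)" for x
  \<comment> \<open>Updating the transported tuple at \<open>k\<close> amounts to updating the
    original one at the image of \<open>k\<close>, since the identification is injective on the
    remaining positions.\<close>
  have \<sigma>upd: "contract Is x (i0, (a \<circ> \<sigma> Is)(k := m)) = contract Is x (i0, a(\<sigma> Is k := m) \<circ> \<sigma> Is)"
    if "Is \<in> pairs r" "x \<in> tensors I L" "k \<in> restP Is \<union> restQ Is" for Is and x :: "('i, 'p, 'k) tensor" and a k m
  proof (rule tensorsD(2)[OF contract_tensors[OF that(2,1)]])
    fix l assume "l \<in> restP Is \<union> restQ Is"
    then have "\<sigma> Is l = \<sigma> Is k \<longleftrightarrow> l = k" using \<sigma>[OF that(1)] that(3) by (metis bij_betw_imp_inj_on inj_on_eq_iff)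
    then show "((a \<circ> \<sigma> Is)(k := m)) l = (a(\<sigma> Is k := m) \<circ> \<sigma> Is) l" by simp
  qed
  interpret h: family_hom I P Q "pairs r" P' Q' h
  proof unfold_locales
    show "finite (pairs r)" by (rule finite_pairs)
    show "finite P'" "finite Q'" "P' \<inter> Q' = {}" using fin dis' by auto
    fix x :: "('i, 'p, 'k) tensor" assume x: "x \<in> tensors I L"
    show "h (x + y) = h x + h y" if "y \<in> tensors I L" for y
      using contract_add[OF x that] by (auto simp: h_def fun_eq_iff)
    show "h (fscale c x) = fscale c (h x)" for c by (auto simp: h_def fun_eq_iff contract_scale)
    show "h x \<in> tensors (pairs r) (P' \<union> Q')"
    proof -
      \<comment> \<open>Each contraction has its own bound; the sum of these finitely many bounds
        serves for all.\<close>
      have "\<exists>n. \<forall>i b. contract Is x (i, b) \<noteq> 0 \<longrightarrow> (\<forall>k\<in>restP Is \<union> restQ Is. b k < n)" if "Is \<in> pairs r" for Is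
        using contract_tensors[OF x that] by (auto simp: tensors_def)
      then obtain n where n: "\<And>Is i b k. Is \<in> pairs r \<Longrightarrow> contract Is x (i, b) \<noteq> 0 \<Longrightarrow> k \<in> restP Is \<union> restQ Is \<Longrightarrow> b k < n Is"
        by metis
      have "Is \<in> pairs r \<and> (\<forall>k\<in>P' \<union> Q'. a k < (\<Sum>Is\<in>pairs r. n Is))" if nz: "h x (Is, a) \<noteq> 0" for Is a
      proof -
        have Is: "Is \<in> pairs r" "contract Is x (i0, a \<circ> \<sigma> Is) \<noteq> 0" using nz by (auto simp: h_def split: if_splits)
        have "a k < (\<Sum>Is\<in>pairs r. n Is)" if k: "k \<in> P' \<union> Q'" for k
        proof -
          obtain l where l: "l \<in> restP Is \<union> restQ Is" "k = \<sigma> Is l"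
            using \<sigma>[OF Is(1)] k by (metis bij_betw_imp_surj_on imageE)
          have "a k < n Is" using n[OF Is l(1)] l(2) by simp
          also have "n Is \<le> (\<Sum>Is\<in>pairs r. n Is)" by (rule member_le_sum[OF Is(1)]) (use finite_pairs in auto)
          finally show ?thesis .
        qed
        then show ?thesis using Is by blast
      qed
      moreover have "h x (Is, a) = h x (Is, b)" if "\<forall>k\<in>P' \<union> Q'. a k = b k" for Is a b
      proof (cases "Is \<in> pairs r")
        case True
        have "contract Is x (i0, a \<circ> \<sigma> Is) = contract Is x (i0, b \<circ> \<sigma> Is)"
          by (rule tensorsD(2)[OF contract_tensors[OF x True]])
            (use that bij_betwE[OF \<sigma>[OF True]] in simp)
        then show ?thesis by (simp add: h_def)
      qed (simp add: h_def)
      ultimately show ?thesis unfolding tensors_def by blast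
    qed
    show "h (transfer_op P Q s t x) = transfer_op P' Q' s t (h x)" for s t
    proof (intro ext, clarify)
      fix Is a
      show "h (transfer_op P Q s t x) (Is, a) = transfer_op P' Q' s t (h x) (Is, a)"
      proof (cases "Is \<in> pairs r")
        case True
        have sums: "(\<Sum>k\<in>X. if (a \<circ> \<sigma> Is) k = m then contract Is x (i0, (a \<circ> \<sigma> Is)(k := m')) else 0)
          = (\<Sum>k\<in>X'. if a k = m then h x (Is, a(k := m')) else 0)"
          if X: "bij_betw (\<sigma> Is) X X'" "X \<subseteq> restP Is \<union> restQ Is" for X X' m m'
        proof -
          have "(\<Sum>k\<in>X. if (a \<circ> \<sigma> Is) k = m then contract Is x (i0, (a \<circ> \<sigma> Is)(k := m')) else 0)
            = (\<Sum>k\<in>X. (\<lambda>k. if a k = m then h x (Is, a(k := m')) else 0) (\<sigma> Is k))"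
            by (intro sum.cong refl) (use X(2) True x in \<open>auto simp: \<sigma>upd h_def\<close>)
          then show ?thesis using sum.reindex_bij_betw[OF X(1)] by simp
        qed
        have "h (transfer_op P Q s t x) (Is, a) = transfer_op (restP Is) (restQ Is) s t (contract Is x) (i0, a \<circ> \<sigma> Is)"
          using True contract_transfer_op[OF x True] by (simp add: h_def)
        also have "\<dots> = transfer_op P' Q' s t (h x) (Is, a)"
          unfolding transfer_op_def prod.case
          using sums[OF \<sigma>P[OF True], of s t] sums[OF \<sigma>Q[OF True], of t s] by simp
        finally show ?thesis .
      next
        case False
        then have "h x (Is, b) = 0" for b by (simp add: h_def)
        then have "transfer_op P' Q' s t (h x) (Is, a) = 0"
          unfolding transfer_op_def prod.case by (subst (1 2) sum.neutral) auto
        then show ?thesis using False by (simp add: h_def)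
      qed
    qed
  qed
  \<comment> \<open>On the remaining positions every index tuple is the transport of a tuple on the
    common ones, so \<open>h\<close> misses no value of a contraction.\<close>
  have lift: "contract Is x (i, b) = contract Is x (i0, (\<lambda>l. b (inv_into (restP Is \<union> restQ Is) (\<sigma> Is) l)) \<circ> \<sigma> Is)"
    if x: "x \<in> tensors I L" and Is: "Is \<in> pairs r" and i: "i = i0" for x :: "('i, 'p, 'k) tensor" and Is i b
    unfolding i
  proof (rule tensorsD(2)[OF contract_tensors[OF x Is]])
    fix k assume "k \<in> restP Is \<union> restQ Is"
    then show "b k = ((\<lambda>l. b (inv_into (restP Is \<union> restQ Is) (\<sigma> Is) l)) \<circ> \<sigma> Is) k"
      using \<sigma>[OF Is] by (simp add: bij_betw_def)
  qed
  have out: "contract Is x (i, b) = 0" if x: "x \<in> tensors I L" and Is: "Is \<in> pairs r'" and i: "i \<noteq> i0"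
    for x :: "('i, 'p, 'k) tensor" and Is i b r'
    using tensorsD(1)[OF contract_tensors[OF x Is], of i b] i I by auto
  have ker: "h x = 0 \<longleftrightarrow> (\<forall>Is\<in>pairs r. contract Is x = 0)" if x: "x \<in> tensors I L" for x
  proof
    assume h0: "h x = 0"
    have "contract Is x (i, b) = 0" if Is: "Is \<in> pairs r" for Is i b
    proof (cases "i = i0")
      case True
      have "h x (Is, \<lambda>l. b (inv_into (restP Is \<union> restQ Is) (\<sigma> Is) l)) = 0" using h0 by simp
      then show ?thesis unfolding lift[OF x Is True] using Is by (simp add: h_def)
    qed (rule out[OF x Is])
    then show "\<forall>Is\<in>pairs r. contract Is x = 0" by (auto simp: fun_eq_iff)
  qed (auto simp: h_def fun_eq_iff)
  \<comment> \<open>A trace of the joint contraction is a contraction along one more pair. This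
    turns the traceless condition into the next kernel.\<close>
  have tr: "trace_at (\<sigma> Is j) (\<sigma> Is k) (h x) (Is, a) = contract ((j, k) # Is) x (i0, a \<circ> \<sigma> Is)"
    if x: "x \<in> tensors I L" and Is: "Is \<in> pairs r" and j: "j \<in> restP Is" and k: "k \<in> restQ Is" for x Is j k a
  proof -
    have "contract Is x (i0, a(\<sigma> Is j := m, \<sigma> Is k := m) \<circ> \<sigma> Is) = contract Is x (i0, (a \<circ> \<sigma> Is)(j := m, k := m))" for m
    proof (rule tensorsD(2)[OF contract_tensors[OF x Is]])
      fix l assume l: "l \<in> restP Is \<union> restQ Is"
      have inj: "inj_on (\<sigma> Is) (restP Is \<union> restQ Is)" using \<sigma>[OF Is] by (simp add: bij_betw_def)
      have "\<sigma> Is l = \<sigma> Is j \<longleftrightarrow> l = j" "\<sigma> Is l = \<sigma> Is k \<longleftrightarrow> l = k"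
        using inj_on_eq_iff[OF inj l, of j] inj_on_eq_iff[OF inj l, of k] j k by auto
      then show "(a(\<sigma> Is j := m, \<sigma> Is k := m) \<circ> \<sigma> Is) l = ((a \<circ> \<sigma> Is)(j := m, k := m)) l" by simp
    qed
    then show ?thesis using Is by (simp add: trace_at_def h_def)
  qed
  have tl: "h x \<in> h.Y.traceless \<longleftrightarrow> (\<forall>Is\<in>pairs (Suc r). contract Is x = 0)" if x: "x \<in> tensors I L" for x
  proof
    assume t: "h x \<in> h.Y.traceless"
    have "contract Js x (i, b) = 0" if Js: "Js \<in> pairs (Suc r)" for Js i b
    proof (cases "i = i0")
      case True
      obtain j k Is where Is: "Js = (j, k) # Is" "Is \<in> pairs r" "j \<in> restP Is" "k \<in> restQ Is"
        using pairs_SucE[OF Js] by metis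
      let ?a = "\<lambda>l. b (inv_into (restP Is \<union> restQ Is) (\<sigma> Is) l)"
      have "\<sigma> Is j \<in> P'" "\<sigma> Is k \<in> Q'" using \<sigma>P[OF Is(2)] \<sigma>Q[OF Is(2)] Is(3,4) by (auto dest: bij_betwE)
      then have "trace_at (\<sigma> Is j) (\<sigma> Is k) (h x) (Is, ?a) = 0"
        using t by (simp add: h.Y.traceless_def)
      then have "contract Js x (i0, ?a \<circ> \<sigma> Is) = 0" using tr[OF x Is(2-4)] Is(1) by simp
      moreover have "contract Js x (i0, ?a \<circ> \<sigma> Is) = contract Js x (i0, b)"
      proof (rule tensorsD(2)[OF contract_tensors[OF x Js]])
        fix l assume "l \<in> restP Js \<union> restQ Js"
        then have "l \<in> restP Is \<union> restQ Is" using rest_Cons_Un[OF Is(3,4)] Is(1) by auto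
        then show "(?a \<circ> \<sigma> Is) l = b l" using \<sigma>[OF Is(2)] by (simp add: bij_betw_def)
      qed
      ultimately show ?thesis using True by simp
    qed (rule out[OF x Js])
    then show "\<forall>Is\<in>pairs (Suc r). contract Is x = 0" by (auto simp: fun_eq_iff)
  next
    assume c: "\<forall>Is\<in>pairs (Suc r). contract Is x = 0"
    have "trace_at j' k' (h x) (Is, a) = 0" if jk: "j' \<in> P'" "k' \<in> Q'" for j' k' Is a
    proof (cases "Is \<in> pairs r")
      case True
      obtain j where j: "j \<in> restP Is" "j' = \<sigma> Is j" using \<sigma>P[OF True] jk(1) by (metis bij_betw_imp_surj_on imageE)
      obtain k where k: "k \<in> restQ Is" "k' = \<sigma> Is k" using \<sigma>Q[OF True] jk(2) by (metis bij_betw_imp_surj_on imageE)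
      have "(j, k) # Is \<in> pairs (Suc r)" using True j k by (simp add: pairs_Cons)
      then have "contract ((j, k) # Is) x = 0" using c by blast
      then show ?thesis using tr[OF x True j(1) k(1), of a] j k by simp
    qed (simp add: trace_at_def h_def)
    then show "h x \<in> h.Y.traceless" using h.h_tensors[OF x] by (auto simp: h.Y.traceless_def fun_eq_iff)
  qed
  have "{x \<in> tensors I L. h x = 0} = contraction_kernel r"
    using ker by (auto simp: contraction_kernel_def)
  moreover have "{x \<in> tensors I L. h x \<in> h.Y.traceless} = contraction_kernel (Suc r)"
    using tl by (auto simp: contraction_kernel_def)
  ultimately show ?thesis using h.soc_step_kernel by simp
qed


lemma submod_contraction_kernel: "submod (contraction_kernel r :: ('i, 'p, 'k::field_char_0) tensor set)"
  unfolding submod_def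
proof (intro conjI allI impI fv.subspaceI)
  have c0: "contract Is 0 = 0" for Is :: "('p \<times> 'p) list"
    by (induction Is) (simp_all only: contract.simps trace_at_zero)
  show "0 \<in> (contraction_kernel r :: ('i, 'p, 'k) tensor set)"
    by (simp add: contraction_kernel_def fv.subspace_0[OF tensors_subspace] c0)
  fix x :: "('i, 'p, 'k) tensor" assume x: "x \<in> contraction_kernel r"
  then have xt: "x \<in> tensors I L" by (simp add: contraction_kernel_def)
  show "x + y \<in> contraction_kernel r" if y: "y \<in> contraction_kernel r" for y
  proof -
    have yt: "y \<in> tensors I L" using y by (simp add: contraction_kernel_def)
    have "contract Is (x + y) = 0" if "Is \<in> pairs r" for Is
      unfolding contract_add[OF xt yt that] using x y that by (simp add: contraction_kernel_def)
    then show ?thesis by (simp add: contraction_kernel_def fv.subspace_add[OF tensors_subspace xt yt])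
  qed
  show "fscale c x \<in> contraction_kernel r" for c
  proof -
    have "contract Is (fscale c x) = 0" if "Is \<in> pairs r" for Is
      unfolding contract_scale using x that by (simp add: contraction_kernel_def)
    then show ?thesis by (simp add: contraction_kernel_def fv.subspace_scale[OF tensors_subspace xt])
  qed
  show "transfer_op P Q s t x \<in> contraction_kernel r" for s t
  proof -
    have "contract Is (transfer_op P Q s t x) = 0" if "Is \<in> pairs r" for Is
      unfolding contract_transfer_op[OF xt that] using x that by (simp add: contraction_kernel_def transfer_op_zero)
    then show ?thesis using submod_transfer_op[OF submod_tensors xt] by (simp add: contraction_kernel_def)
  qed
qed (auto simp: contraction_kernel_def)

text \<open>Puts a member of the span into the shape used by the definition of \<open>socle\<close>:
  finitely many covers with one vector from each, modulo \<open>F\<close>. A new term in a cover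
  already present is added to the vector chosen there.\<close>

lemma soc_step_finite_sum:
  fixes F :: "('i, 'p, 'k::field_char_0) tensor set"
  assumes F: "submod F" and v: "v \<in> soc_step F"
  shows "\<exists>\<N> h. finite \<N> \<and> \<N> \<subseteq> {N. cover F N} \<and> (\<forall>N\<in>\<N>. h N \<in> N) \<and> v - (\<Sum>N\<in>\<N>. h N) \<in> F"
  using v unfolding soc_step_def
proof (induction rule: fv.span_induct_alt)
  case base
  have "0 - (\<Sum>N\<in>{}. h N) \<in> F" for h :: "('i, 'p, 'k) tensor set \<Rightarrow> _"
    unfolding sum.empty diff_0_right by (rule fv.subspace_0[OF submodD(1)[OF F]])
  then show ?case by blast
next
  case (step c x y)
  obtain \<N> h where \<N>: "finite \<N>" "\<N> \<subseteq> {N. cover F N}" "\<forall>N\<in>\<N>. h N \<in> N" "y - (\<Sum>N\<in>\<N>. h N) \<in> F"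
    using step(2) by blast
  show ?case
  proof (cases "x \<in> F")
    case True
    have "fscale c x + (y - (\<Sum>N\<in>\<N>. h N)) \<in> F"
      by (intro fv.subspace_add[OF submodD(1)[OF F]] fv.subspace_scale[OF submodD(1)[OF F]] True \<N>)
    then have "fscale c x + y - (\<Sum>N\<in>\<N>. h N) \<in> F" by (simp only: add_diff_eq)
    then show ?thesis using \<N>(1-3) by (intro exI[of _ \<N>] exI[of _ h] conjI)
  next
    case False
    then obtain N0 where N0: "cover F N0" "x \<in> N0" using step(1) by blast
    then have sub: "fv.subspace N0" using submodD(1) by (auto simp: cover_def)
    define h' where "h' = h(N0 := (if N0 \<in> \<N> then h N0 else 0) + fscale c x)"
    have mem: "h' N \<in> N" if "N \<in> insert N0 \<N>" for N
      using that \<N>(3) fv.subspace_add[OF sub _ fv.subspace_scale[OF sub N0(2)]] fv.subspace_0[OF sub]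
      by (auto simp: h'_def)
    have "(\<Sum>N\<in>insert N0 \<N>. h' N) = (\<Sum>N\<in>\<N>. h N) + fscale c x"
    proof (cases "N0 \<in> \<N>")
      case True
      then have "(\<Sum>N\<in>insert N0 \<N>. h' N) = h' N0 + (\<Sum>N\<in>\<N> - {N0}. h' N)"
        using \<N>(1) by (simp add: insert_absorb sum.remove[of \<N> N0])
      also have "(\<Sum>N\<in>\<N> - {N0}. h' N) = (\<Sum>N\<in>\<N> - {N0}. h N)" by (rule sum.cong) (auto simp: h'_def)
      finally have "(\<Sum>N\<in>insert N0 \<N>. h' N) = h N0 + fscale c x + (\<Sum>N\<in>\<N> - {N0}. h N)"
        using True unfolding h'_def by (simp only: fun_upd_same if_True)
      also have "\<dots> = h N0 + (\<Sum>N\<in>\<N> - {N0}. h N) + fscale c x" by (simp only: ac_simps)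
      also have "h N0 + (\<Sum>N\<in>\<N> - {N0}. h N) = (\<Sum>N\<in>\<N>. h N)" using True \<N>(1) by (rule sum.remove[symmetric, rotated])
      finally show ?thesis .
    next
      case False
      then have "(\<Sum>N\<in>insert N0 \<N>. h' N) = h' N0 + (\<Sum>N\<in>\<N>. h' N)" using \<N>(1) by simp
      also have "(\<Sum>N\<in>\<N>. h' N) = (\<Sum>N\<in>\<N>. h N)" using False by (intro sum.cong) (auto simp: h'_def)
      finally have "(\<Sum>N\<in>insert N0 \<N>. h' N) = 0 + fscale c x + (\<Sum>N\<in>\<N>. h N)"
        using False unfolding h'_def by (simp only: fun_upd_same if_False)
      then show ?thesis by (simp only: add_0 add.commute)
    qed
    then have "fscale c x + y - (\<Sum>N\<in>insert N0 \<N>. h' N) = y - (\<Sum>N\<in>\<N>. h N)" 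
      by (simp only: add.commute[of "fscale c x" y] add_diff_cancel_right)
    then have "fscale c x + y - (\<Sum>N\<in>insert N0 \<N>. h' N) \<in> F" using \<N>(4) by (simp only:)
    moreover have "finite (insert N0 \<N>)" "insert N0 \<N> \<subseteq> {N. cover F N}" using \<N>(1,2) N0(1) by auto
    ultimately show ?thesis using mem by (intro exI[of _ "insert N0 \<N>"] exI[of _ h'] conjI ballI)
  qed
qed

lemma cover_soc_step: "cover F N \<Longrightarrow> N \<subseteq> soc_step F"
  unfolding soc_step_def by (rule subset_trans[OF _ fv.span_superset]) blast

lemma subset_soc_step: "F \<subseteq> soc_step F"
  unfolding soc_step_def by (rule subset_trans[OF _ fv.span_superset]) blast

end

section \<open>Socles of quotients of modules with coordinates\<close>

text \<open>A linear embedding into a function space. It moves linear algebra on a carrier set to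
  the type class structure of functions, and even the group axioms of \<open>M\<close> follow from
  it.\<close>

definition coords :: "('k::field, 'm, 'z) module_scheme \<Rightarrow> ('m \<Rightarrow> 'a \<Rightarrow> 'k) \<Rightarrow> bool" where
  "coords M \<psi> \<longleftrightarrow> inj_on \<psi> (carrier M) \<and> fv.subspace (\<psi> ` carrier M) \<and> \<zero>\<^bsub>M\<^esub> \<in> carrier M \<and> \<psi> \<zero>\<^bsub>M\<^esub> = 0 \<and>
    (\<forall>x\<in>carrier M. \<forall>y\<in>carrier M. x \<oplus>\<^bsub>M\<^esub> y \<in> carrier M \<and> \<psi> (x \<oplus>\<^bsub>M\<^esub> y) = \<psi> x + \<psi> y) \<and>
    (\<forall>a. \<forall>x\<in>carrier M. a \<odot>\<^bsub>M\<^esub> x \<in> carrier M \<and> \<psi> (a \<odot>\<^bsub>M\<^esub> x) = fscale a (\<psi> x))"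

lemma coordsD:
  assumes "coords M \<psi>"
  shows "inj_on \<psi> (carrier M)" "fv.subspace (\<psi> ` carrier M)" "\<zero>\<^bsub>M\<^esub> \<in> carrier M" "\<psi> \<zero>\<^bsub>M\<^esub> = 0"
    "x \<in> carrier M \<Longrightarrow> y \<in> carrier M \<Longrightarrow> x \<oplus>\<^bsub>M\<^esub> y \<in> carrier M"
    "x \<in> carrier M \<Longrightarrow> y \<in> carrier M \<Longrightarrow> \<psi> (x \<oplus>\<^bsub>M\<^esub> y) = \<psi> x + \<psi> y"
    "x \<in> carrier M \<Longrightarrow> a \<odot>\<^bsub>M\<^esub> x \<in> carrier M"
    "x \<in> carrier M \<Longrightarrow> \<psi> (a \<odot>\<^bsub>M\<^esub> x) = fscale a (\<psi> x)"
  using assms by (auto simp: coords_def)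

lemma coords_eqI:
  assumes "coords M \<psi>" "x \<in> carrier M" "y \<in> carrier M" "\<psi> x = \<psi> y"
  shows "x = y"
  using assms coordsD(1) by (auto dest: inj_onD)

lemma coords_abelian_group:
  assumes c: "coords M \<psi>"
  shows "abelian_group M"
proof (rule abelian_groupI)
  note d = coordsD[OF c]
  show "x \<oplus>\<^bsub>M\<^esub> y \<oplus>\<^bsub>M\<^esub> z = x \<oplus>\<^bsub>M\<^esub> (y \<oplus>\<^bsub>M\<^esub> z)" if "x \<in> carrier M" "y \<in> carrier M" "z \<in> carrier M" for x y z
    by (rule coords_eqI[OF c]) (use that in \<open>auto simp: d add.assoc\<close>)
  show "x \<oplus>\<^bsub>M\<^esub> y = y \<oplus>\<^bsub>M\<^esub> x" if "x \<in> carrier M" "y \<in> carrier M" for x y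
    by (rule coords_eqI[OF c]) (use that in \<open>auto simp: d add.commute\<close>)
  show "\<zero>\<^bsub>M\<^esub> \<oplus>\<^bsub>M\<^esub> x = x" if "x \<in> carrier M" for x
    by (rule coords_eqI[OF c]) (use that in \<open>auto simp: d\<close>)
  show "\<exists>y\<in>carrier M. y \<oplus>\<^bsub>M\<^esub> x = \<zero>\<^bsub>M\<^esub>" if x: "x \<in> carrier M" for x
  proof
    show "(- 1) \<odot>\<^bsub>M\<^esub> x \<oplus>\<^bsub>M\<^esub> x = \<zero>\<^bsub>M\<^esub>"
      by (rule coords_eqI[OF c]) (use x in \<open>auto simp: d fun_eq_iff\<close>)
  qed (use x d in auto)
qed (use coordsD[OF c] in auto)

lemma coords_submodule:
  fixes M :: "('k::field, 'm, 'z) module_scheme"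
  assumes c: "coords M \<psi>"
  shows "submodule N (field_ring :: 'k ring) M \<longleftrightarrow> N \<subseteq> carrier M \<and> fv.subspace (\<psi> ` N)"
proof
  note d = coordsD[OF c]
  assume s: "submodule N (field_ring :: 'k ring) M"
  then have g: "subgroup N (add_monoid M)" by (rule submodule.axioms)
  have NM: "N \<subseteq> carrier M" using subgroup.subset[OF g] by simp
  have "fv.subspace (\<psi> ` N)"
  proof (rule fv.subspaceI)
    show "0 \<in> \<psi> ` N" using subgroup.one_closed[OF g] d(4) by (metis image_eqI monoid.select_convs(2))
    fix x assume "x \<in> \<psi> ` N"
    then obtain m where m: "m \<in> N" "x = \<psi> m" by blast
    show "x + y \<in> \<psi> ` N" if "y \<in> \<psi> ` N" for y
    proof -
      obtain m' where m': "m' \<in> N" "y = \<psi> m'" using \<open>y \<in> \<psi> ` N\<close> by blast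
      have "m \<oplus>\<^bsub>M\<^esub> m' \<in> N" using subgroup.m_closed[OF g m(1) m'(1)] by simp
      moreover have "x + y = \<psi> (m \<oplus>\<^bsub>M\<^esub> m')" using m m' NM by (simp add: d subsetD)
      ultimately show ?thesis by blast
    qed
    show "fscale a x \<in> \<psi> ` N" for a
    proof -
      have "a \<odot>\<^bsub>M\<^esub> m \<in> N" by (rule submodule.smult_closed[OF s _ m(1)]) (simp add: field_ring_def)
      moreover have "fscale a x = \<psi> (a \<odot>\<^bsub>M\<^esub> m)" using m NM by (simp add: d subsetD)
      ultimately show ?thesis by blast
    qed
  qed
  with NM show "N \<subseteq> carrier M \<and> fv.subspace (\<psi> ` N)" ..
next
  note d = coordsD[OF c]
  assume "N \<subseteq> carrier M \<and> fv.subspace (\<psi> ` N)"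
  then have NM: "N \<subseteq> carrier M" and sub: "fv.subspace (\<psi> ` N)" by auto
  have mem: "m \<in> N" if "m \<in> carrier M" "\<psi> m \<in> \<psi> ` N" for m
    using that NM coords_eqI[OF c that(1)] by blast
  interpret abelian_group M by (rule coords_abelian_group[OF c])
  show "submodule N (field_ring :: 'k ring) M"
  proof (intro submodule.intro subgroup.intro submodule_axioms.intro)
    show "N \<subseteq> carrier (add_monoid M)" using NM by simp
    show "x \<otimes>\<^bsub>add_monoid M\<^esub> y \<in> N" if "x \<in> N" "y \<in> N" for x y
    proof -
      have "\<psi> (x \<oplus>\<^bsub>M\<^esub> y) \<in> \<psi> ` N" using that NM fv.subspace_add[OF sub] by (simp add: d subsetD)
      then show ?thesis using mem that NM by (simp add: d subsetD)
    qed
    show "\<one>\<^bsub>add_monoid M\<^esub> \<in> N" using mem[of "\<zero>\<^bsub>M\<^esub>"] fv.subspace_0[OF sub] by (simp add: d)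
    show "inv\<^bsub>add_monoid M\<^esub> x \<in> N" if x: "x \<in> N" for x
    proof -
      have xM: "x \<in> carrier M" using x NM by blast
      have "\<psi> (\<ominus>\<^bsub>M\<^esub> x) + \<psi> x = \<psi> (\<ominus>\<^bsub>M\<^esub> x \<oplus>\<^bsub>M\<^esub> x)" using xM by (simp add: d)
      also have "\<dots> = 0" using xM by (simp add: l_neg d)
      finally have "\<psi> (\<ominus>\<^bsub>M\<^esub> x) = - \<psi> x" by (simp add: eq_neg_iff_add_eq_0)
      then have "\<psi> (\<ominus>\<^bsub>M\<^esub> x) \<in> \<psi> ` N" using x fv.subspace_neg[OF sub] by simp
      then show ?thesis using mem[of "\<ominus>\<^bsub>M\<^esub> x"] xM by (simp add: a_inv_def)
    qed
    show "a \<odot>\<^bsub>M\<^esub> x \<in> N" if "x \<in> N" for a x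
    proof -
      have "\<psi> (a \<odot>\<^bsub>M\<^esub> x) \<in> \<psi> ` N" using that NM fv.subspace_scale[OF sub] by (simp add: d subsetD)
      then show ?thesis using mem that NM by (simp add: d subsetD)
    qed
  qed
qed

lemma coords_restrict:
  fixes M :: "('k::field, 'm, 'z) module_scheme"
  assumes c: "coords M \<psi>" and S: "S \<subseteq> carrier M" "fv.subspace (\<psi> ` S)"
  shows "coords (M\<lparr>carrier := S\<rparr>) \<psi>"
proof -
  note d = coordsD[OF c]
  have mem: "m \<in> S" if "m \<in> carrier M" "\<psi> m \<in> \<psi> ` S" for m
    using that S(1) coords_eqI[OF c that(1)] by blast
  have "inj_on \<psi> S" by (rule inj_on_subset[OF d(1) S(1)])
  moreover have "\<zero>\<^bsub>M\<^esub> \<in> S" using mem[of "\<zero>\<^bsub>M\<^esub>"] fv.subspace_0[OF S(2)] by (simp add: d)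
  moreover have "x \<oplus>\<^bsub>M\<^esub> y \<in> S" if "x \<in> S" "y \<in> S" for x y
    using mem[of "x \<oplus>\<^bsub>M\<^esub> y"] that S(1) fv.subspace_add[OF S(2)] by (simp add: d subsetD)
  moreover have "a \<odot>\<^bsub>M\<^esub> x \<in> S" if "x \<in> S" for x a
    using mem[of "a \<odot>\<^bsub>M\<^esub> x"] that S(1) fv.subspace_scale[OF S(2)] by (simp add: d subsetD)
  ultimately show ?thesis using S d unfolding coords_def by (auto simp: subsetD)
qed

lemma coords_finsum:
  assumes c: "coords M \<psi>" and A: "finite A" "f \<in> A \<rightarrow> carrier M"
  shows "finsum M f A \<in> carrier M" "\<psi> (finsum M f A) = (\<Sum>a\<in>A. \<psi> (f a))"
proof -
  interpret abelian_group M by (rule coords_abelian_group[OF c])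
  show "finsum M f A \<in> carrier M" using A(2) by (rule finsum_closed)
  show "\<psi> (finsum M f A) = (\<Sum>a\<in>A. \<psi> (f a))"
    using A
  proof (induction A rule: finite_induct)
    case empty
    then show ?case by (simp add: coordsD(4)[OF c])
  next
    case (insert a A)
    then have "f \<in> A \<rightarrow> carrier M" "f a \<in> carrier M" by auto
    then show ?case using insert by (simp add: finsum_insert coordsD(6)[OF c] finsum_closed)
  qed
qed

lemma lie_quotient_simps:
  "carrier (lie_quotient M N) = a_rcosets\<^bsub>M\<^esub> N" "\<zero>\<^bsub>lie_quotient M N\<^esub> = N"
  "X \<oplus>\<^bsub>lie_quotient M N\<^esub> Y = X <+>\<^bsub>M\<^esub> Y"
  "a \<odot>\<^bsub>lie_quotient M N\<^esub> X = (\<Union>m\<in>X. N +>\<^bsub>M\<^esub> (a \<odot>\<^bsub>M\<^esub> m))"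
  "act (lie_quotient M N) x X = (\<Union>m\<in>X. N +>\<^bsub>M\<^esub> (act M x m))"
  by (simp_all add: lie_quotient_def quotient_module_def module.defs lie_module.defs)


lemma coset_eq:
  assumes c: "coords M \<psi>" and N: "N \<subseteq> carrier M" and m: "m \<in> carrier M"
  shows "N +>\<^bsub>M\<^esub> m = {m' \<in> carrier M. \<psi> m' - \<psi> m \<in> \<psi> ` N}"
proof -
  note d = coordsD[OF c]
  have "N +>\<^bsub>M\<^esub> m = {n \<oplus>\<^bsub>M\<^esub> m |n. n \<in> N}" by (auto simp: a_r_coset_def r_coset_def)
  also have "\<dots> = {m' \<in> carrier M. \<psi> m' - \<psi> m \<in> \<psi> ` N}"
  proof (intro subset_antisym subsetI)
    fix x assume "x \<in> {n \<oplus>\<^bsub>M\<^esub> m |n. n \<in> N}"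
    then obtain n where n: "n \<in> N" "x = n \<oplus>\<^bsub>M\<^esub> m" by blast
    then have nM: "n \<in> carrier M" using N by blast
    have "\<psi> x - \<psi> m = \<psi> n" unfolding n(2) d(6)[OF nM m] by (rule add_diff_cancel_right')
    then show "x \<in> {m' \<in> carrier M. \<psi> m' - \<psi> m \<in> \<psi> ` N}" using n d(5)[OF nM m] by auto
  next
    fix x assume "x \<in> {m' \<in> carrier M. \<psi> m' - \<psi> m \<in> \<psi> ` N}"
    then obtain n where x: "x \<in> carrier M" and n: "n \<in> N" "\<psi> x - \<psi> m = \<psi> n" by blast
    have nM: "n \<in> carrier M" using n N by blast
    have "\<psi> x = \<psi> n + \<psi> m" using n(2) by (simp only: diff_eq_eq)
    then have "x = n \<oplus>\<^bsub>M\<^esub> m" using coords_eqI[OF c x d(5)[OF nM m]] d(6)[OF nM m] by simp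
    then show "x \<in> {n \<oplus>\<^bsub>M\<^esub> m |n. n \<in> N}" using n by blast
  qed
  finally show ?thesis .
qed

text \<open>A linear map with kernel \<open>N\<close> serves as coordinates on the quotient by \<open>N\<close>.\<close>

locale quotient_coords =
  fixes M :: "('k::field, 'm, 'x) lie_module" and \<psi> :: "'m \<Rightarrow> 'a \<Rightarrow> 'k" and N :: "'m set"
    and p :: "('a \<Rightarrow> 'k) \<Rightarrow> ('a \<Rightarrow> 'k)"
  assumes c: "coords M \<psi>" and N: "N \<subseteq> carrier M" "fv.subspace (\<psi> ` N)"
    and p: "Vector_Spaces.linear fscale fscale p" "\<And>v. p v = 0 \<longleftrightarrow> v \<in> \<psi> ` N"
begin

abbreviation coset :: "'m \<Rightarrow> 'm set" where "coset m \<equiv> N +>\<^bsub>M\<^esub> m"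

text \<open>Independent of the chosen representative, since \<open>p\<close> vanishes on the
  coordinates of \<open>N\<close>.\<close>

definition \<chi> :: "'m set \<Rightarrow> 'a \<Rightarrow> 'k" where "\<chi> X = p (\<psi> (SOME m. m \<in> X))"

lemmas d = coordsD[OF c]

lemma coset_mem: "m \<in> carrier M \<Longrightarrow> m' \<in> coset m \<longleftrightarrow> m' \<in> carrier M \<and> p (\<psi> m') = p (\<psi> m)"
  using p(2)[of "\<psi> m' - \<psi> m"] by (simp add: coset_eq[OF c N(1)] fvp.linear_diff[OF p(1)])

lemma coset_self: "m \<in> carrier M \<Longrightarrow> m \<in> coset m"
  by (simp add: coset_mem)

lemma coset_eq_iff: "m \<in> carrier M \<Longrightarrow> m' \<in> carrier M \<Longrightarrow> coset m = coset m' \<longleftrightarrow> p (\<psi> m) = p (\<psi> m')"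
  using coset_mem coset_self by (metis (mono_tags, lifting) subsetI subset_antisym)

lemma \<chi>_coset: "m \<in> carrier M \<Longrightarrow> \<chi> (coset m) = p (\<psi> m)"
  unfolding \<chi>_def using someI[of "\<lambda>x. x \<in> coset m", OF coset_self] coset_mem by blast

lemma carrier_quotient: "carrier (lie_quotient M N) = coset ` carrier M"
  by (auto simp: lie_quotient_simps A_RCOSETS_def RCOSETS_def a_r_coset_def)

lemma coset_add: "m \<in> carrier M \<Longrightarrow> m' \<in> carrier M \<Longrightarrow> coset m <+>\<^bsub>M\<^esub> coset m' = coset (m \<oplus>\<^bsub>M\<^esub> m')"
proof (intro subset_antisym subsetI)
  assume m: "m \<in> carrier M" "m' \<in> carrier M"
  fix x assume "x \<in> coset m <+>\<^bsub>M\<^esub> coset m'"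
  then obtain y z where yz: "y \<in> coset m" "z \<in> coset m'" "x = y \<oplus>\<^bsub>M\<^esub> z"
    by (auto simp: set_add_def set_mult_def)
  then show "x \<in> coset (m \<oplus>\<^bsub>M\<^esub> m')" using m by (simp add: coset_mem d fvp.linear_add[OF p(1)])
next
  assume m: "m \<in> carrier M" "m' \<in> carrier M"
  fix x assume x: "x \<in> coset (m \<oplus>\<^bsub>M\<^esub> m')"
  interpret abelian_group M by (rule coords_abelian_group[OF c])
  from x obtain n where n: "n \<in> N" "x = n \<oplus>\<^bsub>M\<^esub> (m \<oplus>\<^bsub>M\<^esub> m')" by (auto simp: a_r_coset_def r_coset_def)
  have "x = (n \<oplus>\<^bsub>M\<^esub> m) \<oplus>\<^bsub>M\<^esub> m'" using n m N(1) by (simp add: a_assoc subsetD)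
  moreover have "n \<oplus>\<^bsub>M\<^esub> m \<in> coset m" using n by (auto simp: a_r_coset_def r_coset_def)
  ultimately show "x \<in> coset m <+>\<^bsub>M\<^esub> coset m'" using coset_self[OF m(2)]
    by (auto simp: set_add_def set_mult_def)
qed

lemma UN_coset:
  assumes m: "m \<in> carrier M" and f: "\<And>m'. m' \<in> coset m \<Longrightarrow> coset (f m') = coset (f m)"
  shows "(\<Union>m'\<in>coset m. coset (f m')) = coset (f m)"
  using f coset_self[OF m] by blast

lemma coset_smult: "m \<in> carrier M \<Longrightarrow> (\<Union>m'\<in>coset m. coset (a \<odot>\<^bsub>M\<^esub> m')) = coset (a \<odot>\<^bsub>M\<^esub> m)"
  by (rule UN_coset) (auto simp: coset_mem coset_eq_iff d fvp.linear_scale[OF p(1)])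

lemma coset_zero: "coset \<zero>\<^bsub>M\<^esub> = N"
proof -
  have "m \<in> N" if "m \<in> carrier M" "\<psi> m \<in> \<psi> ` N" for m
    using that N coords_eqI[OF c that(1)] by blast
  then show ?thesis using N(1) by (auto simp: coset_eq[OF c N(1) d(3)] d(4))
qed

lemma coords_quotient: "coords (lie_quotient M N) \<chi>"
  unfolding coords_def carrier_quotient
proof (intro conjI)
  show "inj_on \<chi> (coset ` carrier M)" 
  proof (rule inj_onI)
    fix X Y assume X: "X \<in> coset ` carrier M" and Y: "Y \<in> coset ` carrier M" and e: "\<chi> X = \<chi> Y"
    obtain m where m: "m \<in> carrier M" "X = coset m" using X by blast
    obtain m' where m': "m' \<in> carrier M" "Y = coset m'" using Y by blast
    show "X = Y" using e m m' coset_eq_iff[OF m(1) m'(1)] by (simp add: \<chi>_coset)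
  qed
  have "\<chi> ` coset ` carrier M = p ` (\<psi> ` carrier M)" by (force simp: \<chi>_coset)
  then show "fv.subspace (\<chi> ` coset ` carrier M)"
    using fvp.linear_subspace_image[OF p(1) d(2)] by simp
  show "\<zero>\<^bsub>lie_quotient M N\<^esub> \<in> coset ` carrier M" using coset_zero d(3) by (auto simp: lie_quotient_simps)
  show "\<chi> \<zero>\<^bsub>lie_quotient M N\<^esub> = 0"
    using \<chi>_coset[OF d(3)] fvp.linear_0[OF p(1)] by (simp add: lie_quotient_simps coset_zero d(4))
  show "\<forall>X\<in>coset ` carrier M. \<forall>Y\<in>coset ` carrier M. X \<oplus>\<^bsub>lie_quotient M N\<^esub> Y \<in> coset ` carrier M \<and>
      \<chi> (X \<oplus>\<^bsub>lie_quotient M N\<^esub> Y) = \<chi> X + \<chi> Y"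
    by (auto simp: lie_quotient_simps coset_add \<chi>_coset d fvp.linear_add[OF p(1)])
  show "\<forall>a. \<forall>X\<in>coset ` carrier M. a \<odot>\<^bsub>lie_quotient M N\<^esub> X \<in> coset ` carrier M \<and>
      \<chi> (a \<odot>\<^bsub>lie_quotient M N\<^esub> X) = fscale a (\<chi> X)"
    by (auto simp: lie_quotient_simps coset_smult \<chi>_coset d fvp.linear_scale[OF p(1)])
qed

text \<open>The coordinates of all representatives. This is the correspondence between submodules of
  the quotient and submodules above \<open>N\<close>, seen in coordinates.\<close>

definition pull :: "'m set set \<Rightarrow> ('a \<Rightarrow> 'k) set" where
  "pull S = \<psi> ` {m \<in> carrier M. coset m \<in> S}"

lemma pull_mem: "m \<in> carrier M \<Longrightarrow> \<psi> m \<in> pull S \<longleftrightarrow> coset m \<in> S"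
  unfolding pull_def using coords_eqI[OF c] by blast

text \<open>Within the range of the coordinates, each of the two sets arises from the other as an
  image or a preimage under the linear map \<open>p\<close>.\<close>

lemma pull_subspace_iff:
  assumes S: "S \<subseteq> carrier (lie_quotient M N)"
  shows "fv.subspace (\<chi> ` S) \<longleftrightarrow> fv.subspace (pull S)"
proof
  have "\<chi> ` S = p ` pull S"
  proof (intro subset_antisym subsetI)
    fix v assume "v \<in> \<chi> ` S"
    then obtain X where X: "X \<in> S" "v = \<chi> X" by blast
    then obtain m where "m \<in> carrier M" "X = coset m" using S by (auto simp: carrier_quotient)
    then show "v \<in> p ` pull S" using X by (auto simp: \<chi>_coset pull_def)
  next
    fix v assume "v \<in> p ` pull S"
    then show "v \<in> \<chi> ` S" by (force simp: \<chi>_coset pull_def)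
  qed
  then show "fv.subspace (pull S) \<Longrightarrow> fv.subspace (\<chi> ` S)"
    using fvp.linear_subspace_image[OF p(1)] by simp
  have "pull S = \<psi> ` carrier M \<inter> p -` (\<chi> ` S)"
  proof (intro subset_antisym subsetI)
    fix v assume "v \<in> pull S"
    then show "v \<in> \<psi> ` carrier M \<inter> p -` (\<chi> ` S)" by (force simp: \<chi>_coset pull_def)
  next
    fix v assume v: "v \<in> \<psi> ` carrier M \<inter> p -` (\<chi> ` S)"
    then obtain m X where m: "m \<in> carrier M" "v = \<psi> m" "X \<in> S" "p v = \<chi> X" by auto
    obtain m' where m': "m' \<in> carrier M" "X = coset m'" using S m(3) by (auto simp: carrier_quotient)
    then have "coset m = coset m'" using m by (simp add: \<chi>_coset coset_eq_iff)
    then show "v \<in> pull S" using m m' by (auto simp: pull_def)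
  qed
  then show "fv.subspace (\<chi> ` S) \<Longrightarrow> fv.subspace (pull S)"
    using fv.subspace_inter[OF d(2) fvp.linear_subspace_vimage[OF p(1)]] by simp
qed

end

text \<open>The identity minus a projection onto \<open>F\<close>. The quotient coordinates thus
  stay in the same function space, whichever layer of the filtration is divided out.\<close>

lemma exists_linear_with_kernel:
  fixes F :: "('a \<Rightarrow> 'k::field) set"
  assumes "fv.subspace F"
  obtains p :: "('a \<Rightarrow> 'k) \<Rightarrow> ('a \<Rightarrow> 'k)" where "Vector_Spaces.linear fscale fscale p" "\<And>v. p v = 0 \<longleftrightarrow> v \<in> F"
proof -
  have lid: "Vector_Spaces.linear fscale fscale (\<lambda>x :: 'a \<Rightarrow> 'k. x)" by unfold_locales auto
  obtain q where q: "range q \<subseteq> F" "Vector_Spaces.linear fscale fscale q" "\<And>v. v \<in> F \<Longrightarrow> q v = v"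
    using fvp.linear_exists_left_inverse_on[OF lid assms] by auto
  have "Vector_Spaces.linear fscale fscale (\<lambda>v. v - q v)" by (rule fvp.linear_compose_sub[OF lid q(2)])
  moreover have "v - q v = 0 \<longleftrightarrow> v \<in> F" for v
  proof
    assume "v - q v = 0"
    then have "v = q v" by (simp only: right_minus_eq)
    also have "q v \<in> F" using q(1) by blast
    finally show "v \<in> F" .
  qed (simp add: q(3))
  ultimately show thesis using that by blast
qed

section \<open>Lie modules whose submodules are those of the coordinate model\<close>

text \<open>Elements of \<open>L\<close> have to preserve every coordinate submodule, and every
  off-diagonal matrix unit has to be realized by an element of \<open>L\<close>. Together these
  identify the submodules of \<open>M\<close> with those of the coordinate model, for
  \<open>gl_infinity\<close> and \<open>sl_infinity\<close> alike.\<close>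

locale tensor_coords = T: tensor_family "{()}" P Q
  for P Q :: "'p set" +
  fixes L :: "('k::field_char_0, 'x, 'b) lie_algebra_scheme" and M :: "('k, 'm, 'x) lie_module"
    and \<psi> :: "'m \<Rightarrow> (unit, 'p, 'k) tensor"
  assumes c: "coords M \<psi>" and range: "\<psi> ` carrier M = tensors {()} (P \<union> Q)"
    and act_op: "\<And>x. x \<in> carrier L \<Longrightarrow> \<exists>f. Vector_Spaces.linear fscale fscale f \<and>
      (\<forall>m\<in>carrier M. act M x m \<in> carrier M \<and> \<psi> (act M x m) = f (\<psi> m)) \<and>
      (\<forall>F. T.submod F \<longrightarrow> f ` F \<subseteq> F)"
    and op_act: "\<And>s t. s \<noteq> t \<Longrightarrow> \<exists>x\<in>carrier L. \<forall>m\<in>carrier M. \<psi> (act M x m) = transfer_op P Q s t (\<psi> m)"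
begin

lemma act_opE:
  assumes "x \<in> carrier L"
  obtains f where "Vector_Spaces.linear fscale fscale f"
    "\<And>m. m \<in> carrier M \<Longrightarrow> act M x m \<in> carrier M" "\<And>m. m \<in> carrier M \<Longrightarrow> \<psi> (act M x m) = f (\<psi> m)"
    "\<And>F. T.submod F \<Longrightarrow> f ` F \<subseteq> F"
proof -
  obtain f where f: "Vector_Spaces.linear fscale fscale f \<and>
      (\<forall>m\<in>carrier M. act M x m \<in> carrier M \<and> \<psi> (act M x m) = f (\<psi> m)) \<and>
      (\<forall>F. T.submod F \<longrightarrow> f ` F \<subseteq> F)"
    using act_op[OF assms] by (rule exE)
  show thesis by (rule that[of f]) (use f in \<open>simp_all\<close>)
qed

lemma range_mem: "m \<in> carrier M \<Longrightarrow> \<psi> m \<in> tensors {()} (P \<union> Q)"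
  using range by blast

lemma rangeE: "v \<in> tensors {()} (P \<union> Q) \<Longrightarrow> \<exists>m\<in>carrier M. \<psi> m = v"
  using range by (metis imageE)

context
  fixes F :: "(unit, 'p, 'k) tensor set" and N :: "'m set"
    and p :: "(unit, 'p, 'k) tensor \<Rightarrow> (unit, 'p, 'k) tensor"
  assumes F: "T.submod F" and N: "N = {m \<in> carrier M. \<psi> m \<in> F}"
    and p: "Vector_Spaces.linear fscale fscale p" "\<And>v. p v = 0 \<longleftrightarrow> v \<in> F"
begin

lemma image_N: "\<psi> ` N = F"
proof (intro subset_antisym subsetI)
  fix v assume v: "v \<in> F"
  then obtain m where "m \<in> carrier M" "\<psi> m = v" using rangeE T.submodD(2)[OF F] by blast
  then show "v \<in> \<psi> ` N" using v N by blast
qed (use N in auto)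

interpretation q: quotient_coords M \<psi> N p
proof (rule quotient_coords.intro[OF c _ _ p(1)])
  show "N \<subseteq> carrier M" using N by blast
  show "fv.subspace (\<psi> ` N)" unfolding image_N by (rule T.submodD(1)[OF F])
  show "p v = 0 \<longleftrightarrow> v \<in> \<psi> ` N" for v unfolding image_N by (rule p(2))
qed

text \<open>The operator of \<open>x\<close> preserves \<open>F\<close>, so the cosets in the union
  that defines the quotient action all agree.\<close>

lemma act_coset:
  assumes x: "x \<in> carrier L" and m: "m \<in> carrier M"
  shows "act (lie_quotient M N) x (q.coset m) = q.coset (act M x m)"
proof -
  obtain f where f: "Vector_Spaces.linear fscale fscale f"
      "\<And>m. m \<in> carrier M \<Longrightarrow> act M x m \<in> carrier M" "\<And>m. m \<in> carrier M \<Longrightarrow> \<psi> (act M x m) = f (\<psi> m)"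
      "f ` F \<subseteq> F"
    by (rule act_opE[OF x]) (use F in blast)
  have "q.coset (act M x m') = q.coset (act M x m)" if m': "m' \<in> q.coset m" for m'
  proof -
    have m'M: "m' \<in> carrier M" "p (\<psi> m') = p (\<psi> m)" using m' q.coset_mem[OF m] by auto
    then have "p (\<psi> m' - \<psi> m) = 0" unfolding fvp.linear_diff[OF p(1)] by (simp only: right_minus_eq)
    then have "f (\<psi> m' - \<psi> m) \<in> F" using p(2) f(4) by blast
    then have "p (f (\<psi> m') - f (\<psi> m)) = 0" unfolding fvp.linear_diff[OF f(1)] using p(2) by blast
    then have "p (f (\<psi> m')) = p (f (\<psi> m))" unfolding fvp.linear_diff[OF p(1)] by (simp only: right_minus_eq)
    then show ?thesis using m m'M f by (simp add: q.coset_eq_iff)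
  qed
  then show ?thesis unfolding lie_quotient_simps by (rule q.UN_coset[OF m])
qed

text \<open>The two locale conditions give the two directions: realized matrix units turn stability
  under \<open>L\<close> into \<open>T.submod\<close>, and operators of \<open>L\<close> preserve
  every coordinate submodule.\<close>

lemma lie_submodule_quotient_iff:
  assumes S: "S \<subseteq> carrier (lie_quotient M N)"
  shows "lie_submodule L (lie_quotient M N) S \<longleftrightarrow> T.submod (q.pull S)"
proof -
  have 1: "submodule S (field_ring :: 'k ring) (lie_quotient M N) \<longleftrightarrow> fv.subspace (q.pull S)"
    using coords_submodule[OF q.coords_quotient] q.pull_subspace_iff[OF S] S by simp
  have "(\<forall>x\<in>carrier L. \<forall>X\<in>S. act (lie_quotient M N) x X \<in> S) \<longleftrightarrow>
      (\<forall>s t v. s \<noteq> t \<longrightarrow> v \<in> q.pull S \<longrightarrow> transfer_op P Q s t v \<in> q.pull S)" (is "?A \<longleftrightarrow> ?B")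
    if sub: "fv.subspace (q.pull S)"
  proof
    assume A: ?A
    show ?B
    proof (intro allI impI)
      fix s t :: nat and v assume st: "s \<noteq> t" and v: "v \<in> q.pull S"
      obtain m where m: "m \<in> carrier M" "q.coset m \<in> S" "v = \<psi> m" using v by (auto simp: q.pull_def)
      obtain x where x: "x \<in> carrier L" "\<And>m. m \<in> carrier M \<Longrightarrow> \<psi> (act M x m) = transfer_op P Q s t (\<psi> m)"
        using op_act[OF st] by blast
      have xm: "act M x m \<in> carrier M" using act_opE[OF x(1)] m(1) by metis
      have "q.coset (act M x m) \<in> S" using A x(1) m(2) act_coset[OF x(1) m(1)] by metis
      then have "\<psi> (act M x m) \<in> q.pull S" using q.pull_mem[OF xm] by simp
      then show "transfer_op P Q s t v \<in> q.pull S" using x(2)[OF m(1)] m(3) by simp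
    qed
  next
    assume B: ?B
    have sm: "T.submod (q.pull S)" unfolding T.submod_def using sub B range_mem by (auto simp: q.pull_def)
    show ?A
    proof (intro ballI)
      fix x X assume x: "x \<in> carrier L" and X: "X \<in> S"
      then obtain m where m: "m \<in> carrier M" "X = q.coset m" using S by (auto simp: q.carrier_quotient)
      obtain f where f: "act M x m \<in> carrier M" "\<psi> (act M x m) = f (\<psi> m)" "f ` q.pull S \<subseteq> q.pull S"
        by (rule act_opE[OF x]) (use sm m(1) in blast)
      have "\<psi> m \<in> q.pull S" using q.pull_mem[OF m(1)] X m(2) by simp
      then have "\<psi> (act M x m) \<in> q.pull S" using f by auto
      then show "act (lie_quotient M N) x X \<in> S"
        using act_coset[OF x m(1)] m(2) q.pull_mem[OF f(1)] by simp
    qed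
  qed
  moreover have "q.pull S \<subseteq> tensors {()} (P \<union> Q)" using range_mem by (auto simp: q.pull_def)
  ultimately show ?thesis unfolding lie_submodule_def T.submod_def 1 by blast
qed

text \<open>Inverse to \<open>q.pull\<close> on coordinate submodules that contain
  \<open>F\<close>.\<close>

definition push :: "(unit, 'p, 'k) tensor set \<Rightarrow> 'm set set" where
  "push H = q.coset ` {m \<in> carrier M. \<psi> m \<in> H}"

lemma push_carrier: "push H \<subseteq> carrier (lie_quotient M N)"
  by (auto simp: push_def q.carrier_quotient)

lemma pull_push:
  assumes H: "T.submod H" "F \<subseteq> H"
  shows "q.pull (push H) = H"
proof (intro subset_antisym subsetI)
  fix v assume "v \<in> q.pull (push H)"
  then obtain m m' where m: "m \<in> carrier M" "v = \<psi> m" "m' \<in> carrier M" "\<psi> m' \<in> H" "q.coset m = q.coset m'"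
    by (auto simp: q.pull_def push_def)
  then have "p (\<psi> m) = p (\<psi> m')" using q.coset_eq_iff by blast
  then have "p (\<psi> m - \<psi> m') = 0" unfolding fvp.linear_diff[OF p(1)] by (simp only: right_minus_eq)
  then have "\<psi> m - \<psi> m' \<in> H" using p(2) H(2) by blast
  from fv.subspace_add[OF T.submodD(1)[OF H(1)] this m(4)] show "v \<in> H" by (simp only: diff_add_cancel m(2))
next
  fix v assume v: "v \<in> H"
  then obtain m where "m \<in> carrier M" "\<psi> m = v" using rangeE T.submodD(2)[OF H(1)] by blast
  then show "v \<in> q.pull (push H)" using v by (auto simp: q.pull_def push_def)
qed

lemma push_pull:
  assumes "S \<subseteq> carrier (lie_quotient M N)"
  shows "push (q.pull S) = S"
proof (intro subset_antisym subsetI)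
  fix X assume "X \<in> push (q.pull S)"
  then obtain m where "m \<in> carrier M" "\<psi> m \<in> q.pull S" "X = q.coset m" by (auto simp: push_def)
  then show "X \<in> S" using q.pull_mem by simp
next
  fix X assume X: "X \<in> S"
  then obtain m where m: "m \<in> carrier M" "X = q.coset m" using assms by (auto simp: q.carrier_quotient)
  then show "X \<in> push (q.pull S)" using X q.pull_mem[OF m(1)] by (auto simp: push_def)
qed

lemma push_mono: "H \<subseteq> H' \<Longrightarrow> push H \<subseteq> push H'"
  by (auto simp: push_def)

lemma pull_mono: "S \<subseteq> S' \<Longrightarrow> q.pull S \<subseteq> q.pull S'"
  by (auto simp: q.pull_def)

lemma push_F: "push F = {N}"
proof -
  have 1: "q.coset m = N" if m: "m \<in> carrier M" "\<psi> m \<in> F" for m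
  proof -
    have "p (\<psi> m) = 0" "p (\<psi> \<zero>\<^bsub>M\<^esub>) = 0" using p(2) m(2) fv.subspace_0[OF T.submodD(1)[OF F]] by (simp_all add: q.d)
    then show ?thesis using q.coset_eq_iff[OF m(1) q.d(3)] q.coset_zero by (simp only:)
  qed
  have "\<zero>\<^bsub>M\<^esub> \<in> carrier M" "\<psi> \<zero>\<^bsub>M\<^esub> \<in> F" using q.d(3,4) fv.subspace_0[OF T.submodD(1)[OF F]] by auto
  then have "q.coset \<zero>\<^bsub>M\<^esub> \<in> push F" unfolding push_def by blast
  then have "N \<in> push F" unfolding q.coset_zero .
  moreover have "push F \<subseteq> {N}" unfolding push_def using 1 by blast
  ultimately show ?thesis by blast
qed

text \<open>A submodule of the quotient contains the zero coset, whose representatives are the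
  members of \<open>N\<close>, and their coordinates make up \<open>F\<close>.\<close>

lemma F_subset_pull:
  assumes "T.submod (q.pull S)"
  shows "F \<subseteq> q.pull S"
proof
  fix v assume v: "v \<in> F"
  then obtain m where m: "m \<in> carrier M" "\<psi> m = v" using rangeE T.submodD(2)[OF F] by blast
  have "\<psi> \<zero>\<^bsub>M\<^esub> \<in> q.pull S" using fv.subspace_0[OF T.submodD(1)[OF assms]] by (simp add: q.d)
  then have "q.coset \<zero>\<^bsub>M\<^esub> \<in> S" using q.pull_mem[OF q.d(3)] by simp
  moreover have "q.coset m \<in> push F" using m v by (auto simp: push_def)
  ultimately have "q.coset m \<in> S" using push_F q.coset_zero by simp
  then show "v \<in> q.pull S" using q.pull_mem[OF m(1)] m(2) by simp
qed

lemma lie_submodule_restrict: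
  assumes S: "S \<subseteq> carrier (lie_quotient M N)" "T.submod (q.pull S)"
  shows "lie_submodule L (lie_quotient M N\<lparr>carrier := S\<rparr>) S' \<longleftrightarrow> S' \<subseteq> S \<and> lie_submodule L (lie_quotient M N) S'"
proof -
  have "coords (lie_quotient M N\<lparr>carrier := S\<rparr>) q.\<chi>"
    by (rule coords_restrict[OF q.coords_quotient S(1)]) (use q.pull_subspace_iff[OF S(1)] T.submodD(1)[OF S(2)] in simp)
  then show ?thesis
    using S(1) unfolding lie_submodule_def by (auto simp: coords_submodule coords_submodule[OF q.coords_quotient])
qed

text \<open>The maps \<open>push\<close> and \<open>q.pull\<close> preserve inclusion and match the
  zero submodule of the quotient with \<open>F\<close>, so simplicity becomes the covering
  condition.\<close>

lemma simple_submodules_iff: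
  "S \<in> simple_submodules L (lie_quotient M N) \<longleftrightarrow> S \<subseteq> carrier (lie_quotient M N) \<and> T.cover F (q.pull S)"
proof (cases "S \<subseteq> carrier (lie_quotient M N) \<and> T.submod (q.pull S)")
  \<comment> \<open>If \<open>S\<close> is not a submodule of the quotient, both sides are
    false.\<close>
  case False
  moreover have "S \<subseteq> carrier (lie_quotient M N)" if "lie_submodule L (lie_quotient M N) S"
    using that coords_submodule[OF q.coords_quotient] by (simp add: lie_submodule_def)
  ultimately show ?thesis
    using lie_submodule_quotient_iff by (auto simp: simple_submodules_def T.cover_def)
next
  case True
  then have S: "S \<subseteq> carrier (lie_quotient M N)" "T.submod (q.pull S)" by auto
  have FS: "F \<subseteq> q.pull S" by (rule F_subset_pull[OF S(2)])
  have ne: "S = {N} \<longleftrightarrow> q.pull S = F"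
    using push_F pull_push[OF F subset_refl] push_pull[OF S(1)] by metis
  have "(\<forall>S'. lie_submodule L (lie_quotient M N\<lparr>carrier := S\<rparr>) S' \<longrightarrow> S' = {N} \<or> S' = S) \<longleftrightarrow>
    (\<forall>H. T.submod H \<longrightarrow> F \<subseteq> H \<longrightarrow> H \<subseteq> q.pull S \<longrightarrow> H = F \<or> H = q.pull S)" (is "?A \<longleftrightarrow> ?B")
  proof
    assume A: ?A
    show ?B
    proof (intro allI impI)
      fix H assume H: "T.submod H" "F \<subseteq> H" "H \<subseteq> q.pull S"
      have "push H \<subseteq> S" using push_mono[OF H(3)] push_pull[OF S(1)] by simp
      moreover have "lie_submodule L (lie_quotient M N) (push H)"
        using lie_submodule_quotient_iff[OF push_carrier] pull_push[OF H(1,2)] H(1) by simp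
      ultimately have "push H = {N} \<or> push H = S" using A lie_submodule_restrict[OF S] by blast
      then show "H = F \<or> H = q.pull S" using pull_push[OF H(1,2)] pull_push[OF F subset_refl] push_F by metis
    qed
  next
    assume B: ?B
    show ?A
    proof (intro allI impI)
      fix S' assume "lie_submodule L (lie_quotient M N\<lparr>carrier := S\<rparr>) S'"
      then have S': "S' \<subseteq> S" "lie_submodule L (lie_quotient M N) S'" using lie_submodule_restrict[OF S] by auto
      have S'c: "S' \<subseteq> carrier (lie_quotient M N)" using S'(1) S(1) by blast
      have sm: "T.submod (q.pull S')" using lie_submodule_quotient_iff[OF S'c] S'(2) by simp
      have "q.pull S' = F \<or> q.pull S' = q.pull S" using B sm F_subset_pull[OF sm] pull_mono[OF S'(1)] by blast
      then show "S' = {N} \<or> S' = S" using push_pull[OF S'c] push_pull[OF S(1)] push_F by metis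
    qed
  qed
  then show ?thesis
    using S FS ne lie_submodule_quotient_iff[OF S(1)]
    by (auto simp: simple_submodules_def simple_lie_module_def T.cover_def lie_quotient_simps(2) psubset_eq)
qed

text \<open>Sums of cosets are compared in the quotient coordinates, where they become images under
  \<open>p\<close> of sums of representatives. One direction lifts the summands to representatives;
  the other carries the finite sum of \<open>soc_step_finite_sum\<close> to the quotient.\<close>

lemma socle_iff:
  assumes m: "m \<in> carrier M"
  shows "q.coset m \<in> socle L (lie_quotient M N) \<longleftrightarrow> \<psi> m \<in> T.soc_step F"
proof
  have S: "T.submod (T.soc_step F)" by (rule T.submod_soc_step[OF F])
  note sub = T.submodD(1)[OF S]
  assume "q.coset m \<in> socle L (lie_quotient M N)"
  then obtain \<S> f where \<S>: "finite \<S>" "\<S> \<subseteq> simple_submodules L (lie_quotient M N)" "f \<in> (\<Pi> S\<in>\<S>. S)"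
    and eq: "q.coset m = (\<Oplus>\<^bsub>lie_quotient M N\<^esub>S\<in>\<S>. f S)" unfolding socle_def by blast
  have mem: "\<exists>m'. m' \<in> carrier M \<and> f S = q.coset m' \<and> \<psi> m' \<in> T.soc_step F" if "S \<in> \<S>" for S
  proof -
    have s: "S \<subseteq> carrier (lie_quotient M N)" "T.cover F (q.pull S)" using that \<S>(2) simple_submodules_iff by auto
    have fS: "f S \<in> S" using \<S>(3) that by auto
    then obtain m' where m': "m' \<in> carrier M" "f S = q.coset m'" using s(1) by (auto simp: q.carrier_quotient)
    then have "\<psi> m' \<in> q.pull S" using fS q.pull_mem by simp
    then show ?thesis using m' T.cover_soc_step[OF s(2)] by blast
  qed
  then obtain g where g: "\<And>S. S \<in> \<S> \<Longrightarrow> g S \<in> carrier M" "\<And>S. S \<in> \<S> \<Longrightarrow> f S = q.coset (g S)"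
    "\<And>S. S \<in> \<S> \<Longrightarrow> \<psi> (g S) \<in> T.soc_step F" by metis
  have "f \<in> \<S> \<rightarrow> carrier (lie_quotient M N)" using g by (auto simp: q.carrier_quotient)
  from coords_finsum(2)[OF q.coords_quotient \<S>(1) this]
  have "p (\<psi> m) = (\<Sum>S\<in>\<S>. q.\<chi> (f S))" using eq q.\<chi>_coset[OF m] by simp
  also have "\<dots> = (\<Sum>S\<in>\<S>. p (\<psi> (g S)))" by (rule sum.cong) (use g q.\<chi>_coset in auto)
  also have "\<dots> = p (\<Sum>S\<in>\<S>. \<psi> (g S))" by (rule fvp.linear_sum[OF p(1), symmetric])
  finally have "p (\<psi> m - (\<Sum>S\<in>\<S>. \<psi> (g S))) = 0" unfolding fvp.linear_diff[OF p(1)] by (simp only: right_minus_eq)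
  then have "\<psi> m - (\<Sum>S\<in>\<S>. \<psi> (g S)) \<in> T.soc_step F" using p(2) T.subset_soc_step by blast
  moreover have "(\<Sum>S\<in>\<S>. \<psi> (g S)) \<in> T.soc_step F" by (rule fv.subspace_sum[OF sub]) (rule g(3))
  ultimately have "\<psi> m - (\<Sum>S\<in>\<S>. \<psi> (g S)) + (\<Sum>S\<in>\<S>. \<psi> (g S)) \<in> T.soc_step F" by (rule fv.subspace_add[OF sub])
  then show "\<psi> m \<in> T.soc_step F" by (simp only: diff_add_cancel)
next
  assume "\<psi> m \<in> T.soc_step F"
  from T.soc_step_finite_sum[OF F this]
  obtain \<N> h where \<N>: "finite \<N>" "\<N> \<subseteq> {N. T.cover F N}" "\<forall>N\<in>\<N>. h N \<in> N" "\<psi> m - (\<Sum>N\<in>\<N>. h N) \<in> F"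
    by (elim exE conjE) (erule (3) that)
  have cov: "T.submod H" "F \<subseteq> H" if "H \<in> \<N>" for H using that \<N>(2) by (auto simp: T.cover_def)
  \<comment> \<open>The coset of a representative of the vector that was chosen in the cover
    belonging to \<open>S\<close>.\<close>
  define f where "f S = q.coset (SOME m'. m' \<in> carrier M \<and> \<psi> m' = h (q.pull S))" for S
  have f: "f (push H) \<in> push H" "q.\<chi> (f (push H)) = p (h H)" if H: "H \<in> \<N>" for H
  proof -
    have pp: "q.pull (push H) = H" by (rule pull_push[OF cov[OF H]])
    have hH: "h H \<in> H" using \<N>(3) H by blast
    let ?m = "SOME m'. m' \<in> carrier M \<and> \<psi> m' = h (q.pull (push H))"
    have "\<exists>m'. m' \<in> carrier M \<and> \<psi> m' = h (q.pull (push H))"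
      using rangeE[of "h H"] T.submodD(2)[OF cov(1)[OF H] hH] pp by auto
    from someI_ex[OF this] have m': "?m \<in> carrier M" "\<psi> ?m = h H" using pp by auto
    show "f (push H) \<in> push H" unfolding f_def push_def[of H] using m' hH pp by (auto simp: push_def)
    show "q.\<chi> (f (push H)) = p (h H)" unfolding f_def using q.\<chi>_coset[OF m'(1)] m'(2) by simp
  qed
  \<comment> \<open>Distinct covers give distinct submodules of the quotient, so no summands
    merge.\<close>
  have inj: "inj_on push \<N>" by (rule inj_onI) (metis pull_push cov)
  have simple: "push H \<in> simple_submodules L (lie_quotient M N)" if H: "H \<in> \<N>" for H
    using simple_submodules_iff push_carrier pull_push[OF cov[OF H]] \<N>(2) H by auto
  let ?s = "\<Oplus>\<^bsub>lie_quotient M N\<^esub>S\<in>push ` \<N>. f S"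
  have fc: "f \<in> push ` \<N> \<rightarrow> carrier (lie_quotient M N)" using f(1) push_carrier by blast
  have "q.\<chi> ?s = (\<Sum>S\<in>push ` \<N>. q.\<chi> (f S))"
    by (rule coords_finsum(2)[OF q.coords_quotient _ fc]) (use \<N>(1) in simp)
  also have "\<dots> = (\<Sum>H\<in>\<N>. q.\<chi> (f (push H)))" by (rule sum.reindex_cong[OF inj refl refl])
  also have "\<dots> = (\<Sum>H\<in>\<N>. p (h H))" by (rule sum.cong) (use f in auto)
  also have "\<dots> = p (\<Sum>H\<in>\<N>. h H)" by (rule fvp.linear_sum[OF p(1), symmetric])
  also have "\<dots> = p (\<psi> m)"
  proof -
    have "p (\<psi> m - (\<Sum>N\<in>\<N>. h N)) = 0" using p(2) \<N>(4) by blast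
    then have "p (\<psi> m) - p (\<Sum>N\<in>\<N>. h N) = 0" unfolding fvp.linear_diff[OF p(1)] .
    then show ?thesis by (simp only: right_minus_eq)
  qed
  also have "\<dots> = q.\<chi> (q.coset m)" using q.\<chi>_coset[OF m] by simp
  finally have "?s = q.coset m"
    using coords_eqI[OF q.coords_quotient coords_finsum(1)[OF q.coords_quotient _ fc]] \<N>(1) m
    by (simp add: q.carrier_quotient)
  then show "q.coset m \<in> socle L (lie_quotient M N)"
    unfolding socle_def using \<N>(1) simple f(1)
    by (auto intro!: exI[of _ "push ` \<N>"] exI[of _ f])
qed

end

text \<open>Each step is \<open>socle_iff\<close> followed by
  \<open>T.soc_step_contraction_kernel\<close>. The start agrees because the only list in
  \<open>T.pairs 0\<close> is empty and contracts nothing, so its kernel is zero.\<close>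

lemma socle_filtration_eq:
  "socle_filtration L M r = {m \<in> carrier M. \<psi> m \<in> T.contraction_kernel r}"
proof (induction r)
  case 0
  have "T.pairs 0 = {[]}" by (auto simp: T.pairs_def)
  then have "\<psi> m \<in> T.contraction_kernel 0 \<longleftrightarrow> \<psi> m = 0" if "m \<in> carrier M" for m
    using range_mem[OF that] by (simp add: T.contraction_kernel_def)
  then have "\<psi> m \<in> T.contraction_kernel 0 \<longleftrightarrow> m = \<zero>\<^bsub>M\<^esub>" if "m \<in> carrier M" for m
    using that coords_eqI[OF c that coordsD(3)[OF c]] coordsD(4)[OF c] by auto
  then show ?case using coordsD(3)[OF c] by auto
next
  case (Suc r)
  obtain p :: "(unit, 'p, 'k) tensor \<Rightarrow> (unit, 'p, 'k) tensor" where
    p: "Vector_Spaces.linear fscale fscale p" "\<And>v. p v = 0 \<longleftrightarrow> v \<in> T.contraction_kernel r"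
    by (rule exists_linear_with_kernel[OF T.submodD(1)[OF T.submod_contraction_kernel[of r]]]) blast
  show ?case
    using socle_iff[OF T.submod_contraction_kernel Suc p]
    by (simp add: T.soc_step_contraction_kernel[OF refl, of r] cong: conj_cong)
qed

end

section \<open>Dual bases\<close>

context countable_dual_pair
begin

text \<open>A biorthogonal system as a set of pairs: each vector comes with its partner, and the
  pair serves as its own index.\<close>

definition dual_system :: "('v \<times> 'w) set \<Rightarrow> bool" where
  "dual_system D \<longleftrightarrow> (\<forall>x\<in>D. \<forall>y\<in>D. pairing (fst x) (snd y) = (if x = y then 1 else 0))"

lemma pairing_add_left: "pairing (v + v') w = pairing v w + pairing v' w"
  using linear_left[of w] by (simp add: Vector_Spaces.linear_iff)
lemma pairing_scale_left: "pairing (scaleV r v) w = r * pairing v w"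
  using linear_left[of w] by (simp add: Vector_Spaces.linear_iff)
lemma pairing_add_right: "pairing v (w + w') = pairing v w + pairing v w'"
  using linear_right[of v] by (simp add: Vector_Spaces.linear_iff)
lemma pairing_scale_right: "pairing v (scaleW r w) = r * pairing v w"
  using linear_right[of v] by (simp add: Vector_Spaces.linear_iff)
lemma pairing_zero_left [simp]: "pairing 0 w = 0"
  using pairing_add_left[of 0 0 w] by simp
lemma pairing_zero_right [simp]: "pairing v 0 = 0"
  using pairing_add_right[of v 0 0] by simp
lemma pairing_diff_left: "pairing (v - v') w = pairing v w - pairing v' w"
  using pairing_add_left[of "v - v'" v' w] by (simp add: algebra_simps)
lemma pairing_diff_right: "pairing v (w - w') = pairing v w - pairing v w'"
  using pairing_add_right[of v "w - w'" w'] by (simp add: algebra_simps)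
lemma pairing_sum_left: "pairing (sum f A) w = (\<Sum>a\<in>A. pairing (f a) w)"
  by (induction A rule: infinite_finite_induct) (auto simp: pairing_add_left)
lemma pairing_sum_right: "pairing v (sum f A) = (\<Sum>a\<in>A. pairing v (f a))"
  by (induction A rule: infinite_finite_induct) (auto simp: pairing_add_right)

lemma dual_pair_swap: "countable_dual_pair scaleW scaleV (\<lambda>w v. pairing v w)"
  using linear_right linear_left nondegenerate_left nondegenerate_right countable_dim_left countable_dim_right
  by (intro countable_dual_pair.intro countable_dual_pair_axioms.intro V.vector_space_axioms W.vector_space_axioms)

lemma dual_system_swap:
  "countable_dual_pair.dual_system (\<lambda>w v. pairing v w) (prod.swap ` D) \<longleftrightarrow> dual_system D"
proof -
  interpret s: countable_dual_pair scaleW scaleV "\<lambda>w v. pairing v w" by (rule dual_pair_swap)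
  have sw: "prod.swap x = prod.swap y \<longleftrightarrow> y = x" for x y :: "'v \<times> 'w" by (cases x; cases y) auto
  have "s.dual_system (prod.swap ` D) \<longleftrightarrow> (\<forall>x\<in>D. \<forall>y\<in>D. pairing (fst y) (snd x) = (if y = x then 1 else 0))"
    by (simp add: s.dual_system_def sw)
  also have "\<dots> \<longleftrightarrow> dual_system D" unfolding dual_system_def by blast
  finally show ?thesis .
qed

text \<open>A Gram-Schmidt step. The part of \<open>v\<close> orthogonal to \<open>D\<close> is
  nonzero unless \<open>v\<close> is already spanned; non-degeneracy supplies a partner, which is
  normalized and then made orthogonal to \<open>D\<close>.\<close>

lemma dual_system_extend:
  assumes D: "finite D" "dual_system D"
  shows "\<exists>D'. finite D' \<and> dual_system D' \<and> D \<subseteq> D' \<and> v \<in> V.span (fst ` D')"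
proof (cases "v \<in> V.span (fst ` D)")
  case True then show ?thesis using D by blast
next
  case False
  define v' where "v' = v - (\<Sum>x\<in>D. scaleV (pairing v (snd x)) (fst x))"
  have "(\<Sum>x\<in>D. scaleV (pairing v (snd x)) (fst x)) \<in> V.span (fst ` D)"
    by (intro V.span_sum V.span_scale V.span_base) simp
  then have "v' \<noteq> 0" using False by (auto simp: v'_def)
  then obtain w0 where w0: "pairing v' w0 \<noteq> 0" using nondegenerate_left by blast
  define w where "w = scaleW (inverse (pairing v' w0)) w0"
  have w: "pairing v' w = 1" using w0 by (simp add: w_def pairing_scale_right)
  define w' where "w' = w - (\<Sum>x\<in>D. scaleW (pairing (fst x) w) (snd x))"
  have dd: "(\<Sum>x\<in>D. f x * pairing (fst x) (snd y)) = f y" if "y \<in> D" for f y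
  proof -
    have "(\<Sum>x\<in>D. f x * pairing (fst x) (snd y)) = (\<Sum>x\<in>D. if x = y then f y else 0)"
      using D(2) that by (intro sum.cong) (auto simp: dual_system_def)
    then show ?thesis using D(1) that by simp
  qed
  have dd': "(\<Sum>x\<in>D. f x * pairing (fst y) (snd x)) = f y" if "y \<in> D" for f y
  proof -
    have "(\<Sum>x\<in>D. f x * pairing (fst y) (snd x)) = (\<Sum>x\<in>D. if x = y then f y else 0)"
      using D(2) that by (intro sum.cong) (auto simp: dual_system_def)
    then show ?thesis using D(1) that by simp
  qed
  have v'0: "pairing v' (snd y) = 0" if "y \<in> D" for y
    using dd[OF that, of "\<lambda>x. pairing v (snd x)"]
    by (simp add: v'_def pairing_diff_left pairing_sum_left pairing_scale_left)
  have w'0: "pairing (fst y) w' = 0" if "y \<in> D" for y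
    using dd'[OF that, of "\<lambda>x. pairing (fst x) w"]
    by (simp add: w'_def pairing_diff_right pairing_sum_right pairing_scale_right)
  \<comment> \<open>Correcting \<open>w\<close> does not change its pairing with \<open>v'\<close>,
    because \<open>v'\<close> is orthogonal to \<open>D\<close>.\<close>
  have vw: "pairing v' w' = 1"
    using w v'0 by (simp add: w'_def pairing_diff_right pairing_sum_right pairing_scale_right)
  have notin: "(v', w') \<notin> D" using v'0[of "(v', w')"] vw by auto
  have "dual_system (insert (v', w') D)"
    using D(2) v'0 w'0 vw notin unfolding dual_system_def by auto
  moreover have "v \<in> V.span (fst ` insert (v', w') D)"
  proof -
    have "v = v' + (\<Sum>x\<in>D. scaleV (pairing v (snd x)) (fst x))" by (simp add: v'_def)
    also have "\<dots> \<in> V.span (fst ` insert (v', w') D)"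
      by (intro V.span_add V.span_sum V.span_scale V.span_base) auto
    finally show ?thesis .
  qed
  ultimately show ?thesis using D(1) by (intro exI[of _ "insert (v', w') D"]) auto
qed

text \<open>The covector is handled by the same step in the dual pair with the two spaces
  exchanged.\<close>

lemma dual_system_extend_both:
  assumes D: "finite D" "dual_system D"
  shows "\<exists>D'. finite D' \<and> dual_system D' \<and> D \<subseteq> D' \<and> v \<in> V.span (fst ` D') \<and> w \<in> W.span (snd ` D')"
proof -
  obtain D1 where D1: "finite D1" "dual_system D1" "D \<subseteq> D1" "v \<in> V.span (fst ` D1)"
    using dual_system_extend[OF D] by blast
  interpret s: countable_dual_pair scaleW scaleV "\<lambda>w v. pairing v w" by (rule dual_pair_swap)
  have "s.dual_system (prod.swap ` D1)" using D1(2) dual_system_swap by simp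
  from s.dual_system_extend[OF _ this, of w] D1(1)
  obtain D2 where D2: "finite D2" "s.dual_system D2" "prod.swap ` D1 \<subseteq> D2" "w \<in> W.span (fst ` D2)" by auto
  have e: "prod.swap ` prod.swap ` D2 = D2" by (simp add: image_comp)
  have "dual_system (prod.swap ` D2)" using D2(2) dual_system_swap[of "prod.swap ` D2"] e by simp
  moreover have sub: "D1 \<subseteq> prod.swap ` D2" using image_mono[OF D2(3), of prod.swap] by (simp add: image_comp)
  moreover have "v \<in> V.span (fst ` prod.swap ` D2)" using D1(4) V.span_mono[OF image_mono[OF sub]] by blast
  moreover have "snd ` prod.swap ` D2 = fst ` D2" by (force simp: image_comp)
  ultimately show ?thesis using D1(3) D2(1,4) by (intro exI[of _ "prod.swap ` D2"]) auto
qed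

text \<open>Countable dimension lets the basis vectors of both spaces be listed and absorbed, one of
  each at a time, into an increasing chain of finite dual systems. The union spans both spaces and
  is countably infinite.\<close>

lemma dual_bases:
  "\<exists>(e :: nat \<Rightarrow> 'v) (f :: nat \<Rightarrow> 'w). (\<forall>s t. pairing (e s) (f t) = (if s = t then 1 else 0)) \<and>
    V.span (range e) = UNIV \<and> W.span (range f) = UNIV"
proof -
  obtain BV where BV: "countable BV" "infinite BV" "V.independent BV" "V.span BV = UNIV"
    using countable_dim_left by blast
  obtain BW where BW: "countable BW" "infinite BW" "W.independent BW" "W.span BW = UNIV"
    using countable_dim_right by blast
  define b where "b = from_nat_into BV"
  define c where "c = from_nat_into BW"
  have b: "range b = BV" unfolding b_def using BV by (intro range_from_nat_into) auto
  have c: "range c = BW" unfolding c_def using BW by (intro range_from_nat_into) auto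
  define ok where "ok D \<longleftrightarrow> finite D \<and> dual_system D" for D
  have "\<exists>d. \<forall>n. ok (d n) \<and> d n \<subseteq> d (Suc n) \<and> b n \<in> V.span (fst ` d (Suc n)) \<and> c n \<in> W.span (snd ` d (Suc n))"
  proof -
    have "\<exists>d. \<forall>n. ok (d n) \<and> (d n \<subseteq> d (Suc n) \<and> b n \<in> V.span (fst ` d (Suc n)) \<and> c n \<in> W.span (snd ` d (Suc n)))"
    proof (rule dependent_nat_choice)
      show "\<exists>D. ok D" by (rule exI[of _ "{}"]) (simp add: ok_def dual_system_def)
      show "\<exists>D'. ok D' \<and> D \<subseteq> D' \<and> b n \<in> V.span (fst ` D') \<and> c n \<in> W.span (snd ` D')" if "ok D" for D n
        using dual_system_extend_both[of D "b n" "c n"] that by (auto simp: ok_def)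
    qed
    then show ?thesis by blast
  qed
  then obtain d where d: "\<And>n. ok (d n)" "\<And>n. d n \<subseteq> d (Suc n)"
    "\<And>n. b n \<in> V.span (fst ` d (Suc n))" "\<And>n. c n \<in> W.span (snd ` d (Suc n))" by blast
  have mono: "d m \<subseteq> d n" if "m \<le> n" for m n using that d(2) by (rule lift_Suc_mono_le[rotated])
  define D where "D = (\<Union>n. d n)"
  have ds: "pairing (fst x) (snd y) = (if x = y then 1 else 0)" if xy: "x \<in> D" "y \<in> D" for x y
  proof -
    obtain m n where "x \<in> d m" "y \<in> d n" using xy by (auto simp: D_def)
    then have "x \<in> d (max m n)" "y \<in> d (max m n)" using mono[of m "max m n"] mono[of n "max m n"] by auto
    then show ?thesis using d(1)[of "max m n"] by (auto simp: ok_def dual_system_def)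
  qed
  have "b n \<in> V.span (fst ` D)" for n
    using d(3)[of n] V.span_mono[of "fst ` d (Suc n)" "fst ` D"] by (auto simp: D_def)
  then have "BV \<subseteq> V.span (fst ` D)" using b by blast
  then have spV: "V.span (fst ` D) = UNIV" using V.span_minimal[OF _ V.subspace_span] BV(4) by blast
  have "c n \<in> W.span (snd ` D)" for n
    using d(4)[of n] W.span_mono[of "snd ` d (Suc n)" "snd ` D"] by (auto simp: D_def)
  then have "BW \<subseteq> W.span (snd ` D)" using c by blast
  then have spW: "W.span (snd ` D) = UNIV" using W.span_minimal[OF _ W.subspace_span] BW(4) by blast
  have "countable D" unfolding D_def using d(1) by (auto simp: ok_def countable_finite)
  moreover have "infinite D"
  proof
    assume "finite D"
    then have fin: "finite (fst ` D)" by simp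
    have "finite BV" using V.independent_span_bound[OF fin BV(3)] spV by auto
    then show False using BV(2) by simp
  qed
  ultimately obtain g :: "nat \<Rightarrow> 'v \<times> 'w" where g: "bij_betw g UNIV D"
    using bij_betw_from_nat_into by blast
  show ?thesis
  proof (intro exI[of _ "fst \<circ> g"] exI[of _ "snd \<circ> g"] conjI allI)
    show "pairing ((fst \<circ> g) s) ((snd \<circ> g) t) = (if s = t then 1 else 0)" for s t
    proof -
      have "g s \<in> D" "g t \<in> D" using bij_betwE[OF g] by auto
      moreover have "g s = g t \<longleftrightarrow> s = t" using bij_betw_imp_inj_on[OF g] by (auto dest: inj_onD)
      ultimately show ?thesis using ds[of "g s" "g t"] by simp
    qed
    have "range g = D" using g by (simp add: bij_betw_def)
    then show "V.span (range (fst \<circ> g)) = UNIV" "W.span (range (snd \<circ> g)) = UNIV"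
      unfolding image_comp[symmetric] using spV spW by simp_all
  qed
qed

end

section \<open>Coordinates on mixed tensors\<close>

lemma lookup_prescale [simp]: "Poly_Mapping.lookup (prescale c x) g = c * Poly_Mapping.lookup x g"
  unfolding prescale_def Poly_Mapping.map.rep_eq by (simp add: when_def)

interpretation pm: vector_space "prescale :: 'k::field \<Rightarrow> ('g \<Rightarrow>\<^sub>0 'k) \<Rightarrow> ('g \<Rightarrow>\<^sub>0 'k)"
  by unfold_locales (auto intro!: poly_mapping_eqI simp: lookup_add algebra_simps)

lemma keys_prescale: "Poly_Mapping.keys (prescale c x) \<subseteq> Poly_Mapping.keys x"
  by (auto simp: in_keys_iff)

lemma prescale_single: "prescale c (Poly_Mapping.single g r) = Poly_Mapping.single g (c * r)"
  by (rule poly_mapping_eqI) (simp add: lookup_single when_def)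

definition lin_ext :: "('g \<Rightarrow> 'a \<Rightarrow> 'k::field) \<Rightarrow> ('g \<Rightarrow>\<^sub>0 'k) \<Rightarrow> 'a \<Rightarrow> 'k" where
  "lin_ext F t = (\<Sum>g\<in>Poly_Mapping.keys t. fscale (Poly_Mapping.lookup t g) (F g))"

lemma lin_ext_superset:
  assumes "finite S" "Poly_Mapping.keys t \<subseteq> S"
  shows "lin_ext F t = (\<Sum>g\<in>S. fscale (Poly_Mapping.lookup t g) (F g))"
  unfolding lin_ext_def by (rule sum.mono_neutral_left) (use assms in \<open>auto simp: in_keys_iff\<close>)

lemma lin_ext_add: "lin_ext F (t + t') = lin_ext F t + lin_ext F t'"
proof -
  let ?S = "Poly_Mapping.keys t \<union> Poly_Mapping.keys t'"
  have "lin_ext F (t + t') = (\<Sum>g\<in>?S. fscale (Poly_Mapping.lookup (t + t') g) (F g))"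
    by (rule lin_ext_superset) (use keys_add[of t t'] in auto)
  also have "\<dots> = (\<Sum>g\<in>?S. fscale (Poly_Mapping.lookup t g) (F g)) + (\<Sum>g\<in>?S. fscale (Poly_Mapping.lookup t' g) (F g))"
    by (simp only: lookup_add fv.scale_left_distrib sum.distrib)
  also have "\<dots> = lin_ext F t + lin_ext F t'"
    using lin_ext_superset[of ?S t F] lin_ext_superset[of ?S t' F] by simp
  finally show ?thesis .
qed

lemma lin_ext_scale: "lin_ext F (prescale c t) = fscale c (lin_ext F t)"
  using lin_ext_superset[OF finite_keys keys_prescale[of c t], of F]
  by (simp only: lin_ext_def fv.scale_sum_right lookup_prescale fv.scale_scale)

lemma lin_ext_linear: "Vector_Spaces.linear prescale fscale (lin_ext F)"
  by unfold_locales (simp_all only: lin_ext_add lin_ext_scale)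

lemma lin_ext_single: "lin_ext F (Poly_Mapping.single g c) = fscale c (F g)"
  using lin_ext_superset[of "{g}" "Poly_Mapping.single g c" F] by (auto split: if_splits)

lemma lin_ext_diff: "lin_ext F (t - t') = lin_ext F t - lin_ext F t'"
  using lin_ext_add[of F "t - t'" t'] by (simp only: diff_add_cancel add_diff_cancel_right' eq_diff_eq)

lemma lin_ext_zero: "lin_ext F 0 = 0"
  by (simp add: lin_ext_def)

lemma lin_ext_sum: "lin_ext F (\<Sum>i\<in>A. t i) = (\<Sum>i\<in>A. lin_ext F (t i))"
  by (induction A rule: infinite_finite_induct) (simp_all only: sum.infinite sum.empty sum.insert lin_ext_zero lin_ext_add not_False_eq_True)

lemma lin_ext_linear_extension:
  "lin_ext F (linear_extension G t) = lin_ext (\<lambda>g. lin_ext F (G g)) t"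
  unfolding linear_extension_def lin_ext_sum lin_ext_scale by (simp only: lin_ext_def[of _ t])

lemma single_decomp: "t = (\<Sum>g\<in>Poly_Mapping.keys t. prescale (Poly_Mapping.lookup t g) (Poly_Mapping.single g 1))"
proof (rule poly_mapping_eqI)
  fix h
  have "Poly_Mapping.lookup (\<Sum>g\<in>Poly_Mapping.keys t. prescale (Poly_Mapping.lookup t g) (Poly_Mapping.single g 1)) h
    = (\<Sum>g\<in>Poly_Mapping.keys t. if g = h then Poly_Mapping.lookup t g else 0)"
    unfolding lookup_sum by (rule sum.cong) (auto simp: lookup_single when_def)
  also have "\<dots> = Poly_Mapping.lookup t h" by (simp add: in_keys_iff)
  finally show "Poly_Mapping.lookup t h = Poly_Mapping.lookup
      (\<Sum>g\<in>Poly_Mapping.keys t. prescale (Poly_Mapping.lookup t g) (Poly_Mapping.single g 1)) h" by simp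
qed

lemma free_space_carrier:
  "t \<in> carrier (free_space p q) \<longleftrightarrow> (\<forall>g\<in>Poly_Mapping.keys t. length (fst g) = p \<and> length (snd g) = q)"
  by (auto simp: free_space_def)

lemma free_space_subspace: "pm.subspace (carrier (free_space p q :: ('k::field, ('v, 'w, 'k) prespace) module))"
proof (rule pm.subspaceI)
  fix t t' :: "('v, 'w, 'k) prespace" assume "t \<in> carrier (free_space p q)" "t' \<in> carrier (free_space p q)"
  then show "t + t' \<in> carrier (free_space p q)" using keys_add[of t t'] by (auto simp: free_space_carrier)
next
  fix c and t :: "('v, 'w, 'k) prespace" assume "t \<in> carrier (free_space p q)"
  then show "prescale c t \<in> carrier (free_space p q)" using keys_prescale[of c t] by (auto simp: free_space_carrier)
qed (simp add: free_space_carrier)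

lemma single_free_space: "length vs = p \<Longrightarrow> length ws = q \<Longrightarrow> Poly_Mapping.single (vs, ws) c \<in> carrier (free_space p q)"
  by (auto simp: free_space_carrier split: if_splits)

lemma linear_extension_free_space:
  assumes "t \<in> carrier (free_space p q)"
    "\<And>vs ws. length vs = p \<Longrightarrow> length ws = q \<Longrightarrow> F (vs, ws) \<in> carrier (free_space p' q')"
  shows "linear_extension F t \<in> carrier (free_space p' q')"
  unfolding linear_extension_def
  by (intro pm.subspace_sum pm.subspace_scale free_space_subspace)
    (use assms in \<open>force simp: free_space_carrier[of t]\<close>)

lemma prod_list_update:
  assumes "length xs = n" "i < n"
  shows "(\<Prod>k<n. F (xs[i := x] ! k) k) = F x i * (\<Prod>k\<in>{..<n} - {i}. F (xs ! k) k :: 'k::comm_monoid_mult)"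
proof -
  have "(\<Prod>k<n. F (xs[i := x] ! k) k) = F (xs[i := x] ! i) i * (\<Prod>k\<in>{..<n} - {i}. F (xs[i := x] ! k) k)"
    using assms by (intro prod.remove) auto
  also have "(\<Prod>k\<in>{..<n} - {i}. F (xs[i := x] ! k) k) = (\<Prod>k\<in>{..<n} - {i}. F (xs ! k) k)"
    by (rule prod.cong) auto
  finally show ?thesis using assms by simp
qed

section \<open>Coordinates of pure tensors and the multilinearity relations\<close>

abbreviation posV :: "nat \<Rightarrow> (nat + nat) set" where "posV p \<equiv> Inl ` {..<p}"
abbreviation posW :: "nat \<Rightarrow> (nat + nat) set" where "posW q \<equiv> Inr ` {..<q}"

locale dual_pair_bases = countable_dual_pair scaleV scaleW pairing
  for scaleV :: "'k::field_char_0 \<Rightarrow> 'v::ab_group_add \<Rightarrow> 'v"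
    and scaleW :: "'k \<Rightarrow> 'w::ab_group_add \<Rightarrow> 'w" and pairing :: "'v \<Rightarrow> 'w \<Rightarrow> 'k" +
  fixes e :: "nat \<Rightarrow> 'v" and f :: "nat \<Rightarrow> 'w"
  assumes dual: "pairing (e s) (f t) = (if s = t then 1 else 0)"
    and span_e: "V.span (range e) = UNIV" and span_f: "W.span (range f) = UNIV"
begin

lemma expansion_left: "\<exists>n. (\<forall>s\<ge>n. pairing v (f s) = 0) \<and> (\<forall>m\<ge>n. v = (\<Sum>s<m. scaleV (pairing v (f s)) (e s)))"
proof -
  have "v \<in> V.span (range e)" using span_e by simp
  then have "\<exists>n. (\<forall>s\<ge>n. pairing v (f s) = 0) \<and> v = (\<Sum>s<n. scaleV (pairing v (f s)) (e s))"
  proof (induction rule: V.span_induct_alt)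
    case base
    show ?case by (rule exI[of _ 0]) simp
  next
    case (step c x y)
    obtain k where k: "x = e k" using step(1) by blast
    obtain n where n: "\<forall>s\<ge>n. pairing y (f s) = 0" "y = (\<Sum>s<n. scaleV (pairing y (f s)) (e s))" using step(2) by blast
    define m where "m = max n (Suc k)"
    have pr: "pairing (scaleV c x + y) (f s) = (if s = k then c else 0) + pairing y (f s)" for s
      by (simp add: pairing_add_left pairing_scale_left k dual)
    have "(\<Sum>s<m. scaleV (pairing (scaleV c x + y) (f s)) (e s))
      = (\<Sum>s<m. if s = k then scaleV c (e k) else 0) + (\<Sum>s<m. scaleV (pairing y (f s)) (e s))"
      unfolding pr V.scale_left_distrib sum.distrib by (intro arg_cong2[where f = "(+)"] sum.cong) auto
    also have "(\<Sum>s<m. if s = k then scaleV c (e k) else 0) = scaleV c x"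
    proof -
      have "k < m" by (simp add: m_def)
      then show ?thesis by (simp add: k)
    qed
    also have "(\<Sum>s<m. scaleV (pairing y (f s)) (e s)) = (\<Sum>s<n. scaleV (pairing y (f s)) (e s))"
      by (rule sum.mono_neutral_right) (use n(1) in \<open>auto simp: m_def\<close>)
    finally have "scaleV c x + y = (\<Sum>s<m. scaleV (pairing (scaleV c x + y) (f s)) (e s))" using n(2) by simp
    moreover have "\<forall>s\<ge>m. pairing (scaleV c x + y) (f s) = 0" using n(1) by (auto simp: pr m_def)
    ultimately show ?case by blast
  qed
  then obtain n where n: "\<forall>s\<ge>n. pairing v (f s) = 0" "v = (\<Sum>s<n. scaleV (pairing v (f s)) (e s))" by blast
  have "(\<Sum>s<m. scaleV (pairing v (f s)) (e s)) = (\<Sum>s<n. scaleV (pairing v (f s)) (e s))" if "n \<le> m" for m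
    by (rule sum.mono_neutral_right) (use n(1) that in auto)
  then show ?thesis using n by metis
qed

lemma swap: "dual_pair_bases scaleW scaleV (\<lambda>w v. pairing v w) f e"
  by (intro dual_pair_bases.intro dual_pair_swap dual_pair_bases_axioms.intro) (auto simp: dual span_e span_f)

lemma expansion_right: "\<exists>n. (\<forall>s\<ge>n. pairing (e s) w = 0) \<and> (\<forall>m\<ge>n. w = (\<Sum>s<m. scaleW (pairing (e s) w) (f s)))"
  using dual_pair_bases.expansion_left[OF swap] .

lemma pairing_expand:
  assumes "w = (\<Sum>s<n. scaleW (pairing (e s) w) (f s))"
  shows "pairing v w = (\<Sum>s<n. pairing v (f s) * pairing (e s) w)"
  by (subst assms) (simp add: pairing_sum_right pairing_scale_right mult.commute)

text \<open>The coordinates of a pure tensor are products of those of its factors; \<open>f\<close>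
  reads off the coordinates of vectors and \<open>e\<close> those of covectors.\<close>

definition genc :: "nat \<Rightarrow> nat \<Rightarrow> 'v list \<times> 'w list \<Rightarrow> (unit, nat + nat, 'k) tensor" where
  "genc p q g = (\<lambda>(_, a). (\<Prod>i<p. pairing (fst g ! i) (f (a (Inl i)))) * (\<Prod>j<q. pairing (e (a (Inr j))) (snd g ! j)))"

definition crd :: "nat \<Rightarrow> nat \<Rightarrow> ('v, 'w, 'k) prespace \<Rightarrow> (unit, nat + nat, 'k) tensor" where
  "crd p q = lin_ext (genc p q)"

lemma genc_tensors: "genc p q (vs, ws) \<in> tensors {()} (posV p \<union> posW q)"
proof -
  have "\<forall>i. \<exists>n. \<forall>s\<ge>n. pairing (vs ! i) (f s) = 0" using expansion_left by blast
  then obtain m where m: "\<And>i s. m i \<le> s \<Longrightarrow> pairing (vs ! i) (f s) = 0" by metis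
  have "\<forall>j. \<exists>n. \<forall>s\<ge>n. pairing (e s) (ws ! j) = 0" using expansion_right by blast
  then obtain n where n: "\<And>j s. n j \<le> s \<Longrightarrow> pairing (e s) (ws ! j) = 0" by metis
  define N where "N = (\<Sum>i<p. m i) + (\<Sum>j<q. n j)"
  have bound: "a k < N" if nz: "genc p q (vs, ws) (u, a) \<noteq> 0" and k: "k \<in> posV p \<union> posW q" for u a k
    using k
  proof
    assume "k \<in> posV p"
    then obtain i where i: "i < p" "k = Inl i" by auto
    then have "pairing (vs ! i) (f (a k)) \<noteq> 0" using nz by (auto simp: genc_def)
    then have "a k < m i" using m by (meson not_le)
    also have "m i \<le> (\<Sum>i<p. m i)" using i by (intro member_le_sum) auto
    finally show ?thesis by (simp add: N_def)
  next
    assume "k \<in> posW q"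
    then obtain j where j: "j < q" "k = Inr j" by auto
    then have "pairing (e (a k)) (ws ! j) \<noteq> 0" using nz by (auto simp: genc_def)
    then have "a k < n j" using n by (meson not_le)
    also have "n j \<le> (\<Sum>j<q. n j)" using j by (intro member_le_sum) auto
    finally show ?thesis by (simp add: N_def)
  qed
  have dep: "genc p q (vs, ws) (u, a) = genc p q (vs, ws) (u, b)" if "\<forall>k\<in>posV p \<union> posW q. a k = b k" for u a b
  proof -
    have "a (Inl i) = b (Inl i)" if "i < p" for i using \<open>\<forall>k\<in>posV p \<union> posW q. a k = b k\<close> that by auto
    moreover have "a (Inr i) = b (Inr i)" if "i < q" for i using \<open>\<forall>k\<in>posV p \<union> posW q. a k = b k\<close> that by auto
    ultimately show ?thesis by (simp add: genc_def)
  qed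
  show ?thesis unfolding tensors_def mem_Collect_eq
    by (intro conjI allI impI exI[of _ N] ballI) (auto intro: dep bound)
qed

lemma crd_tensors: "crd p q t \<in> tensors {()} (posV p \<union> posW q)"
  unfolding crd_def lin_ext_def
proof (intro fv.subspace_sum fv.subspace_scale tensors_subspace)
  fix g show "genc p q g \<in> tensors {()} (posV p \<union> posW q)" using genc_tensors by (cases g) simp
qed

lemmas crd_simps = lin_ext_add[where F = "genc p q" for p q, folded crd_def]
  lin_ext_diff[where F = "genc p q" for p q, folded crd_def]
  lin_ext_scale[where F = "genc p q" for p q, folded crd_def]
  lin_ext_single[where F = "genc p q" for p q, folded crd_def]
  lin_ext_sum[where F = "genc p q" for p q, folded crd_def]
  lin_ext_zero[where F = "genc p q" for p q, folded crd_def]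

lemma genc_update_left:
  assumes "length vs = p" "i < p"
  shows "genc p q (vs[i := x], ws) (u, a) = pairing x (f (a (Inl i))) *
    ((\<Prod>k\<in>{..<p} - {i}. pairing (vs ! k) (f (a (Inl k)))) * (\<Prod>j<q. pairing (e (a (Inr j))) (ws ! j)))"
  using prod_list_update[OF assms, of "\<lambda>v k. pairing v (f (a (Inl k)))" x] by (simp add: genc_def mult.assoc)

lemma genc_update_right:
  assumes "length ws = q" "j < q"
  shows "genc p q (vs, ws[j := x]) (u, a) = pairing (e (a (Inr j))) x *
    ((\<Prod>i<p. pairing (vs ! i) (f (a (Inl i)))) * (\<Prod>k\<in>{..<q} - {j}. pairing (e (a (Inr k))) (ws ! k)))"
  using prod_list_update[OF assms, of "\<lambda>w k. pairing (e (a (Inr k))) w" x] by (simp add: genc_def ac_simps)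

abbreviation rels :: "nat \<Rightarrow> nat \<Rightarrow> ('v, 'w, 'k) prespace set" where
  "rels p q \<equiv> multilinearity_relations scaleV scaleW p q"

lemma tensor_rel_span: "tensor_rel scaleV scaleW p q = pm.span (rels p q)"
  by (simp add: tensor_rel_def)

lemma crd_rels: "r \<in> rels p q \<Longrightarrow> crd p q r = 0"
  unfolding multilinearity_relations_def
  by (auto simp: crd_simps fun_eq_iff genc_update_left genc_update_right pairing_add_left pairing_add_right
      pairing_scale_left pairing_scale_right distrib_right mult.assoc)

lemma crd_tensor_rel: "r \<in> tensor_rel scaleV scaleW p q \<Longrightarrow> crd p q r = 0"
  unfolding tensor_rel_span
  by (induction rule: pm.span_induct_alt) (simp_all add: crd_simps crd_rels)

lemma rels_free_space: "rels p q \<subseteq> carrier (free_space p q)"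
proof -
  have d: "x - y \<in> carrier (free_space p q)" if "x \<in> carrier (free_space p q)" "y \<in> carrier (free_space p q)"
    for p q and x y :: "('v, 'w, 'k) prespace"
    by (rule pm.subspace_diff[OF free_space_subspace that])
  show ?thesis unfolding multilinearity_relations_def by (auto intro!: d single_free_space)
qed

lemma tensor_rel_free_space: "tensor_rel scaleV scaleW p q \<subseteq> carrier (free_space p q)"
  unfolding tensor_rel_span by (rule pm.span_minimal[OF rels_free_space free_space_subspace])

section \<open>Reduction to basis tensors modulo the relations\<close>

definition basis_gens :: "nat \<Rightarrow> nat \<Rightarrow> nat \<Rightarrow> nat \<Rightarrow> ('v list \<times> 'w list) set" where
  "basis_gens p q k l = {(vs, ws). length vs = p \<and> length ws = q \<and> (\<forall>i<k. vs ! i \<in> range e) \<and> (\<forall>j<l. ws ! j \<in> range f)}"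

text \<open>Tracks the reduction slot by slot: it grows from the span of all generators of the right
  lengths to the claim that basis tensors suffice modulo the relations.\<close>

definition reduced :: "nat \<Rightarrow> nat \<Rightarrow> nat \<Rightarrow> nat \<Rightarrow> ('v, 'w, 'k) prespace set" where
  "reduced p q k l = pm.span (rels p q \<union> (\<lambda>g. Poly_Mapping.single g 1) ` basis_gens p q k l)"

lemma reduced_rels: "r \<in> rels p q \<Longrightarrow> r \<in> reduced p q k l"
  unfolding reduced_def by (rule pm.span_base) simp

lemma reduced_gens: "g \<in> basis_gens p q k l \<Longrightarrow> Poly_Mapping.single g 1 \<in> reduced p q k l"
  unfolding reduced_def by (rule pm.span_base) simp

lemma reduced_subspace: "pm.subspace (reduced p q k l)"
  by (simp add: reduced_def)

text \<open>The entry in slot \<open>k\<close> is expanded in the basis by induction over its span;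
  each step combines one additivity and one homogeneity relation.\<close>

lemma reduce_left:
  assumes g: "(vs, ws) \<in> basis_gens p q k l" and k: "k < p"
  shows "Poly_Mapping.single (vs, ws) 1 \<in> reduced p q (Suc k) l"
proof -
  have len: "length vs = p" "length ws = q" using g by (auto simp: basis_gens_def)
  note sub = reduced_subspace[of p q "Suc k" l]
  have "Poly_Mapping.single (vs[k := x], ws) 1 \<in> reduced p q (Suc k) l" if "x \<in> V.span (range e)" for x
    using that
  proof (induction rule: V.span_induct_alt)
    case base
    \<comment> \<open>The homogeneity relation with scalar \<open>0\<close>: its second term is
      zero, so a generator with a zero entry is itself a relation.\<close>
    have "Poly_Mapping.single (vs[k := scaleV 0 0], ws) 1 - Poly_Mapping.single (vs[k := 0], ws) 0 \<in> rels p q"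
      unfolding multilinearity_relations_def using len k by blast
    then show ?case using reduced_rels by fastforce
  next
    case (step c x y)
    have 1: "Poly_Mapping.single (vs[k := scaleV c x + y], ws) 1 - Poly_Mapping.single (vs[k := scaleV c x], ws) 1
        - Poly_Mapping.single (vs[k := y], ws) 1 \<in> reduced p q (Suc k) l"
      by (rule reduced_rels) (use len k in \<open>unfold multilinearity_relations_def, blast\<close>)
    have 2: "Poly_Mapping.single (vs[k := scaleV c x], ws) 1 - Poly_Mapping.single (vs[k := x], ws) c \<in> reduced p q (Suc k) l"
      by (rule reduced_rels) (use len k in \<open>unfold multilinearity_relations_def, blast\<close>)
    have "Poly_Mapping.single (vs[k := x], ws) 1 \<in> reduced p q (Suc k) l"
      by (rule reduced_gens) (use g step(1) k len in \<open>auto simp: basis_gens_def nth_list_update less_Suc_eq\<close>)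
    from pm.subspace_scale[OF sub this, of c]
    have 3: "Poly_Mapping.single (vs[k := x], ws) c \<in> reduced p q (Suc k) l" by (simp add: prescale_single)
    from pm.subspace_add[OF sub pm.subspace_add[OF sub 1 pm.subspace_add[OF sub 2 3]] step(2)]
    show ?case by (simp add: algebra_simps)
  qed
  from this[of "vs ! k"] show ?thesis using span_e by simp
qed

lemma reduce_right:
  assumes g: "(vs, ws) \<in> basis_gens p q k l" and l: "l < q"
  shows "Poly_Mapping.single (vs, ws) 1 \<in> reduced p q k (Suc l)"
proof -
  have len: "length vs = p" "length ws = q" using g by (auto simp: basis_gens_def)
  note sub = reduced_subspace[of p q k "Suc l"]
  have "Poly_Mapping.single (vs, ws[l := x]) 1 \<in> reduced p q k (Suc l)" if "x \<in> W.span (range f)" for x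
    using that
  proof (induction rule: W.span_induct_alt)
    case base
    have "Poly_Mapping.single (vs, ws[l := scaleW 0 0]) 1 - Poly_Mapping.single (vs, ws[l := 0]) 0 \<in> rels p q"
      unfolding multilinearity_relations_def using len l by blast
    then show ?case using reduced_rels by fastforce
  next
    case (step c x y)
    have 1: "Poly_Mapping.single (vs, ws[l := scaleW c x + y]) 1 - Poly_Mapping.single (vs, ws[l := scaleW c x]) 1
        - Poly_Mapping.single (vs, ws[l := y]) 1 \<in> reduced p q k (Suc l)"
      by (rule reduced_rels) (use len l in \<open>unfold multilinearity_relations_def, blast\<close>)
    have 2: "Poly_Mapping.single (vs, ws[l := scaleW c x]) 1 - Poly_Mapping.single (vs, ws[l := x]) c \<in> reduced p q k (Suc l)"
      by (rule reduced_rels) (use len l in \<open>unfold multilinearity_relations_def, blast\<close>)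
    have "Poly_Mapping.single (vs, ws[l := x]) 1 \<in> reduced p q k (Suc l)"
      by (rule reduced_gens) (use g step(1) l len in \<open>auto simp: basis_gens_def nth_list_update less_Suc_eq\<close>)
    from pm.subspace_scale[OF sub this, of c]
    have 3: "Poly_Mapping.single (vs, ws[l := x]) c \<in> reduced p q k (Suc l)" by (simp add: prescale_single)
    from pm.subspace_add[OF sub pm.subspace_add[OF sub 1 pm.subspace_add[OF sub 2 3]] step(2)]
    show ?case by (simp add: algebra_simps)
  qed
  from this[of "ws ! l"] show ?thesis using span_f by simp
qed

lemma reduced_mono:
  assumes "\<And>g. g \<in> basis_gens p q k l \<Longrightarrow> Poly_Mapping.single g 1 \<in> reduced p q k' l'"
  shows "reduced p q k l \<subseteq> reduced p q k' l'"
  unfolding reduced_def[of p q k l] by (rule pm.span_minimal[OF _ reduced_subspace]) (use assms reduced_rels in auto)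

lemma free_space_reduced: "carrier (free_space p q) \<subseteq> reduced p q p q"
proof -
  have 1: "reduced p q 0 0 \<subseteq> reduced p q k 0" if "k \<le> p" for k
    using that
  proof (induction k)
    case (Suc k)
    have "reduced p q k 0 \<subseteq> reduced p q (Suc k) 0"
      by (rule reduced_mono) (use reduce_left Suc.prems in force)
    then show ?case using Suc by simp
  qed simp
  have 2: "reduced p q p 0 \<subseteq> reduced p q p l" if "l \<le> q" for l
    using that
  proof (induction l)
    case (Suc l)
    have "reduced p q p l \<subseteq> reduced p q p (Suc l)"
      by (rule reduced_mono) (use reduce_right Suc.prems in force)
    then show ?case using Suc by simp
  qed simp
  have "t \<in> reduced p q 0 0" if t: "t \<in> carrier (free_space p q)" for t
  proof (subst single_decomp, intro pm.subspace_sum pm.subspace_scale reduced_subspace reduced_gens)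
    fix g assume "g \<in> Poly_Mapping.keys t"
    then show "g \<in> basis_gens p q 0 0" using t by (cases g) (auto simp: free_space_carrier basis_gens_def)
  qed
  then show ?thesis using 1[of p] 2[of q] by auto
qed

definition basis_gen :: "nat \<Rightarrow> nat \<Rightarrow> (nat + nat \<Rightarrow> nat) \<Rightarrow> 'v list \<times> 'w list" where
  "basis_gen p q a = (map (\<lambda>i. e (a (Inl i))) [0..<p], map (\<lambda>j. f (a (Inr j))) [0..<q])"

lemma basis_gens_eq: "basis_gens p q p q = range (basis_gen p q)"
proof (intro subset_antisym subsetI)
  fix g assume "g \<in> basis_gens p q p q"
  then obtain vs ws where g: "g = (vs, ws)" "length vs = p" "length ws = q"
    "\<forall>i<p. \<exists>s. vs ! i = e s" "\<forall>j<q. \<exists>s. ws ! j = f s"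
    by (auto simp: basis_gens_def image_iff)
  obtain \<alpha> \<beta> where "\<And>i. i < p \<Longrightarrow> vs ! i = e (\<alpha> i)" "\<And>j. j < q \<Longrightarrow> ws ! j = f (\<beta> j)" using g(4,5) by metis
  then have "g = basis_gen p q (case_sum \<alpha> \<beta>)" using g(1-3) by (auto simp: basis_gen_def intro!: nth_equalityI)
  then show "g \<in> range (basis_gen p q)" by blast
qed (auto simp: basis_gens_def basis_gen_def)

lemma inj_e: "e s = e t \<longleftrightarrow> s = t" using dual by (metis zero_neq_one)
lemma inj_f: "f s = f t \<longleftrightarrow> s = t" using dual by (metis zero_neq_one)

lemma basis_gen_eq_iff: "basis_gen p q a = basis_gen p q b \<longleftrightarrow> (\<forall>k\<in>posV p \<union> posW q. a k = b k)"
  by (auto simp: basis_gen_def inj_e inj_f)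

lemma genc_basis_gen: "genc p q (basis_gen p q a) (u, b) = (if basis_gen p q a = basis_gen p q b then 1 else 0)"
proof -
  have "(\<Prod>i<p. if a (Inl i) = b (Inl i) then 1 else (0::'k)) = (if \<forall>i<p. a (Inl i) = b (Inl i) then 1 else 0)"
    by (auto intro: prod.neutral)
  moreover have "(\<Prod>j<q. if b (Inr j) = a (Inr j) then 1 else (0::'k)) = (if \<forall>j<q. b (Inr j) = a (Inr j) then 1 else 0)"
    by (auto intro: prod.neutral)
  ultimately show ?thesis unfolding basis_gen_eq_iff by (auto simp: genc_def basis_gen_def dual)
qed

lemma crd_lookup:
  assumes "y \<in> pm.span ((\<lambda>g. Poly_Mapping.single g 1) ` basis_gens p q p q)"
  shows "crd p q y (u, b) = Poly_Mapping.lookup y (basis_gen p q b)"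
  using assms
proof (induction rule: pm.span_induct_alt)
  case (step c x y)
  obtain a where "x = Poly_Mapping.single (basis_gen p q a) 1" using step(1) by (auto simp: basis_gens_eq)
  then show ?case using step(2) by (simp add: crd_simps lookup_add genc_basis_gen lookup_single when_def)
qed (simp add: crd_simps)

text \<open>By slotwise reduction \<open>x\<close> is a relation plus a combination of basis
  tensors. Coordinates kill the relation and return the coefficients of the combination, which
  therefore is zero when the coordinates vanish. From here on, equality of tensors is equality of
  coordinates.\<close>

lemma tensor_rel_iff:
  assumes x: "x \<in> carrier (free_space p q)"
  shows "x \<in> tensor_rel scaleV scaleW p q \<longleftrightarrow> crd p q x = 0"
proof
  assume 0: "crd p q x = 0"
  have "x \<in> pm.span (rels p q \<union> (\<lambda>g. Poly_Mapping.single g 1) ` basis_gens p q p q)"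
    using free_space_reduced x by (auto simp: reduced_def)
  then obtain r y where ry: "r \<in> pm.span (rels p q)" "y \<in> pm.span ((\<lambda>g. Poly_Mapping.single g 1) ` basis_gens p q p q)" "x = r + y"
    unfolding pm.span_Un by auto
  have y0: "crd p q y = 0" using 0 ry(3) crd_tensor_rel[of r p q] ry(1) by (simp add: crd_simps tensor_rel_span)
  have "Poly_Mapping.lookup y g = 0" for g
  proof (cases "g \<in> basis_gens p q p q")
    case True
    then obtain a where "g = basis_gen p q a" by (auto simp: basis_gens_eq)
    then show ?thesis using crd_lookup[OF ry(2), of "()" a] y0 by simp
  next
    case False
    show ?thesis using ry(2)
    proof (induction rule: pm.span_induct_alt)
      case (step c x y)
      from step(1) obtain h where h: "x = Poly_Mapping.single h 1" "h \<in> basis_gens p q p q" by blast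
      then have "h \<noteq> g" using False by blast
      then show ?case using step(2) by (simp add: h(1) lookup_add lookup_single)
    qed simp
  qed
  then have "y = 0" by (intro poly_mapping_eqI) simp
  then show "x \<in> tensor_rel scaleV scaleW p q" using ry by (simp add: tensor_rel_span)
qed (rule crd_tensor_rel)

lemma crd_surj:
  assumes x: "x \<in> tensors {()} (posV p \<union> posW q)"
  shows "\<exists>t\<in>carrier (free_space p q). crd p q t = x"
proof -
  let ?L = "posV p \<union> posW q"
  obtain n where n: "\<And>m i b k. n \<le> m \<Longrightarrow> x (i, b) \<noteq> 0 \<Longrightarrow> k \<in> ?L \<Longrightarrow> b k < m" by (rule tensors_bound[OF x]) blast
  define A where "A = PiE ?L (\<lambda>_. {..<n})"
  have fin: "finite A" unfolding A_def by (intro finite_PiE) auto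
  define t where "t = (\<Sum>a\<in>A. Poly_Mapping.single (basis_gen p q a) (x ((), a)))"
  have "crd p q t (u, b) = x (u, b)" for u b
  proof -
    \<comment> \<open>Only the values of \<open>b\<close> at the positions matter; restricting to
      them makes \<open>b\<close> comparable with the finitely many members of
      \<open>A\<close>.\<close>
    define b' where "b' = restrict b ?L"
    have b': "basis_gen p q a = basis_gen p q b \<longleftrightarrow> a = b'" if "a \<in> A" for a
    proof
      assume "basis_gen p q a = basis_gen p q b"
      then have ab: "a k = b k" if "k \<in> ?L" for k using that unfolding basis_gen_eq_iff by blast
      show "a = b'"
      proof
        fix k show "a k = b' k"
        proof (cases "k \<in> ?L")
          case True then show ?thesis using ab[OF True] unfolding b'_def restrict_def by (simp only: if_True)
        next
          case False
          then have "a k = undefined" using \<open>a \<in> A\<close> unfolding A_def by (rule PiE_arb[rotated])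
          then show ?thesis using False unfolding b'_def restrict_def by (simp only: if_False)
        qed
      qed
    qed (simp add: basis_gen_eq_iff b'_def)
    have xb: "x (u, b) = x ((), b')" by (cases u) (auto simp: b'_def intro!: tensorsD(2)[OF x])
    have "crd p q t (u, b) = (\<Sum>a\<in>A. x ((), a) * genc p q (basis_gen p q a) (u, b))"
      by (simp add: t_def crd_simps sum_apply)
    also have "\<dots> = (\<Sum>a\<in>A. if a = b' then x ((), b') else 0)"
      by (rule sum.cong) (auto simp: genc_basis_gen b')
    also have "\<dots> = (if b' \<in> A then x ((), b') else 0)" using fin by simp
    also have "\<dots> = x ((), b')"
    proof (cases "x ((), b') = 0")
      case False
      then have "b' \<in> A" using n[of n "()" b'] by (auto simp: A_def b'_def PiE_def)
      then show ?thesis by simp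
    qed simp
    finally show ?thesis using xb by simp
  qed
  then have "crd p q t = x" by (auto simp: fun_eq_iff)
  moreover have "t \<in> carrier (free_space p q)" unfolding t_def
    by (intro pm.subspace_sum free_space_subspace) (auto simp: basis_gen_def intro!: single_free_space)
  ultimately show ?thesis by blast
qed

end

section \<open>The module structure and the Lie algebra action in coordinates\<close>

lemma mixed_tensors_simps:
  "carrier (mixed_tensors scaleV scaleW pairing p q) = a_rcosets\<^bsub>free_space p q\<^esub> (tensor_rel scaleV scaleW p q)"
  "\<zero>\<^bsub>mixed_tensors scaleV scaleW pairing p q\<^esub> = tensor_rel scaleV scaleW p q"
  "X \<oplus>\<^bsub>mixed_tensors scaleV scaleW pairing p q\<^esub> Y = X <+>\<^bsub>free_space p q\<^esub> Y"
  "a \<odot>\<^bsub>mixed_tensors scaleV scaleW pairing p q\<^esub> X = (\<Union>t\<in>X. tensor_class scaleV scaleW p q (prescale a t))"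
  "act (mixed_tensors scaleV scaleW pairing p q) X T =
    (\<Union>x\<in>X. \<Union>t\<in>T. tensor_class scaleV scaleW p q (bilinear_extension (gl_act_gen pairing) x t))"
  by (simp_all add: mixed_tensors_def tensor_space_def quotient_module_def tensor_class_def free_space_def
      module.defs lie_module.defs)

lemma gl_carrier:
  "carrier (gl_infinity scaleV scaleW pairing) = a_rcosets\<^bsub>free_space 1 1\<^esub> (tensor_rel scaleV scaleW 1 1)"
  by (simp add: gl_infinity_def tensor_space_def quotient_module_def module.defs lie_algebra.defs)

lemma sl_carrier:
  "carrier (sl_infinity scaleV scaleW pairing) =
    {X \<in> carrier (gl_infinity scaleV scaleW pairing). \<forall>x\<in>X. linear_pairing pairing x = 0}"
  by (simp add: sl_infinity_def)

definition matrix_index :: "nat \<Rightarrow> nat \<Rightarrow> nat + nat \<Rightarrow> nat" where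
  "matrix_index s t = case_sum (\<lambda>_. s) (\<lambda>_. t)"

lemma matrix_index_simps [simp]: "matrix_index s t (Inl i) = s" "matrix_index s t (Inr i) = t"
  by (simp_all add: matrix_index_def)

text \<open>The action of an element of gl with coordinates \<open>c\<close>. The cut-off
  \<open>n\<close> stands for the finite support of \<open>c\<close>; by
  \<open>matrix_op_mono\<close> every sufficient cut-off gives the same operator.\<close>

definition matrix_op :: "nat \<Rightarrow> nat \<Rightarrow> nat \<Rightarrow> (unit, nat + nat, 'k::field) tensor \<Rightarrow>
    (unit, nat + nat, 'k) tensor \<Rightarrow> (unit, nat + nat, 'k) tensor" where
  "matrix_op p q n c v =
    (\<Sum>s<n. \<Sum>t<n. fscale (c ((), matrix_index s t)) (transfer_op (posV p) (posW q) s t v))"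

lemma matrix_op_linear: "Vector_Spaces.linear fscale fscale (matrix_op p q n c)"
  unfolding matrix_op_def
  by (intro fvp.linear_compose_sum ballI fvp.linear_compose_scale_right transfer_op_linear)

lemma matrix_op_mono:
  assumes "\<And>s t. c ((), matrix_index s t) \<noteq> 0 \<Longrightarrow> s < n \<and> t < n" "n \<le> m"
  shows "matrix_op p q m c v = matrix_op p q n c v"
proof -
  have 0: "fscale (c ((), matrix_index s t)) x = 0" if "\<not> (s < n \<and> t < n)" for s t and x :: "unit \<times> (nat + nat \<Rightarrow> nat) \<Rightarrow> 'a"
    using assms(1)[of s t] that by (auto simp: fun_eq_iff)
  have "matrix_op p q m c v = (\<Sum>s<m. \<Sum>t<n. fscale (c ((), matrix_index s t)) (transfer_op (posV p) (posW q) s t v))"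
    unfolding matrix_op_def by (intro sum.cong refl sum.mono_neutral_right) (use assms(2) 0 in auto)
  also have "\<dots> = matrix_op p q n c v"
    unfolding matrix_op_def by (intro sum.mono_neutral_right ballI sum.neutral) (use assms(2) 0 in auto)
  finally show ?thesis .
qed

lemma matrix_op_lin_ext:
  "matrix_op p q n (lin_ext F t) v = lin_ext (\<lambda>g. matrix_op p q n (F g) v) t"
proof (intro ext, clarify)
  fix b :: "nat + nat \<Rightarrow> nat"
  have "matrix_op p q n (lin_ext F t) v ((), b) = (\<Sum>s<n. \<Sum>r<n. \<Sum>g\<in>Poly_Mapping.keys t.
      Poly_Mapping.lookup t g * (F g ((), matrix_index s r) * transfer_op (posV p) (posW q) s r v ((), b)))"
    by (simp add: matrix_op_def lin_ext_def sum_apply sum_distrib_right mult.assoc)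
  also have "\<dots> = (\<Sum>s<n. \<Sum>g\<in>Poly_Mapping.keys t. \<Sum>r<n.
      Poly_Mapping.lookup t g * (F g ((), matrix_index s r) * transfer_op (posV p) (posW q) s r v ((), b)))"
    by (intro sum.cong refl sum.swap)
  also have "\<dots> = (\<Sum>g\<in>Poly_Mapping.keys t. \<Sum>s<n. \<Sum>r<n.
      Poly_Mapping.lookup t g * (F g ((), matrix_index s r) * transfer_op (posV p) (posW q) s r v ((), b)))"
    by (rule sum.swap)
  also have "\<dots> = lin_ext (\<lambda>g. matrix_op p q n (F g) v) t ((), b)"
    by (simp add: matrix_op_def lin_ext_def sum_apply sum_distrib_left)
  finally show "matrix_op p q n (lin_ext F t) v ((), b) = lin_ext (\<lambda>g. matrix_op p q n (F g) v) t ((), b)" .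
qed

lemma linear_lin_ext:
  assumes "Vector_Spaces.linear fscale fscale h"
  shows "h (lin_ext F t) = lin_ext (\<lambda>g. h (F g)) t"
  unfolding lin_ext_def fvp.linear_sum[OF assms] fvp.linear_scale[OF assms] ..

lemma lin_ext_cong: "(\<And>g. g \<in> Poly_Mapping.keys t \<Longrightarrow> F g = F' g) \<Longrightarrow> lin_ext F t = lin_ext F' t"
  unfolding lin_ext_def by (rule sum.cong) auto

lemma tensor_family_pos: "tensor_family {()} (posV p) (posW q)"
  by unfold_locales auto

context dual_pair_bases
begin

abbreviation tc :: "nat \<Rightarrow> nat \<Rightarrow> ('v, 'w, 'k) prespace \<Rightarrow> ('v, 'w, 'k) prespace set" where
  "tc p q \<equiv> tensor_class scaleV scaleW p q"

abbreviation mixed :: "nat \<Rightarrow> nat \<Rightarrow> ('k, ('v, 'w, 'k) prespace set, ('v, 'w, 'k) prespace set) lie_module" where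
  "mixed p q \<equiv> mixed_tensors scaleV scaleW pairing p q"

lemma tc_eq: "tc p q t = {r + t |r. r \<in> tensor_rel scaleV scaleW p q}"
  by (auto simp: tensor_class_def a_r_coset_def r_coset_def free_space_def)

text \<open>Cosets are the fibres of \<open>crd\<close>, so well-definedness of an operation is
  checked by comparing coordinates.\<close>

lemma tc_mem:
  assumes t: "t \<in> carrier (free_space p q)"
  shows "x \<in> tc p q t \<longleftrightarrow> x \<in> carrier (free_space p q) \<and> crd p q x = crd p q t"
proof
  assume "x \<in> tc p q t"
  then obtain r where r: "r \<in> tensor_rel scaleV scaleW p q" "x = r + t" by (auto simp: tc_eq)
  then show "x \<in> carrier (free_space p q) \<and> crd p q x = crd p q t"
    using t tensor_rel_free_space[of p q] pm.subspace_add[OF free_space_subspace, of r p q t]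
    by (auto simp: crd_simps crd_tensor_rel)
next
  assume x: "x \<in> carrier (free_space p q) \<and> crd p q x = crd p q t"
  then have "x - t \<in> carrier (free_space p q)" using t by (intro pm.subspace_diff[OF free_space_subspace]) auto
  moreover have "crd p q (x - t) = 0" using x by (simp add: crd_simps)
  ultimately have "x - t \<in> tensor_rel scaleV scaleW p q" by (simp add: tensor_rel_iff)
  moreover have "x = (x - t) + t" by simp
  ultimately show "x \<in> tc p q t" unfolding tc_eq by blast
qed

lemma tc_self: "t \<in> carrier (free_space p q) \<Longrightarrow> t \<in> tc p q t"
  by (simp add: tc_mem)

lemma tc_eqI: "t \<in> carrier (free_space p q) \<Longrightarrow> t' \<in> carrier (free_space p q) \<Longrightarrow> crd p q t = crd p q t' \<Longrightarrow> tc p q t = tc p q t'"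
  by (auto simp: tc_mem)

lemma tc_zero: "tc p q 0 = tensor_rel scaleV scaleW p q"
  by (auto simp: tc_eq)

lemma zero_free_space: "0 \<in> carrier (free_space p q)"
  by (rule pm.subspace_0[OF free_space_subspace])

lemma rcosets_tc: "a_rcosets\<^bsub>free_space p q\<^esub> (tensor_rel scaleV scaleW p q) = tc p q ` carrier (free_space p q)"
  by (auto simp: A_RCOSETS_def RCOSETS_def tensor_class_def a_r_coset_def)

lemma carrier_mixed: "carrier (mixed p q) = tc p q ` carrier (free_space p q)"
  by (simp add: mixed_tensors_simps rcosets_tc)

text \<open>Collapses the unions over representatives by which operations on cosets are
  defined.\<close>

lemma tc_UN:
  assumes "t \<in> carrier (free_space p q)"
    and "\<And>x. x \<in> carrier (free_space p q) \<Longrightarrow> crd p q x = crd p q t \<Longrightarrow> F x = F t"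
  shows "(\<Union>x\<in>tc p q t. F x) = F t"
proof -
  have "F x = F t" if "x \<in> tc p q t" for x
    using assms(2)[of x] that unfolding tc_mem[OF assms(1)] by simp
  then show ?thesis using tc_self[OF assms(1)] by blast
qed

lemma tc_add:
  assumes "t \<in> carrier (free_space p q)" "t' \<in> carrier (free_space p q)"
  shows "tc p q t <+>\<^bsub>free_space p q\<^esub> tc p q t' = tc p q (t + t')"
proof -
  have tt: "t + t' \<in> carrier (free_space p q)" by (rule pm.subspace_add[OF free_space_subspace assms])
  have "tc p q t <+>\<^bsub>free_space p q\<^esub> tc p q t' = {x + y |x y. x \<in> tc p q t \<and> y \<in> tc p q t'}"
    by (auto simp: set_add_def set_mult_def free_space_def)
  also have "\<dots> = tc p q (t + t')"
  proof (intro subset_antisym subsetI)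
    fix z assume "z \<in> {x + y |x y. x \<in> tc p q t \<and> y \<in> tc p q t'}"
    then show "z \<in> tc p q (t + t')"
      using assms tt by (auto simp: tc_mem crd_simps pm.subspace_add[OF free_space_subspace])
  next
    fix z assume z: "z \<in> tc p q (t + t')"
    then have "z - t' \<in> tc p q t"
      using assms tt by (auto simp: tc_mem crd_simps pm.subspace_diff[OF free_space_subspace])
    moreover have "z = (z - t') + t'" by simp
    ultimately show "z \<in> {x + y |x y. x \<in> tc p q t \<and> y \<in> tc p q t'}" using tc_self[OF assms(2)] by blast
  qed
  finally show ?thesis .
qed

lemma prescale_free_space: "t \<in> carrier (free_space p q) \<Longrightarrow> prescale a t \<in> carrier (free_space p q)"
  by (rule pm.subspace_scale[OF free_space_subspace])

lemma tc_smult: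
  assumes "t \<in> carrier (free_space p q)"
  shows "(\<Union>x\<in>tc p q t. tc p q (prescale a x)) = tc p q (prescale a t)"
  by (rule tc_UN[OF assms], rule tc_eqI) (simp_all add: assms prescale_free_space crd_simps)

definition psi :: "nat \<Rightarrow> nat \<Rightarrow> ('v, 'w, 'k) prespace set \<Rightarrow> (unit, nat + nat, 'k) tensor" where
  "psi p q T = crd p q (SOME t. t \<in> T)"

lemma psi_tc: "t \<in> carrier (free_space p q) \<Longrightarrow> psi p q (tc p q t) = crd p q t"
  unfolding psi_def using someI[of "\<lambda>x. x \<in> tc p q t", OF tc_self] tc_mem by blast

lemma psi_range: "psi p q ` carrier (mixed p q) = tensors {()} (posV p \<union> posW q)"
proof -
  have "psi p q ` carrier (mixed p q) = crd p q ` carrier (free_space p q)"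
    unfolding carrier_mixed image_image by (rule image_cong) (auto simp: psi_tc)
  also have "\<dots> = tensors {()} (posV p \<union> posW q)" using crd_tensors crd_surj by blast
  finally show ?thesis .
qed

lemma coords_mixed: "coords (mixed p q) (psi p q)"
  unfolding coords_def
proof (intro conjI)
  show "inj_on (psi p q) (carrier (mixed p q))"
  proof (rule inj_onI)
    fix X Y assume "X \<in> carrier (mixed p q)" "Y \<in> carrier (mixed p q)" and e: "psi p q X = psi p q Y"
    then obtain x y where x: "x \<in> carrier (free_space p q)" "X = tc p q x"
      and y: "y \<in> carrier (free_space p q)" "Y = tc p q y" by (auto simp: carrier_mixed)
    then show "X = Y" using e tc_eqI[OF x(1) y(1)] by (simp add: psi_tc)
  qed
  show "fv.subspace (psi p q ` carrier (mixed p q))" unfolding psi_range by (rule tensors_subspace)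
  show "\<zero>\<^bsub>mixed p q\<^esub> \<in> carrier (mixed p q)"
    unfolding mixed_tensors_simps(2) carrier_mixed tc_zero[symmetric] using zero_free_space by blast
  show "psi p q \<zero>\<^bsub>mixed p q\<^esub> = 0"
    unfolding mixed_tensors_simps(2) tc_zero[symmetric] psi_tc[OF zero_free_space] crd_simps ..
  show "\<forall>X\<in>carrier (mixed p q). \<forall>Y\<in>carrier (mixed p q). X \<oplus>\<^bsub>mixed p q\<^esub> Y \<in> carrier (mixed p q) \<and>
      psi p q (X \<oplus>\<^bsub>mixed p q\<^esub> Y) = psi p q X + psi p q Y"
  proof (intro ballI)
    fix X Y assume "X \<in> carrier (mixed p q)" "Y \<in> carrier (mixed p q)"
    then obtain x y where x: "x \<in> carrier (free_space p q)" "X = tc p q x"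
      and y: "y \<in> carrier (free_space p q)" "Y = tc p q y" by (auto simp: carrier_mixed)
    have xy: "x + y \<in> carrier (free_space p q)" by (rule pm.subspace_add[OF free_space_subspace x(1) y(1)])
    then show "X \<oplus>\<^bsub>mixed p q\<^esub> Y \<in> carrier (mixed p q) \<and> psi p q (X \<oplus>\<^bsub>mixed p q\<^esub> Y) = psi p q X + psi p q Y"
      unfolding mixed_tensors_simps(3) x(2) y(2) tc_add[OF x(1) y(1)] carrier_mixed
      by (simp add: psi_tc x y xy crd_simps)
  qed
  show "\<forall>a. \<forall>X\<in>carrier (mixed p q). a \<odot>\<^bsub>mixed p q\<^esub> X \<in> carrier (mixed p q) \<and>
      psi p q (a \<odot>\<^bsub>mixed p q\<^esub> X) = fscale a (psi p q X)"
  proof (intro allI ballI)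
    fix a X assume "X \<in> carrier (mixed p q)"
    then obtain x where x: "x \<in> carrier (free_space p q)" "X = tc p q x" by (auto simp: carrier_mixed)
    then show "a \<odot>\<^bsub>mixed p q\<^esub> X \<in> carrier (mixed p q) \<and> psi p q (a \<odot>\<^bsub>mixed p q\<^esub> X) = fscale a (psi p q X)"
      unfolding mixed_tensors_simps(4) x(2) tc_smult[OF x(1)] carrier_mixed
      using prescale_free_space[OF x(1), of a] by (simp only: psi_tc x crd_simps image_eqI)
  qed
qed

lemma genc_upd_left:
  assumes "length vs = p" "i < p"
  shows "genc p q (vs, ws) (u, b(Inl i := s)) = pairing (vs ! i) (f s) *
    ((\<Prod>k\<in>{..<p} - {i}. pairing (vs ! k) (f (b (Inl k)))) * (\<Prod>j<q. pairing (e (b (Inr j))) (ws ! j)))"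
proof -
  have 1: "(\<Prod>k\<in>{..<p} - {i}. pairing (vs ! k) (f ((b(Inl i := s)) (Inl k)))) =
      (\<Prod>k\<in>{..<p} - {i}. pairing (vs ! k) (f (b (Inl k))))" by (rule prod.cong) auto
  have 2: "(b(Inl i := s)) (Inr j) = b (Inr j)" for j by simp
  show ?thesis using genc_update_left[OF assms, of q "vs ! i" ws u "b(Inl i := s)"]
    by (simp only: list_update_id fun_upd_same 1 2)
qed

lemma genc_upd_right:
  assumes "length ws = q" "j < q"
  shows "genc p q (vs, ws) (u, b(Inr j := s)) = pairing (e s) (ws ! j) *
    ((\<Prod>i<p. pairing (vs ! i) (f (b (Inl i)))) * (\<Prod>k\<in>{..<q} - {j}. pairing (e (b (Inr k))) (ws ! k)))"
proof -
  have 1: "(\<Prod>k\<in>{..<q} - {j}. pairing (e ((b(Inr j := s)) (Inr k))) (ws ! k)) =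
      (\<Prod>k\<in>{..<q} - {j}. pairing (e (b (Inr k))) (ws ! k))" by (rule prod.cong) auto
  have 2: "(b(Inr j := s)) (Inl i) = b (Inl i)" for i by simp
  show ?thesis using genc_update_right[OF assms, of p vs "ws ! j" u "b(Inr j := s)"]
    by (simp only: list_update_id fun_upd_same 1 2)
qed

text \<open>Expanding \<open>u\<close> and \<open>w\<close> in the dual bases turns the pairings of
  the Leibniz rule into sums over basis indices. At each position one of the two indices is fixed by
  \<open>b\<close>, and the sum over the other one is a pairing.\<close>

lemma crd_act_gen:
  assumes len: "length vs = p" "length ws = q"
    and u: "\<And>s. n \<le> s \<Longrightarrow> pairing u (f s) = 0" "u = (\<Sum>s<n. scaleV (pairing u (f s)) (e s))"
    and w: "\<And>s. n \<le> s \<Longrightarrow> pairing (e s) w = 0" "w = (\<Sum>s<n. scaleW (pairing (e s) w) (f s))"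
  shows "crd p q (gl_act_gen pairing ([u], [w]) (vs, ws)) = matrix_op p q n (genc 1 1 ([u], [w])) (genc p q (vs, ws))"
proof (intro ext, clarify)
  fix b :: "nat + nat \<Rightarrow> nat"
  \<comment> \<open>\<open>RV i\<close> and \<open>RW j\<close> collect the coordinate factors away
    from the position that is changed.\<close>
  define RV where "RV i = (\<Prod>k\<in>{..<p} - {i}. pairing (vs ! k) (f (b (Inl k)))) * (\<Prod>j<q. pairing (e (b (Inr j))) (ws ! j))" for i
  define RW where "RW j = (\<Prod>i<p. pairing (vs ! i) (f (b (Inl i)))) * (\<Prod>k\<in>{..<q} - {j}. pairing (e (b (Inr k))) (ws ! k))" for j
  have upd: "genc p q (vs, ws) ((), b(Inl i := s)) = pairing (vs ! i) (f s) * RV i" if "i < p" for i s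
    unfolding RV_def by (rule genc_upd_left[OF len(1) that])
  have upd': "genc p q (vs, ws) ((), b(Inr j := s)) = pairing (e s) (ws ! j) * RW j" if "j < q" for j s
    unfolding RW_def by (rule genc_upd_right[OF len(2) that])
  have pw: "pairing v w = (\<Sum>t<n. pairing v (f t) * pairing (e t) w)" for v by (rule pairing_expand[OF w(2)])
  have pu: "pairing u w' = (\<Sum>s<n. pairing u (f s) * pairing (e s) w')" for w'
    by (subst u(2)) (simp add: pairing_sum_left pairing_scale_left)
  have sum_pw: "(\<Sum>s<n. \<Sum>t<n. A s * (pairing v (f t) * pairing (e t) w)) = (\<Sum>s<n. A s) * pairing v w" for A v
    by (subst pw[of v]) (simp only: sum_product)
  have sum_pu: "(\<Sum>t<n. \<Sum>s<n. A t * (pairing u (f s) * pairing (e s) w')) = (\<Sum>t<n. A t) * pairing u w'" for A w'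
    by (subst pu[of w']) (simp only: sum_product)
  have swap3: "(\<Sum>s<n. \<Sum>t<n. \<Sum>i<m. F s t i) = (\<Sum>i<m. \<Sum>s<n. \<Sum>t<n. F s t i)" for F :: "nat \<Rightarrow> nat \<Rightarrow> nat \<Rightarrow> 'k" and m
    by (subst sum.swap[of _ "{..<m}" "{..<n}"], subst sum.swap[of _ "{..<m}" "{..<n}"]) (rule refl)
  \<comment> \<open>The index \<open>b k\<close> may lie beyond the cut-off; then its coefficient is
    zero by the choice of \<open>n\<close>.\<close>
  have delta: "(\<Sum>s<n. g s * (if b k = s then c else 0)) = g (b k) * c" if "n \<le> b k \<Longrightarrow> g (b k) = 0" for g :: "nat \<Rightarrow> 'k" and k c
  proof -
    have "(\<Sum>s<n. g s * (if b k = s then c else 0)) = (\<Sum>s<n. if s = b k then g (b k) * c else 0)"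
      by (rule sum.cong) auto
    then show ?thesis using that by (auto simp: not_less)
  qed
  have "matrix_op p q n (genc 1 1 ([u], [w])) (genc p q (vs, ws)) ((), b)
    = (\<Sum>s<n. \<Sum>t<n. (pairing u (f s) * pairing (e t) w) *
        ((\<Sum>i<p. if b (Inl i) = s then pairing (vs ! i) (f t) * RV i else 0)
         - (\<Sum>j<q. if b (Inr j) = t then pairing (e s) (ws ! j) * RW j else 0)))"
    unfolding matrix_op_def sum_apply fscale_apply
  proof (intro sum.cong refl arg_cong2[where f = "(*)"])
    fix s t
    show "genc 1 1 ([u], [w]) ((), matrix_index s t) = pairing u (f s) * pairing (e t) w" by (simp add: genc_def)
    have "(\<Sum>k\<in>posV p. if b k = s then genc p q (vs, ws) ((), b(k := t)) else 0)
      = (\<Sum>i<p. if b (Inl i) = s then pairing (vs ! i) (f t) * RV i else 0)"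
      by (subst sum.reindex) (auto simp: upd intro!: sum.cong)
    moreover have "(\<Sum>k\<in>posW q. if b k = t then genc p q (vs, ws) ((), b(k := s)) else 0)
      = (\<Sum>j<q. if b (Inr j) = t then pairing (e s) (ws ! j) * RW j else 0)"
      by (subst sum.reindex) (auto simp: upd' intro!: sum.cong)
    ultimately show "transfer_op (posV p) (posW q) s t (genc p q (vs, ws)) ((), b)
      = (\<Sum>i<p. if b (Inl i) = s then pairing (vs ! i) (f t) * RV i else 0)
         - (\<Sum>j<q. if b (Inr j) = t then pairing (e s) (ws ! j) * RW j else 0)"
      by (simp add: transfer_op_def)
  qed
  also have "\<dots> = (\<Sum>s<n. \<Sum>t<n. \<Sum>i<p. (pairing u (f s) * (if b (Inl i) = s then RV i else 0)) * (pairing (vs ! i) (f t) * pairing (e t) w))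
    - (\<Sum>s<n. \<Sum>t<n. \<Sum>j<q. (pairing (e t) w * (if b (Inr j) = t then RW j else 0)) * (pairing u (f s) * pairing (e s) (ws ! j)))"
    unfolding right_diff_distrib sum_subtractf sum_distrib_left
    by (intro arg_cong2[where f = "(-)"] sum.cong refl) auto
  also have "(\<Sum>s<n. \<Sum>t<n. \<Sum>i<p. (pairing u (f s) * (if b (Inl i) = s then RV i else 0)) * (pairing (vs ! i) (f t) * pairing (e t) w))
    = (\<Sum>i<p. \<Sum>s<n. \<Sum>t<n. (pairing u (f s) * (if b (Inl i) = s then RV i else 0)) * (pairing (vs ! i) (f t) * pairing (e t) w))"
    by (rule swap3)
  also have "\<dots> = (\<Sum>i<p. (\<Sum>s<n. pairing u (f s) * (if b (Inl i) = s then RV i else 0)) * pairing (vs ! i) w)"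
    by (simp only: sum_pw)
  also have "\<dots> = (\<Sum>i<p. pairing (vs ! i) w * genc p q (vs[i := u], ws) ((), b))"
    by (intro sum.cong refl) (simp add: delta u(1) genc_update_left[OF len(1)] RV_def)
  also have "(\<Sum>s<n. \<Sum>t<n. \<Sum>j<q. (pairing (e t) w * (if b (Inr j) = t then RW j else 0)) * (pairing u (f s) * pairing (e s) (ws ! j)))
    = (\<Sum>j<q. \<Sum>t<n. \<Sum>s<n. (pairing (e t) w * (if b (Inr j) = t then RW j else 0)) * (pairing u (f s) * pairing (e s) (ws ! j)))"
    unfolding swap3 by (intro sum.cong refl sum.swap)
  also have "\<dots> = (\<Sum>j<q. (\<Sum>t<n. pairing (e t) w * (if b (Inr j) = t then RW j else 0)) * pairing u (ws ! j))"
    by (simp only: sum_pu)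
  also have "\<dots> = (\<Sum>j<q. pairing u (ws ! j) * genc p q (vs, ws[j := w]) ((), b))"
    by (intro sum.cong refl) (simp add: delta w(1) genc_update_right[OF len(2)] RW_def)
  also have "(\<Sum>i<p. pairing (vs ! i) w * genc p q (vs[i := u], ws) ((), b)) - \<dots>
    = crd p q (gl_act_gen pairing ([u], [w]) (vs, ws)) ((), b)"
    by (simp add: gl_act_gen_def crd_simps sum_apply len)
  finally show "crd p q (gl_act_gen pairing ([u], [w]) (vs, ws)) ((), b)
    = matrix_op p q n (genc 1 1 ([u], [w])) (genc p q (vs, ws)) ((), b)" by simp
qed

definition expands :: "'v list \<times> 'w list \<Rightarrow> nat \<Rightarrow> bool" where
  "expands g n \<longleftrightarrow> (\<exists>u w. g = ([u], [w]) \<and>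
      (\<forall>s\<ge>n. pairing u (f s) = 0) \<and> u = (\<Sum>s<n. scaleV (pairing u (f s)) (e s)) \<and>
      (\<forall>s\<ge>n. pairing (e s) w = 0) \<and> w = (\<Sum>s<n. scaleW (pairing (e s) w) (f s)))"

lemma exists_expansion_bound:
  assumes x: "x \<in> carrier (free_space 1 1)"
  obtains n where "n0 \<le> n" "\<And>g. g \<in> Poly_Mapping.keys x \<Longrightarrow> expands g n"
proof -
  have "\<exists>n. \<forall>m\<ge>n. expands g m" if g: "g \<in> Poly_Mapping.keys x" for g
  proof -
    have "length (fst g) = 1" "length (snd g) = 1" using x g by (auto simp: free_space_carrier)
    then obtain u w where uw: "g = ([u], [w])" by (cases g) (auto simp: length_Suc_conv)
    obtain n1 where n1: "\<forall>s\<ge>n1. pairing u (f s) = 0" "\<forall>m\<ge>n1. u = (\<Sum>s<m. scaleV (pairing u (f s)) (e s))"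
      using expansion_left by blast
    obtain n2 where n2: "\<forall>s\<ge>n2. pairing (e s) w = 0" "\<forall>m\<ge>n2. w = (\<Sum>s<m. scaleW (pairing (e s) w) (f s))"
      using expansion_right by blast
    show ?thesis unfolding expands_def
      by (rule exI[of _ "max n1 n2"], intro allI impI exI[of _ u] exI[of _ w] conjI) (use uw n1 n2 in auto)
  qed
  then obtain n where n: "\<And>g m. g \<in> Poly_Mapping.keys x \<Longrightarrow> n g \<le> m \<Longrightarrow> expands g m" by metis
  show thesis
  proof (rule that[of "n0 + (\<Sum>g\<in>Poly_Mapping.keys x. n g)"])
    fix g assume g: "g \<in> Poly_Mapping.keys x"
    then have "n g \<le> (\<Sum>g\<in>Poly_Mapping.keys x. n g)" by (intro member_le_sum) auto
    then show "expands g (n0 + (\<Sum>g\<in>Poly_Mapping.keys x. n g))" by (intro n[OF g]) simp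
  qed simp
qed

text \<open>The generators occurring in \<open>x\<close> may need a larger cut-off than their sum,
  in which high terms can cancel. So the computation uses a common bound \<open>m\<close> for the
  generators and is then cut down to \<open>n\<close>, which is a condition on the class of
  \<open>x\<close> only.\<close>

lemma crd_act:
  assumes x: "x \<in> carrier (free_space 1 1)" and t: "t \<in> carrier (free_space p q)"
    and n: "\<And>s r. crd 1 1 x ((), matrix_index s r) \<noteq> 0 \<Longrightarrow> s < n \<and> r < n"
  shows "crd p q (bilinear_extension (gl_act_gen pairing) x t) = matrix_op p q n (crd 1 1 x) (crd p q t)"
proof -
  obtain m where m: "n \<le> m" "\<And>g. g \<in> Poly_Mapping.keys x \<Longrightarrow> expands g m"
    by (rule exists_expansion_bound[OF x, of n]) blast
  have gen: "crd p q (linear_extension (gl_act_gen pairing g) t) = matrix_op p q m (genc 1 1 g) (crd p q t)"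
    if g: "g \<in> Poly_Mapping.keys x" for g
  proof -
    obtain u w where uw: "g = ([u], [w])" "\<forall>s\<ge>m. pairing u (f s) = 0" "u = (\<Sum>s<m. scaleV (pairing u (f s)) (e s))"
      "\<forall>s\<ge>m. pairing (e s) w = 0" "w = (\<Sum>s<m. scaleW (pairing (e s) w) (f s))" using m(2)[OF g] unfolding expands_def by (elim exE conjE) (erule (4) that)
    have "crd p q (linear_extension (gl_act_gen pairing g) t) = lin_ext (\<lambda>h. crd p q (gl_act_gen pairing g h)) t"
      unfolding crd_def by (rule lin_ext_linear_extension)
    also have "\<dots> = lin_ext (\<lambda>h. matrix_op p q m (genc 1 1 g) (genc p q h)) t"
    proof (rule lin_ext_cong)
      fix h assume "h \<in> Poly_Mapping.keys t"
      then have len: "length (fst h) = p" "length (snd h) = q" using t by (auto simp: free_space_carrier)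
      show "crd p q (gl_act_gen pairing g h) = matrix_op p q m (genc 1 1 g) (genc p q h)"
        using crd_act_gen[OF len _ uw(3) _ uw(5)] uw(2,4) unfolding uw(1) by simp
    qed
    also have "\<dots> = matrix_op p q m (genc 1 1 g) (crd p q t)"
      unfolding crd_def by (rule linear_lin_ext[OF matrix_op_linear, symmetric])
    finally show ?thesis .
  qed
  have "crd p q (bilinear_extension (gl_act_gen pairing) x t)
    = lin_ext (\<lambda>g. crd p q (linear_extension (gl_act_gen pairing g) t)) x"
    unfolding bilinear_extension_def crd_def by (rule lin_ext_linear_extension)
  also have "\<dots> = lin_ext (\<lambda>g. matrix_op p q m (genc 1 1 g) (crd p q t)) x" by (rule lin_ext_cong[OF gen])
  also have "\<dots> = matrix_op p q m (crd 1 1 x) (crd p q t)"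
    unfolding crd_def[of 1 1] by (rule matrix_op_lin_ext[symmetric])
  also have "\<dots> = matrix_op p q n (crd 1 1 x) (crd p q t)" by (rule matrix_op_mono[OF n m(1)])
  finally show ?thesis .
qed

lemma crd_matrix_bound:
  obtains n where "\<And>s r. crd 1 1 x ((), matrix_index s r) \<noteq> 0 \<Longrightarrow> s < n \<and> r < n"
proof -
  obtain n where n: "\<And>m i b k. n \<le> m \<Longrightarrow> crd 1 1 x (i, b) \<noteq> 0 \<Longrightarrow> k \<in> posV 1 \<union> posW 1 \<Longrightarrow> b k < m"
    by (rule tensors_bound[OF crd_tensors]) blast
  show thesis
  proof (rule that[of n])
    fix s r assume nz: "crd 1 1 x ((), matrix_index s r) \<noteq> 0"
    have "matrix_index s r (Inl 0) < n" "matrix_index s r (Inr 0) < n" by (rule n[OF order_refl nz]; simp)+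
    then show "s < n \<and> r < n" by simp
  qed
qed

lemma bilinear_free_space:
  assumes x: "x \<in> carrier (free_space 1 1)" and t: "t \<in> carrier (free_space p q)"
  shows "bilinear_extension (gl_act_gen pairing) x t \<in> carrier (free_space p q)"
  unfolding bilinear_extension_def
proof (intro linear_extension_free_space[OF x] linear_extension_free_space[OF t])
  fix us :: "'v list" and us' :: "'w list" and vs :: "'v list" and ws :: "'w list"
  assume len: "length vs = p" "length ws = q"
  show "gl_act_gen pairing (us, us') (vs, ws) \<in> carrier (free_space p q)"
    unfolding gl_act_gen_def Let_def
    by (intro pm.subspace_diff[OF free_space_subspace] pm.subspace_sum[OF free_space_subspace])
      (use len in \<open>auto intro: single_free_space\<close>)
qed

text \<open>By \<open>crd_act\<close> the coordinates of the result depend only on those of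
  \<open>x\<close> and \<open>t\<close>, so all cosets in the defining union agree.\<close>

lemma act_tc:
  assumes x: "x \<in> carrier (free_space 1 1)" and t: "t \<in> carrier (free_space p q)"
  shows "act (mixed p q) (tc 1 1 x) (tc p q t) = tc p q (bilinear_extension (gl_act_gen pairing) x t)"
proof -
  obtain n where n: "\<And>s r. crd 1 1 x ((), matrix_index s r) \<noteq> 0 \<Longrightarrow> s < n \<and> r < n" by (rule crd_matrix_bound) blast
  have eq: "tc p q (bilinear_extension (gl_act_gen pairing) x' t') = tc p q (bilinear_extension (gl_act_gen pairing) x t)"
    if x': "x' \<in> tc 1 1 x" and t': "t' \<in> tc p q t" for x' t'
  proof -
    have x'': "x' \<in> carrier (free_space 1 1)" "crd 1 1 x' = crd 1 1 x" using x' tc_mem[OF x] by auto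
    have t'': "t' \<in> carrier (free_space p q)" "crd p q t' = crd p q t" using t' tc_mem[OF t] by auto
    have "crd p q (bilinear_extension (gl_act_gen pairing) x' t') = matrix_op p q n (crd 1 1 x') (crd p q t')"
      by (rule crd_act[OF x''(1) t''(1)]) (use n x''(2) in auto)
    also have "\<dots> = crd p q (bilinear_extension (gl_act_gen pairing) x t)"
      unfolding x''(2) t''(2) by (rule crd_act[OF x t n, symmetric])
    finally show ?thesis by (rule tc_eqI[OF bilinear_free_space[OF x''(1) t''(1)] bilinear_free_space[OF x t]])
  qed
  show ?thesis unfolding mixed_tensors_simps(5) using eq tc_self[OF x] tc_self[OF t] by blast
qed

text \<open>The action is a finite combination of matrix units, diagonal ones included, and all of
  these preserve a submodule.\<close>

lemma gl_act_op:
  assumes X: "X \<in> carrier (gl_infinity scaleV scaleW pairing)"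
  shows "\<exists>h. Vector_Spaces.linear fscale fscale h \<and>
      (\<forall>m\<in>carrier (mixed p q). act (mixed p q) X m \<in> carrier (mixed p q) \<and> psi p q (act (mixed p q) X m) = h (psi p q m)) \<and>
      (\<forall>F. tensor_family.submod {()} (posV p) (posW q) F \<longrightarrow> h ` F \<subseteq> F)"
proof -
  obtain x where x: "x \<in> carrier (free_space 1 1)" "X = tc 1 1 x" using X by (auto simp: gl_carrier rcosets_tc)
  obtain n where n: "\<And>s r. crd 1 1 x ((), matrix_index s r) \<noteq> 0 \<Longrightarrow> s < n \<and> r < n" by (rule crd_matrix_bound) blast
  interpret T: tensor_family "{()}" "posV p" "posW q" by (rule tensor_family_pos)
  show ?thesis
  proof (intro exI[of _ "matrix_op p q n (crd 1 1 x)"] conjI ballI allI impI)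
    show "Vector_Spaces.linear fscale fscale (matrix_op p q n (crd 1 1 x))" by (rule matrix_op_linear)
    fix m assume "m \<in> carrier (mixed p q)"
    then obtain t where t: "t \<in> carrier (free_space p q)" "m = tc p q t" by (auto simp: carrier_mixed)
    have b: "bilinear_extension (gl_act_gen pairing) x t \<in> carrier (free_space p q)" by (rule bilinear_free_space[OF x(1) t(1)])
    show "act (mixed p q) X m \<in> carrier (mixed p q)"
      unfolding x(2) t(2) act_tc[OF x(1) t(1)] carrier_mixed using b by blast
    show "psi p q (act (mixed p q) X m) = matrix_op p q n (crd 1 1 x) (psi p q m)"
      unfolding x(2) t(2) act_tc[OF x(1) t(1)] psi_tc[OF b] psi_tc[OF t(1)] by (rule crd_act[OF x(1) t(1) n])
  next
    fix F :: "(unit, nat + nat, 'k) tensor set" assume F: "T.submod F"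
    show "matrix_op p q n (crd 1 1 x) ` F \<subseteq> F"
    proof
      fix v assume "v \<in> matrix_op p q n (crd 1 1 x) ` F"
      then obtain y where y: "y \<in> F" "v = matrix_op p q n (crd 1 1 x) y" by blast
      note sub = T.submodD(1)[OF F]
      show "v \<in> F" unfolding y(2) matrix_op_def
        by (intro fv.subspace_sum[OF sub] fv.subspace_scale[OF sub] T.submod_transfer_op[OF F y(1)])
    qed
  qed
qed

text \<open>The pairing is the trace of the coordinate matrix, so membership in sl can be tested on
  coordinates.\<close>

lemma linear_pairing_eq:
  assumes x: "x \<in> carrier (free_space 1 1)"
  shows "\<exists>n\<ge>n0. linear_pairing pairing x = (\<Sum>s<n. crd 1 1 x ((), matrix_index s s))"
proof -
  obtain m where m: "n0 \<le> m" "\<And>g. g \<in> Poly_Mapping.keys x \<Longrightarrow> expands g m"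
    by (rule exists_expansion_bound[OF x, of n0]) blast
  have "pairing (hd (fst g)) (hd (snd g)) = (\<Sum>s<m. genc 1 1 g ((), matrix_index s s))" if g: "g \<in> Poly_Mapping.keys x" for g
  proof -
    obtain u w where uw: "g = ([u], [w])" "\<forall>s\<ge>m. pairing u (f s) = 0" "u = (\<Sum>s<m. scaleV (pairing u (f s)) (e s))"
      "\<forall>s\<ge>m. pairing (e s) w = 0" "w = (\<Sum>s<m. scaleW (pairing (e s) w) (f s))" using m(2)[OF g] unfolding expands_def by (elim exE conjE) (erule (4) that)
    show ?thesis unfolding uw(1) using pairing_expand[OF uw(5), of u] by (simp add: genc_def)
  qed
  then have "linear_pairing pairing x = (\<Sum>g\<in>Poly_Mapping.keys x. \<Sum>s<m. Poly_Mapping.lookup x g * genc 1 1 g ((), matrix_index s s))"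
    unfolding linear_pairing_def by (simp add: sum_distrib_left)
  also have "\<dots> = (\<Sum>s<m. \<Sum>g\<in>Poly_Mapping.keys x. Poly_Mapping.lookup x g * genc 1 1 g ((), matrix_index s s))"
    by (rule sum.swap)
  also have "\<dots> = (\<Sum>s<m. crd 1 1 x ((), matrix_index s s))"
    by (simp add: crd_def lin_ext_def sum_apply)
  finally show ?thesis using m(1) by blast
qed

text \<open>The witness is the class of the pure tensor of \<open>e s\<close> and
  \<open>f t\<close>, which has trace zero because \<open>s \<noteq> t\<close>.\<close>

lemma sl_op_act:
  assumes st: "s \<noteq> t"
  shows "\<exists>X\<in>carrier (sl_infinity scaleV scaleW pairing). \<forall>m\<in>carrier (mixed p q).
    psi p q (act (mixed p q) X m) = transfer_op (posV p) (posW q) s t (psi p q m)"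
proof
  let ?x = "Poly_Mapping.single ([e s], [f t]) 1 :: ('v, 'w, 'k) prespace"
  have x: "?x \<in> carrier (free_space 1 1)" by (rule single_free_space) auto
  have cx: "crd 1 1 ?x ((), matrix_index i j) = (if i = s \<and> j = t then 1 else 0)" for i j
    by (simp add: crd_simps genc_def dual)
  have "linear_pairing pairing y = 0" if y: "y \<in> tc 1 1 ?x" for y
  proof -
    have y': "y \<in> carrier (free_space 1 1)" "crd 1 1 y = crd 1 1 ?x" using y tc_mem[OF x] by auto
    obtain n where "linear_pairing pairing y = (\<Sum>i<n. crd 1 1 y ((), matrix_index i i))"
      using linear_pairing_eq[OF y'(1)] by blast
    also have "\<dots> = 0" unfolding y'(2) cx using st by (intro sum.neutral) auto
    finally show ?thesis .
  qed
  then show "tc 1 1 ?x \<in> carrier (sl_infinity scaleV scaleW pairing)"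
    using x unfolding sl_carrier gl_carrier rcosets_tc by blast
  show "\<forall>m\<in>carrier (mixed p q). psi p q (act (mixed p q) (tc 1 1 ?x) m) = transfer_op (posV p) (posW q) s t (psi p q m)"
  proof
    fix m assume "m \<in> carrier (mixed p q)"
    then obtain y where y: "y \<in> carrier (free_space p q)" "m = tc p q y" by (auto simp: carrier_mixed)
    have b: "bilinear_extension (gl_act_gen pairing) ?x y \<in> carrier (free_space p q)" by (rule bilinear_free_space[OF x y(1)])
    let ?n = "Suc (max s t)"
    have bound: "i < ?n \<and> j < ?n" if "crd 1 1 ?x ((), matrix_index i j) \<noteq> 0" for i j
      using that unfolding cx by (auto split: if_splits)
    have "psi p q (act (mixed p q) (tc 1 1 ?x) m) = matrix_op p q ?n (crd 1 1 ?x) (crd p q y)"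
      unfolding y(2) act_tc[OF x y(1)] psi_tc[OF b] by (rule crd_act[OF x y(1) bound])
    also have "\<dots> = (\<Sum>i<?n. \<Sum>j<?n. if j = t then (if i = s then transfer_op (posV p) (posW q) i j (crd p q y) else 0) else 0)"
      unfolding matrix_op_def cx by (intro sum.cong refl) (auto simp: fun_eq_iff)
    also have "\<dots> = transfer_op (posV p) (posW q) s t (crd p q y)"
      by (simp add: less_Suc_eq_le)
    finally show "psi p q (act (mixed p q) (tc 1 1 ?x) m) = transfer_op (posV p) (posW q) s t (psi p q m)"
      by (simp only: y(2) psi_tc[OF y(1)])
  qed
qed

lemma tensor_coords_gl: "tensor_coords (posV p) (posW q) (gl_infinity scaleV scaleW pairing) (mixed p q) (psi p q)"
  by (intro tensor_coords.intro tensor_family_pos tensor_coords_axioms.intro coords_mixed psi_range gl_act_op)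
    (use sl_op_act sl_carrier in blast)+

lemma tensor_coords_sl: "tensor_coords (posV p) (posW q) (sl_infinity scaleV scaleW pairing) (mixed p q) (psi p q)"
  by (intro tensor_coords.intro tensor_family_pos tensor_coords_axioms.intro coords_mixed psi_range gl_act_op sl_op_act)
    (simp_all add: sl_carrier)

end

section \<open>Contractions in coordinates\<close>

text \<open>In \<open>nths xs A\<close> the entry at a selected place \<open>i\<close> moves to the
  place numbered by the count of selected places before \<open>i\<close>.\<close>

lemma prod_nths:
  "(\<Prod>k<length (nths xs A). H (nths xs A ! k) k) =
    (\<Prod>i\<in>{..<length xs} \<inter> A. H (xs ! i) (card {i'. i' < i \<and> i' \<in> A}) :: 'k::comm_monoid_mult)"
proof (induction xs rule: rev_induct)
  case (snoc x xs)
  let ?n = "length xs"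
  have len: "length (nths xs A) = card {i'. i' < ?n \<and> i' \<in> A}" by (rule length_nths)
  have old: "(\<Prod>i\<in>{..<?n} \<inter> A. H ((xs @ [x]) ! i) (card {i'. i' < i \<and> i' \<in> A}))
    = (\<Prod>k<length (nths xs A). H (nths xs A ! k) k)"
    unfolding snoc by (rule prod.cong) (auto simp: nth_append)
  show ?case
  proof (cases "?n \<in> A")
    case True
    then have n: "nths (xs @ [x]) A = nths xs A @ [x]" by (simp add: nths_append)
    have "{..<length (xs @ [x])} \<inter> A = insert ?n ({..<?n} \<inter> A)" using True by auto
    then have "(\<Prod>i\<in>{..<length (xs @ [x])} \<inter> A. H ((xs @ [x]) ! i) (card {i'. i' < i \<and> i' \<in> A}))
      = H x (length (nths xs A)) * (\<Prod>k<length (nths xs A). H (nths xs A ! k) k)"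
      using old len by (simp add: nth_append)
    also have "\<dots> = (\<Prod>k<length (nths (xs @ [x]) A). H (nths (xs @ [x]) A ! k) k)"
      unfolding n by (simp add: mult.commute nth_append)
    finally show ?thesis by simp
  next
    case False
    then have n: "nths (xs @ [x]) A = nths xs A" by (simp add: nths_append)
    have "{..<length (xs @ [x])} \<inter> A = {..<?n} \<inter> A" using False by (auto simp: less_Suc_eq)
    then show ?thesis unfolding n using old by simp
  qed
qed simp

lemma disjoint_index_pairs_card:
  assumes "Is \<in> disjoint_index_pairs p q r"
  shows "fst ` set Is \<subseteq> {..<p}" "snd ` set Is \<subseteq> {..<q}" "card (fst ` set Is) = r" "card (snd ` set Is) = r" "length Is = r"
  using assms distinct_card[of "map fst Is"] distinct_card[of "map snd Is"] by (auto simp: disjoint_index_pairs_def)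

lemma length_nths_complement:
  assumes "A \<subseteq> {..<length xs}"
  shows "length (nths xs (- A)) = length xs - card A"
proof -
  have "{i. i < length xs \<and> i \<in> - A} = {..<length xs} - A" by auto
  then show ?thesis using assms by (simp add: length_nths card_Diff_subset finite_subset)
qed

abbreviation pos_pair :: "nat \<times> nat \<Rightarrow> (nat + nat) \<times> (nat + nat)" where
  "pos_pair \<equiv> map_prod Inl Inr"

lemma pairs_pos: "tensor_family.pairs (posV p) (posW q) r = map pos_pair ` disjoint_index_pairs p q r"
proof -
  interpret T: tensor_family "{()}" "posV p" "posW q" by (rule tensor_family_pos)
  have d: "distinct (map fst (map pos_pair Is)) \<longleftrightarrow> distinct (map fst Is)"
    "distinct (map snd (map pos_pair Is)) \<longleftrightarrow> distinct (map snd Is)" for Is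
    by (simp_all add: distinct_map comp_inj_on_iff[symmetric] inj_on_def)
  show ?thesis
  proof (intro subset_antisym subsetI)
    fix Js assume Js: "Js \<in> T.pairs r"
    define Is where "Is = map (map_prod projl projr) Js"
    have "map pos_pair Is = Js"
      unfolding Is_def map_map using Js by (intro map_idI) (auto simp: T.pairs_def)
    moreover have "Is \<in> disjoint_index_pairs p q r"
    proof -
      have "map pos_pair Is \<in> T.pairs r" using Js calculation by simp
      then show ?thesis using d[of Is] by (force simp: T.pairs_def disjoint_index_pairs_def)
    qed
    ultimately show "Js \<in> map pos_pair ` disjoint_index_pairs p q r" by blast
  next
    fix Js assume "Js \<in> map pos_pair ` disjoint_index_pairs p q r"
    then obtain Is where Is: "Js = map pos_pair Is" "Is \<in> disjoint_index_pairs p q r" by blast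
    then show "Js \<in> T.pairs r" using d[of Is] by (auto simp: T.pairs_def disjoint_index_pairs_def)
  qed
qed

lemma disjoint_index_pairs_nonempty: "r \<le> min p q \<Longrightarrow> map (\<lambda>k. (k, k)) [0..<r] \<in> disjoint_index_pairs p q r"
  by (auto simp: disjoint_index_pairs_def o_def)

lemma disjoint_index_pairs_empty: "min p q < r \<Longrightarrow> disjoint_index_pairs p q r = {}"
proof (rule ccontr)
  assume r: "min p q < r" and "disjoint_index_pairs p q r \<noteq> {}"
  then obtain Is where Is: "Is \<in> disjoint_index_pairs p q r" by blast
  note c = disjoint_index_pairs_card[OF Is]
  have "r \<le> p" using card_mono[OF _ c(1)] c(3) by simp
  moreover have "r \<le> q" using card_mono[OF _ c(2)] c(4) by simp
  ultimately show False using r by simp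
qed

text \<open>The place that a surviving position takes in the lists from which the contracted entries
  have been removed.\<close>

definition relabel :: "(nat \<times> nat) list \<Rightarrow> nat + nat \<Rightarrow> nat + nat" where
  "relabel Is = map_sum (\<lambda>i. card {i'. i' < i \<and> i' \<in> - fst ` set Is}) (\<lambda>j. card {j'. j' < j \<and> j' \<in> - snd ` set Is})"

lemma inj_on_rank: "inj_on (\<lambda>i::nat. card {i'. i' < i \<and> i' \<in> A}) A"
proof (rule linorder_inj_onI)
  fix i i' :: nat assume "i < i'" "i \<in> A" "i' \<in> A"
  then have "card {k. k < i \<and> k \<in> A} < card {k. k < i' \<and> k \<in> A}" by (intro psubset_card_mono) auto
  then show "card {k. k < i \<and> k \<in> A} \<noteq> card {k. k < i' \<and> k \<in> A}" by simp
qed auto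

context dual_pair_bases
begin

text \<open>Contracting one pair sums over the dual bases, and the expansion of the covector turns
  this sum into the pairing of the two factors.\<close>

lemma contract_genc:
  assumes "set Is \<subseteq> {..<p} \<times> {..<q}" "distinct (map fst Is)" "distinct (map snd Is)"
  shows "contract (map pos_pair Is) (genc p q (vs, ws)) ((), a) =
    (\<Prod>(i, j)\<leftarrow>Is. pairing (vs ! i) (ws ! j)) *
    ((\<Prod>i\<in>{..<p} - fst ` set Is. pairing (vs ! i) (f (a (Inl i)))) *
     (\<Prod>j\<in>{..<q} - snd ` set Is. pairing (e (a (Inr j))) (ws ! j)))"
  using assms
proof (induction Is arbitrary: a)
  case Nil
  then show ?case by (simp add: genc_def)
next
  case (Cons ij Is)
  obtain i j where ij: "ij = (i, j)" by (cases ij)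
  let ?A = "{..<p} - fst ` set Is" and ?B = "{..<q} - snd ` set Is"
  have i: "i \<in> ?A" and j: "j \<in> ?B" using Cons.prems by (auto simp: ij)
  define C where "C = (\<Prod>(i, j)\<leftarrow>Is. pairing (vs ! i) (ws ! j))"
  define X where "X = (\<Prod>i\<in>?A - {i}. pairing (vs ! i) (f (a (Inl i))))"
  define Y where "Y = (\<Prod>j\<in>?B - {j}. pairing (e (a (Inr j))) (ws ! j))"
  have summand: "contract (map pos_pair Is) (genc p q (vs, ws)) ((), a(Inl i := m, Inr j := m))
    = C * X * Y * (pairing (vs ! i) (f m) * pairing (e m) (ws ! j))" for m
  proof -
    have "(\<Prod>k\<in>?A. pairing (vs ! k) (f ((a(Inl i := m, Inr j := m)) (Inl k)))) = pairing (vs ! i) (f m) * X"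
      unfolding X_def using i by (subst prod.remove[of _ i]) (auto intro!: prod.cong arg_cong2[where f = "(*)"])
    moreover have "(\<Prod>k\<in>?B. pairing (e ((a(Inl i := m, Inr j := m)) (Inr k))) (ws ! k)) = pairing (e m) (ws ! j) * Y"
      unfolding Y_def using j by (subst prod.remove[of _ j]) (auto intro!: prod.cong arg_cong2[where f = "(*)"])
    ultimately show ?thesis using Cons.prems by (subst Cons.IH) (simp_all only: C_def ac_simps, auto)
  qed
  obtain n where n: "\<forall>s\<ge>n. pairing (e s) (ws ! j) = 0" "\<forall>m\<ge>n. ws ! j = (\<Sum>s<m. scaleW (pairing (e s) (ws ! j)) (f s))"
    using expansion_right by blast
  have "contract (map pos_pair (ij # Is)) (genc p q (vs, ws)) ((), a)
    = Sum_any (\<lambda>m. C * X * Y * (pairing (vs ! i) (f m) * pairing (e m) (ws ! j)))"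
    by (simp add: ij trace_at_def summand)
  also have "\<dots> = (\<Sum>m<n. C * X * Y * (pairing (vs ! i) (f m) * pairing (e m) (ws ! j)))"
    by (rule Sum_any_bounded) (use n(1) in \<open>auto simp: not_le[symmetric]\<close>)
  also have "\<dots> = C * X * Y * pairing (vs ! i) (ws ! j)"
    using pairing_expand[of "ws ! j" n "vs ! i"] n(2) by (simp add: sum_distrib_left)
  also have "X = (\<Prod>i\<in>{..<p} - fst ` set (ij # Is). pairing (vs ! i) (f (a (Inl i))))"
    unfolding X_def by (rule prod.cong) (auto simp: ij)
  also have "Y = (\<Prod>j\<in>{..<q} - snd ` set (ij # Is). pairing (e (a (Inr j))) (ws ! j))"
    unfolding Y_def by (rule prod.cong) (auto simp: ij)
  finally show ?case by (simp add: ij C_def ac_simps)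
qed

text \<open>The remaining factors are the same on both sides. They are numbered consecutively by
  \<open>nths\<close>, whereas \<open>contract\<close> keeps the old positions;
  \<open>relabel\<close> mediates.\<close>

lemma crd_contraction_gen:
  assumes Is: "Is \<in> disjoint_index_pairs p q r" and len: "length vs = p" "length ws = q"
  shows "crd (p - r) (q - r) (contraction_gen pairing Is (vs, ws)) ((), a) =
    contract (map pos_pair Is) (genc p q (vs, ws)) ((), a \<circ> relabel Is)"
proof -
  note c = disjoint_index_pairs_card[OF Is]
  have lv: "length (nths vs (- fst ` set Is)) = p - r" "length (nths ws (- snd ` set Is)) = q - r"
    using length_nths_complement[of "fst ` set Is" vs] length_nths_complement[of "snd ` set Is" ws] c len by simp_all
  have "(\<Prod>k<p - r. pairing (nths vs (- fst ` set Is) ! k) (f (a (Inl k))))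
    = (\<Prod>i\<in>{..<p} - fst ` set Is. pairing (vs ! i) (f ((a \<circ> relabel Is) (Inl i))))"
    using prod_nths[where xs = vs and A = "- fst ` set Is" and H = "\<lambda>v k. pairing v (f (a (Inl k)))"]
    by (simp add: lv len relabel_def Diff_eq)
  moreover have "(\<Prod>k<q - r. pairing (e (a (Inr k))) (nths ws (- snd ` set Is) ! k))
    = (\<Prod>j\<in>{..<q} - snd ` set Is. pairing (e ((a \<circ> relabel Is) (Inr j))) (ws ! j))"
    using prod_nths[where xs = ws and A = "- snd ` set Is" and H = "\<lambda>w k. pairing (e (a (Inr k))) w"]
    by (simp add: lv len relabel_def Diff_eq)
  ultimately show ?thesis
    using Is by (subst contract_genc) (simp_all add: disjoint_index_pairs_def contraction_gen_def crd_simps genc_def)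
qed

text \<open>Additivity of contractions is available on \<open>tensors\<close>, where all coordinates
  of generators lie, so the sum over the finite support is handled term by term.\<close>

lemma contract_lin_ext:
  assumes Is: "Is \<in> disjoint_index_pairs p q r"
  shows "contract (map pos_pair Is) (crd p q t) = lin_ext (\<lambda>g. contract (map pos_pair Is) (genc p q g)) t"
proof -
  interpret T: tensor_family "{()}" "posV p" "posW q" by (rule tensor_family_pos)
  have Js: "map pos_pair Is \<in> T.pairs r" using Is pairs_pos by blast
  have gt: "fscale k (genc p q g) \<in> tensors {()} T.L" for k g
    by (rule fv.subspace_scale[OF tensors_subspace]) (cases g, simp add: genc_tensors)
  have "contract (map pos_pair Is) (\<Sum>g\<in>S. fscale (k g) (genc p q g)) =
    (\<Sum>g\<in>S. fscale (k g) (contract (map pos_pair Is) (genc p q g)))" if "finite S" for S k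
    using that
  proof (induction S rule: finite_induct)
    case empty
    have "contract (map pos_pair Is) (fscale 0 0 :: (unit, nat + nat, 'k) tensor) = fscale 0 (contract (map pos_pair Is) 0)"
      by (rule T.contract_scale)
    then show ?case unfolding fv.scale_zero_left sum.empty .
  next
    case (insert g S)
    have "(\<Sum>g\<in>S. fscale (k g) (genc p q g)) \<in> tensors {()} T.L"
      by (rule fv.subspace_sum[OF tensors_subspace gt])
    from T.contract_add[OF gt this Js] show ?case
      unfolding sum.insert[OF insert.hyps] insert.IH T.contract_scale .
  qed
  then show ?thesis unfolding crd_def lin_ext_def by simp
qed

lemma crd_contraction:
  assumes Is: "Is \<in> disjoint_index_pairs p q r" and t: "t \<in> carrier (free_space p q)"
  shows "crd (p - r) (q - r) (linear_extension (contraction_gen pairing Is) t) ((), a) =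
    contract (map pos_pair Is) (crd p q t) ((), a \<circ> relabel Is)"
proof -
  have "crd (p - r) (q - r) (linear_extension (contraction_gen pairing Is) t)
    = lin_ext (\<lambda>g. crd (p - r) (q - r) (contraction_gen pairing Is g)) t"
    unfolding crd_def by (rule lin_ext_linear_extension)
  then have "crd (p - r) (q - r) (linear_extension (contraction_gen pairing Is) t) ((), a)
    = (\<Sum>g\<in>Poly_Mapping.keys t. Poly_Mapping.lookup t g * crd (p - r) (q - r) (contraction_gen pairing Is g) ((), a))"
    by (simp add: lin_ext_def sum_apply)
  also have "\<dots> = (\<Sum>g\<in>Poly_Mapping.keys t. Poly_Mapping.lookup t g * contract (map pos_pair Is) (genc p q g) ((), a \<circ> relabel Is))"
  proof (intro sum.cong refl arg_cong2[where f = "(*)"])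
    fix g assume "g \<in> Poly_Mapping.keys t"
    then have "length (fst g) = p" "length (snd g) = q" using t by (auto simp: free_space_carrier)
    then show "crd (p - r) (q - r) (contraction_gen pairing Is g) ((), a) = contract (map pos_pair Is) (genc p q g) ((), a \<circ> relabel Is)"
      using crd_contraction_gen[OF Is, of "fst g" "snd g"] by simp
  qed
  also have "\<dots> = contract (map pos_pair Is) (crd p q t) ((), a \<circ> relabel Is)"
    unfolding contract_lin_ext[OF Is] by (simp add: lin_ext_def sum_apply)
  finally show ?thesis .
qed

text \<open>\<open>relabel\<close> is injective on the surviving positions, so every tuple on them
  comes from a tuple of the shortened tensor, and no value of the contraction is missed.\<close>

lemma contract_eq_0_iff:
  assumes Is: "Is \<in> disjoint_index_pairs p q r" and t: "t \<in> carrier (free_space p q)"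
  shows "crd (p - r) (q - r) (linear_extension (contraction_gen pairing Is) t) = 0 \<longleftrightarrow>
    contract (map pos_pair Is) (crd p q t) = 0"
proof
  interpret T: tensor_family "{()}" "posV p" "posW q" by (rule tensor_family_pos)
  let ?R = "T.restP (map pos_pair Is) \<union> T.restQ (map pos_pair Is)"
  assume 0: "crd (p - r) (q - r) (linear_extension (contraction_gen pairing Is) t) = 0"
  have Js: "map pos_pair Is \<in> T.pairs r" using Is pairs_pos by blast
  have inj: "inj_on (relabel Is) ?R"
  proof (rule inj_onI)
    have R: "k \<in> Inl ` (- fst ` set Is) \<union> Inr ` (- snd ` set Is)" if "k \<in> ?R" for k
      using that by (force simp: T.restP_def T.restQ_def)
    fix k l assume kl: "k \<in> ?R" "l \<in> ?R" and eq: "relabel Is k = relabel Is l"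
    show "k = l"
    proof (cases k)
      case k: (Inl i)
      then obtain i' where l: "l = Inl i'" using eq by (cases l) (simp_all add: relabel_def)
      have "i \<in> - fst ` set Is" "i' \<in> - fst ` set Is" using R[OF kl(1)] R[OF kl(2)] unfolding k l by blast+
      then show ?thesis using inj_onD[OF inj_on_rank[of "- fst ` set Is"], of i i'] eq
        unfolding k l relabel_def map_sum.simps by blast
    next
      case k: (Inr i)
      then obtain i' where l: "l = Inr i'" using eq by (cases l) (simp_all add: relabel_def)
      have "i \<in> - snd ` set Is" "i' \<in> - snd ` set Is" using R[OF kl(1)] R[OF kl(2)] unfolding k l by blast+
      then show ?thesis using inj_onD[OF inj_on_rank[of "- snd ` set Is"], of i i'] eq
        unfolding k l relabel_def map_sum.simps by blast
    qed
  qed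
  have "contract (map pos_pair Is) (crd p q t) ((), b) = 0" for b
  proof -
    let ?a = "\<lambda>l. b (inv_into ?R (relabel Is) l)"
    have "contract (map pos_pair Is) (crd p q t) ((), b) = contract (map pos_pair Is) (crd p q t) ((), ?a \<circ> relabel Is)"
      by (rule tensorsD(2)[OF T.contract_tensors[OF crd_tensors Js]]) (simp add: inv_into_f_f[OF inj])
    also have "\<dots> = 0" using crd_contraction[OF Is t, of ?a] 0 by simp
    finally show ?thesis .
  qed
  then show "contract (map pos_pair Is) (crd p q t) = 0" by (auto simp: fun_eq_iff)
next
  assume "contract (map pos_pair Is) (crd p q t) = 0"
  then have "crd (p - r) (q - r) (linear_extension (contraction_gen pairing Is) t) ((), a) = 0" for a
    unfolding crd_contraction[OF Is t] by simp
  then show "crd (p - r) (q - r) (linear_extension (contraction_gen pairing Is) t) = 0" by (auto simp: fun_eq_iff)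
qed

lemma contraction_free_space:
  assumes Is: "Is \<in> disjoint_index_pairs p q r" and t: "t \<in> carrier (free_space p q)"
  shows "linear_extension (contraction_gen pairing Is) t \<in> carrier (free_space (p - r) (q - r))"
proof (rule linear_extension_free_space[OF t])
  fix vs :: "'v list" and ws :: "'w list" assume len: "length vs = p" "length ws = q"
  note c = disjoint_index_pairs_card[OF Is]
  show "contraction_gen pairing Is (vs, ws) \<in> carrier (free_space (p - r) (q - r))"
    unfolding contraction_gen_def Let_def fst_conv snd_conv
    by (rule single_free_space)
      (use length_nths_complement[of "fst ` set Is" vs] length_nths_complement[of "snd ` set Is" ws] c len in simp_all)
qed

lemma contraction_tc:
  assumes Is: "Is \<in> disjoint_index_pairs p q r" and t: "t \<in> carrier (free_space p q)"
  shows "contraction scaleV scaleW pairing p q Is (tc p q t)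
    = tc (p - r) (q - r) (linear_extension (contraction_gen pairing Is) t)"
  unfolding contraction_def disjoint_index_pairs_card(5)[OF Is]
proof (rule tc_UN[OF t])
  fix x assume x: "x \<in> carrier (free_space p q)" "crd p q x = crd p q t"
  show "tc (p - r) (q - r) (linear_extension (contraction_gen pairing Is) x)
    = tc (p - r) (q - r) (linear_extension (contraction_gen pairing Is) t)"
  proof (rule tc_eqI[OF contraction_free_space[OF Is x(1)] contraction_free_space[OF Is t]])
    have "crd (p - r) (q - r) (linear_extension (contraction_gen pairing Is) x) ((), a)
      = crd (p - r) (q - r) (linear_extension (contraction_gen pairing Is) t) ((), a)" for a
      unfolding crd_contraction[OF Is x(1)] crd_contraction[OF Is t] x(2) ..
    then show "crd (p - r) (q - r) (linear_extension (contraction_gen pairing Is) x)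
      = crd (p - r) (q - r) (linear_extension (contraction_gen pairing Is) t)" by (auto simp: fun_eq_iff)
  qed
qed

lemma a_kernel_contraction:
  assumes Is: "Is \<in> disjoint_index_pairs p q r"
  shows "a_kernel (mixed p q) (mixed (p - r) (q - r)) (contraction scaleV scaleW pairing p q Is) =
    {T \<in> carrier (mixed p q). contract (map pos_pair Is) (psi p q T) = 0}"
proof -
  have "contraction scaleV scaleW pairing p q Is T = \<zero>\<^bsub>mixed (p - r) (q - r)\<^esub> \<longleftrightarrow>
    contract (map pos_pair Is) (psi p q T) = 0" if T: "T \<in> carrier (mixed p q)" for T
  proof -
    obtain t where t: "t \<in> carrier (free_space p q)" "T = tc p q t" using T by (auto simp: carrier_mixed)
    let ?y = "linear_extension (contraction_gen pairing Is) t"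
    have y: "?y \<in> carrier (free_space (p - r) (q - r))" by (rule contraction_free_space[OF Is t(1)])
    have "tc (p - r) (q - r) ?y = tc (p - r) (q - r) 0 \<longleftrightarrow> crd (p - r) (q - r) ?y = 0"
    proof
      assume "tc (p - r) (q - r) ?y = tc (p - r) (q - r) 0"
      then have "psi (p - r) (q - r) (tc (p - r) (q - r) ?y) = psi (p - r) (q - r) (tc (p - r) (q - r) 0)" by simp
      then show "crd (p - r) (q - r) ?y = 0" unfolding psi_tc[OF y] psi_tc[OF zero_free_space] crd_simps .
    next
      assume "crd (p - r) (q - r) ?y = 0"
      then show "tc (p - r) (q - r) ?y = tc (p - r) (q - r) 0"
        by (intro tc_eqI[OF y zero_free_space]) (simp only: crd_simps)
    qed
    then show ?thesis
      unfolding t(2) contraction_tc[OF Is t(1)] mixed_tensors_simps(2) tc_zero[symmetric] psi_tc[OF t(1)]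
      using contract_eq_0_iff[OF Is t(1)] by simp
  qed
  then show ?thesis unfolding a_kernel_def' by blast
qed

lemma contraction_kernel_pos:
  "v \<in> tensor_family.contraction_kernel {()} (posV p) (posW q) r \<longleftrightarrow>
    v \<in> tensors {()} (posV p \<union> posW q) \<and> (\<forall>Is\<in>disjoint_index_pairs p q r. contract (map pos_pair Is) v = 0)"
proof -
  interpret T: tensor_family "{()}" "posV p" "posW q" by (rule tensor_family_pos)
  show ?thesis unfolding T.contraction_kernel_def pairs_pos by auto
qed

lemma socle_filtration_mixed:
  assumes "L = gl_infinity scaleV scaleW pairing \<or> L = sl_infinity scaleV scaleW pairing"
  shows "socle_filtration L (mixed p q) r =
    {T \<in> carrier (mixed p q). \<forall>Is\<in>disjoint_index_pairs p q r. contract (map pos_pair Is) (psi p q T) = 0}"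
proof -
  have "tensor_coords (posV p) (posW q) L (mixed p q) (psi p q)"
    using assms tensor_coords_gl tensor_coords_sl by blast
  then interpret tensor_coords "posV p" "posW q" L "mixed p q" "psi p q" .
  show ?thesis unfolding socle_filtration_eq contraction_kernel_pos using psi_range by blast
qed

text \<open>The pure tensor with all factors \<open>e 0\<close> and \<open>f 0\<close> survives
  contraction along the pairs \<open>(k, k)\<close> with \<open>k < r\<close>: its coordinate at the
  zero tuple is a product of ones.\<close>

lemma socle_filtration_proper:
  assumes L: "L = gl_infinity scaleV scaleW pairing" and r: "r \<le> min p q"
  shows "socle_filtration L (mixed p q) r \<noteq> carrier (mixed p q)"
proof
  assume eq: "socle_filtration L (mixed p q) r = carrier (mixed p q)"
  let ?vs = "replicate p (e 0)" and ?ws = "replicate q (f 0)" and ?Is = "map (\<lambda>k. (k, k)) [0..<r]"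
  let ?t = "Poly_Mapping.single (?vs, ?ws) 1 :: ('v, 'w, 'k) prespace"
  have t: "?t \<in> carrier (free_space p q)" by (rule single_free_space) auto
  have Is: "?Is \<in> disjoint_index_pairs p q r" by (rule disjoint_index_pairs_nonempty[OF r])
  have "tc p q ?t \<in> socle_filtration L (mixed p q) r" unfolding eq carrier_mixed using t by blast
  then have "contract (map pos_pair ?Is) (psi p q (tc p q ?t)) = 0"
    using socle_filtration_mixed[of L p q r] L Is by blast
  then have "contract (map pos_pair ?Is) (genc p q (?vs, ?ws)) = 0"
    unfolding psi_tc[OF t] crd_simps fv.scale_one .
  then have "contract (map pos_pair ?Is) (genc p q (?vs, ?ws)) ((), \<lambda>_. 0) = 0" by simp
  moreover have "contract (map pos_pair ?Is) (genc p q (?vs, ?ws)) ((), \<lambda>_. 0) = 1"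
  proof (subst contract_genc)
    have "(\<Prod>(i, j)\<leftarrow>?Is. pairing (?vs ! i) (?ws ! j)) = (\<Prod>k\<leftarrow>[0..<r]. 1)"
      unfolding map_map by (intro arg_cong[where f = prod_list] map_cong refl) (use r in \<open>auto simp: dual\<close>)
    also have "\<dots> = 1" by (induction r) auto
    finally have 1: "(\<Prod>(i, j)\<leftarrow>?Is. pairing (?vs ! i) (?ws ! j)) = 1" .
    show "(\<Prod>(i, j)\<leftarrow>?Is. pairing (?vs ! i) (?ws ! j)) *
      ((\<Prod>i\<in>{..<p} - fst ` set ?Is. pairing (?vs ! i) (f 0)) * (\<Prod>j\<in>{..<q} - snd ` set ?Is. pairing (e 0) (?ws ! j))) = 1"
      unfolding 1 by (simp add: dual)
  qed (use Is in \<open>auto simp: disjoint_index_pairs_def\<close>)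
  ultimately show False by simp
qed

end

theorem theorem2p2:
  fixes scaleV :: "'k::field_char_0 \<Rightarrow> 'v::ab_group_add \<Rightarrow> 'v"
    and scaleW :: "'k \<Rightarrow> 'w::ab_group_add \<Rightarrow> 'w"
    and pairing :: "'v \<Rightarrow> 'w \<Rightarrow> 'k"
    and p q :: nat
  assumes "countable_dual_pair scaleV scaleW pairing"
  shows "has_loewy_length (gl_infinity scaleV scaleW pairing)
           (mixed_tensors scaleV scaleW pairing p q) (min p q + 1) \<and>
    (\<forall>r\<in>{1..min p q}.
       socle_filtration (gl_infinity scaleV scaleW pairing)
         (mixed_tensors scaleV scaleW pairing p q) r =
       (\<Inter>Is\<in>disjoint_index_pairs p q r.
          a_kernel (mixed_tensors scaleV scaleW pairing p q)
            (mixed_tensors scaleV scaleW pairing (p - r) (q - r))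
            (contraction scaleV scaleW pairing p q Is))) \<and>
    (\<forall>r. socle_filtration (sl_infinity scaleV scaleW pairing)
           (mixed_tensors scaleV scaleW pairing p q) r =
         socle_filtration (gl_infinity scaleV scaleW pairing)
           (mixed_tensors scaleV scaleW pairing p q) r)"
proof -
  interpret countable_dual_pair scaleV scaleW pairing by (rule assms)
  obtain e :: "nat \<Rightarrow> 'v" and f :: "nat \<Rightarrow> 'w" where ef: "\<And>s t. pairing (e s) (f t) = (if s = t then 1 else 0)"
    "V.span (range e) = UNIV" "W.span (range f) = UNIV" using dual_bases by blast
  interpret dual_pair_bases scaleV scaleW pairing e f by unfold_locales (use ef in auto)
  let ?gl = "gl_infinity scaleV scaleW pairing"
  have "has_loewy_length ?gl (mixed p q) (min p q + 1)"
    unfolding has_loewy_length_def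
  proof (intro conjI allI impI)
    \<comment> \<open>There are no \<open>min p q + 1\<close> disjoint pairs, so the condition is
      vacuous.\<close>
    show "socle_filtration ?gl (mixed p q) (min p q + 1) = carrier (mixed p q)"
      unfolding socle_filtration_mixed[OF disjI1[OF refl]] using disjoint_index_pairs_empty[of p q "min p q + 1"] by simp
    fix k assume "0 < k \<and> socle_filtration ?gl (mixed p q) k = carrier (mixed p q)"
    then have "\<not> k \<le> min p q" using socle_filtration_proper[OF refl, of k p q] by blast
    then show "min p q + 1 \<le> k" by linarith
  qed simp
  moreover have "socle_filtration ?gl (mixed p q) r =
      (\<Inter>Is\<in>disjoint_index_pairs p q r. a_kernel (mixed p q) (mixed (p - r) (q - r)) (contraction scaleV scaleW pairing p q Is))"
    if r: "r \<in> {1..min p q}" for r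
  proof -
    \<comment> \<open>An intersection over no collections at all would be the universe instead of
      the carrier; for \<open>r\<close> up to \<open>min p q\<close> the diagonal pairs exclude
      this.\<close>
    have ne: "disjoint_index_pairs p q r \<noteq> {}" using disjoint_index_pairs_nonempty[of r p q] r by auto
    have "(\<Inter>Is\<in>disjoint_index_pairs p q r. a_kernel (mixed p q) (mixed (p - r) (q - r)) (contraction scaleV scaleW pairing p q Is))
      = (\<Inter>Is\<in>disjoint_index_pairs p q r. {T \<in> carrier (mixed p q). contract (map pos_pair Is) (psi p q T) = 0})"
      by (rule INF_cong[OF refl a_kernel_contraction])
    also have "\<dots> = socle_filtration ?gl (mixed p q) r"
      unfolding socle_filtration_mixed[OF disjI1[OF refl]] using ne by blast
    finally show ?thesis by simp
  qed
  moreover have "socle_filtration (sl_infinity scaleV scaleW pairing) (mixed p q) r = socle_filtration ?gl (mixed p q) r" for r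
    unfolding socle_filtration_mixed[OF disjI1[OF refl]] socle_filtration_mixed[OF disjI2[OF refl]] ..
  ultimately show ?thesis by blast
qed

end
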